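(* Let $\mathbf{g}_1\in V(\Omega)'$, $g_2\in H^{-1}(\Omega)$, and $T_d\in H^1(\Omega)$ with $T_d=0$ on $\partial\Omega\setminus\Gamma_\gamma$ in the trace sense. Then there exist $\varepsilon_1,\varepsilon_2,\varepsilon_3>0$ such that if $$\mathrm{Re}\in(0,\varepsilon_1),\qquad \mathrm{Pr}\in\left(0,\frac{\varepsilon_2}{\mathrm{Re}}\right),\qquad \mathrm{Gr}\in(0,\varepsilon_3\,\mathrm{Re}),$$ and $\mathbf{g}_1$, $g_2$, and $T_d$ are sufficiently small, there is a unique weak solution $(\mathbf{v},T)\in V(\Omega)\times H^1(\Omega)$ to the Boussinesq system with data $\mathbf{g}_1,g_2,T_d$.
   Context: $\Omega\subset\mathbb{R}^2$ is an open bounded set with Lipschitz boundary $\partial\Omega$, and $\Gamma_\gamma\subset\partial\Omega$ is an open and connected boundary portion with nonzero one-dimensional Lebesgue measure. $V(\Omega)=\{\boldsymbol\varphi\in H^1(\Omega;\mathbb{R}^2): \operatorname{div}\boldsymbol\varphi=0 \text{ a.e. in }\Omega,\ \boldsymbol\varphi=0\text{ on }\partial\Omega\text{ in the trace sense}\}$ with norm $\|\boldsymbol\varphi\|_{V(\Omega)}=(\int_\Omega|\nabla\boldsymbol\varphi|^2dx)^{1/2}$; $H_0^1(\Omega)$ is the space of functions in $H^1(\Omega)$ with zero trace on $\partial\Omega$, with norm $(\int_\Omega|\nabla\varphi|^2dx)^{1/2}$. Their duals are $V(\Omega)'$ and $H^{-1}(\Omega)$. $\mathbf{e}=(0,1)$;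 $\mathrm{Re},\mathrm{Pr},\mathrm{Gr}$ are the Reynolds, Prandtl and Grashof numbers. The Boussinesq system is: $\mathbf{v}\cdot\nabla\mathbf{v}-\frac1{\mathrm{Re}}\Delta\mathbf{v}+\nabla p-\frac{\mathrm{Gr}}{\mathrm{Re}^2}T\mathbf{e}=\mathbf{g}_1$ and $\nabla\cdot\mathbf{v}=0$ in $\Omega$, $\mathbf{v}=0$ on $\partial\Omega$; $\mathbf{v}\cdot\nabla T-\frac{1}{\mathrm{Re}\,\mathrm{Pr}}\Delta T=g_2$ in $\Omega$, $T=T_d$ on $\Gamma_\gamma$, $T=0$ on $\partial\Omega\setminus\Gamma_\gamma$. A weak solution is a pair $(\mathbf{v},T)\in V(\Omega)\times H^1(\Omega)$ with $T-T_d\in H_0^1(\Omega)$ such that $$\int_\Omega(\mathbf{v}\cdot\nabla\mathbf{v})\cdot\boldsymbol\varphi\,dx+\frac1{\mathrm{Re}}\int_\Omega\nabla\mathbf{v}:\nabla\boldsymbol\varphi\,dx-\frac{\mathrm{Gr}}{\mathrm{Re}^2}\int_\Omega T\mathbf{e}\cdot\boldsymbol\varphi\,dx=\langle\mathbf{g}_1,\boldsymbol\varphi\rangle\quad\forall\boldsymbol\varphi\in V(\Omega),$$ $$\int_\Omega(\mathbf{v}\cdot\nabla T)\varphi\,dx+\frac1{\mathrm{Re}\,\mathrm{Pr}}\int_\Omega\nabla T\cdot\nabla\varphi\,dx=\langle g_2,\varphi\rangle\quad\forall\varphi\in H_0^1(\Omega).$$ Here $(\mathbf{v}\cdot\nabla\mathbf{w})_j=\sum_i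 v_i\partial_i w_j$. *)

theory Defs
  imports "HOL-Analysis.Analysis"
begin

text \<open>One-dimensional Hausdorff measure. Coverings use bounded sets only, since \<^const>\<open>diameter\<close>
  is meaningful only for these. The set function is a metric outer measure, hence countably additive
  on the Borel sets; in dimension one no normalising constant is needed.\<close>

definition hausdorff1_pre :: "real \<Rightarrow> (real^2) set \<Rightarrow> ennreal" where
  "hausdorff1_pre d A =
     (INF S \<in> {S :: nat \<Rightarrow> (real^2) set.
                 A \<subseteq> (\<Union>n. S n) \<and> (\<forall>n. bounded (S n) \<and> diameter (S n) \<le> d)}.
        \<Sum>n. ennreal (diameter (S n)))"

definition hausdorff1_outer :: "(real^2) set \<Rightarrow> ennreal" where
  "hausdorff1_outer A = (SUP d \<in> {0<..}. hausdorff1_pre d A)"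

definition hausdorff1 :: "(real^2) measure" where
  "hausdorff1 = measure_of UNIV (sets borel) hausdorff1_outer"

definition boundary_measure :: "(real^2) set \<Rightarrow> (real^2) measure" where
  "boundary_measure \<Omega> = restrict_space hausdorff1 (frontier \<Omega>)"

text \<open>Near each boundary point, in suitable orthonormal coordinates (given by \<open>R\<close>), the set is
  the strict epigraph of a Lipschitz function.\<close>

definition lipschitz_boundary :: "(real^2) set \<Rightarrow> bool" where
  "lipschitz_boundary \<Omega> \<longleftrightarrow>
     (\<forall>p \<in> frontier \<Omega>. \<exists>U R \<gamma> L.
        open U \<and> p \<in> U \<and> orthogonal_transformation (R :: real^2 \<Rightarrow> real^2) \<and>
        lipschitz_on L UNIV (\<gamma> :: real \<Rightarrow> real) \<and>
        \<Omega> \<inter> U = {x \<in> U. \<gamma> (R x $ 1) < R x $ 2})"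

definition partial :: "2 \<Rightarrow> (real^2 \<Rightarrow> real) \<Rightarrow> real^2 \<Rightarrow> real" where
  "partial i f x = frechet_derivative f (at x) (axis i 1)"

primrec Ck :: "nat \<Rightarrow> (real^2 \<Rightarrow> real) \<Rightarrow> bool" where
  "Ck 0 f = continuous_on UNIV f"
| "Ck (Suc k) f = ((\<forall>x. f differentiable (at x)) \<and> (\<forall>i. Ck k (partial i f)))"

definition smooth :: "(real^2 \<Rightarrow> real) \<Rightarrow> bool" where
  "smooth f \<longleftrightarrow> (\<forall>k. Ck k f)"

definition test_functions :: "(real^2) set \<Rightarrow> (real^2 \<Rightarrow> real) set" where
  "test_functions \<Omega> =
     {\<psi>. smooth \<psi> \<and> compact (closure {x. \<psi> x \<noteq> 0}) \<and> closure {x. \<psi> x \<noteq> 0} \<subseteq> \<Omega>}"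

definition L2 :: "(real^2) measure \<Rightarrow> (real^2 \<Rightarrow> real) set" where
  "L2 M = {f \<in> borel_measurable M. integrable M (\<lambda>x. (f x)\<^sup>2)}"

text \<open>Elements of the function spaces below are functions on the whole plane of which only the
  values on \<open>\<Omega>\<close> matter, and these only up to null sets.\<close>

definition has_weak_grad :: "(real^2) set \<Rightarrow> (real^2 \<Rightarrow> real) \<Rightarrow> (real^2 \<Rightarrow> real^2) \<Rightarrow> bool" where
  "has_weak_grad \<Omega> u G \<longleftrightarrow>
     (\<forall>i. (\<lambda>x. G x $ i) \<in> L2 (lebesgue_on \<Omega>)) \<and>
     (\<forall>\<psi> \<in> test_functions \<Omega>. \<forall>i.
        (\<integral>x. u x * partial i \<psi> x \<partial>lebesgue_on \<Omega>) = - (\<integral>x. G x $ i * \<psi> x \<partial>lebesgue_on \<Omega>))"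

definition H1 :: "(real^2) set \<Rightarrow> (real^2 \<Rightarrow> real) set" where
  "H1 \<Omega> = {u \<in> L2 (lebesgue_on \<Omega>). \<exists>G. has_weak_grad \<Omega> u G}"

text \<open>For \<open>u\<close> in \<^const>\<open>H1\<close> the weak gradient is unique up to null sets, so the choice made here
  does not affect integrals or almost-everywhere statements.\<close>

definition wgrad :: "(real^2) set \<Rightarrow> (real^2 \<Rightarrow> real) \<Rightarrow> real^2 \<Rightarrow> real^2" where
  "wgrad \<Omega> u = (SOME G. has_weak_grad \<Omega> u G)"

definition h1_norm :: "(real^2) set \<Rightarrow> (real^2 \<Rightarrow> real) \<Rightarrow> real" where
  "h1_norm \<Omega> u =
     sqrt ((\<integral>x. (u x)\<^sup>2 \<partial>lebesgue_on \<Omega>) + (\<integral>x. (norm (wgrad \<Omega> u x))\<^sup>2 \<partial>lebesgue_on \<Omega>))"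

text \<open>The trace operator from \<open>H\<^sup>1(\<Omega>)\<close> to \<open>L\<^sup>2(\<partial>\<Omega>)\<close>, as a relation: the extension by continuity of
  the restriction map on functions smooth up to the boundary.\<close>

definition has_trace :: "(real^2) set \<Rightarrow> (real^2 \<Rightarrow> real) \<Rightarrow> (real^2 \<Rightarrow> real) \<Rightarrow> bool" where
  "has_trace \<Omega> u w \<longleftrightarrow>
     u \<in> H1 \<Omega> \<and> w \<in> L2 (boundary_measure \<Omega>) \<and>
     (\<exists>f. (\<forall>n. smooth (f n)) \<and>
        (\<lambda>n. h1_norm \<Omega> (\<lambda>x. f n x - u x)) \<longlonglongrightarrow> 0 \<and>
        (\<lambda>n. \<integral>\<^sup>+x. ennreal ((f n x - w x)\<^sup>2) \<partial>boundary_measure \<Omega>) \<longlonglongrightarrow> 0)"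

definition zero_trace_on :: "(real^2) set \<Rightarrow> (real^2) set \<Rightarrow> (real^2 \<Rightarrow> real) \<Rightarrow> bool" where
  "zero_trace_on \<Omega> A u \<longleftrightarrow>
     (\<exists>w. has_trace \<Omega> u w \<and> (AE x in boundary_measure \<Omega>. x \<in> A \<longrightarrow> w x = 0))"

definition H10 :: "(real^2) set \<Rightarrow> (real^2 \<Rightarrow> real) set" where
  "H10 \<Omega> = {u \<in> H1 \<Omega>. zero_trace_on \<Omega> (frontier \<Omega>) u}"

definition h10_norm :: "(real^2) set \<Rightarrow> (real^2 \<Rightarrow> real) \<Rightarrow> real" where
  "h10_norm \<Omega> u = sqrt (\<integral>x. (norm (wgrad \<Omega> u x))\<^sup>2 \<partial>lebesgue_on \<Omega>)"

text \<open>Entry \<open>(j, i)\<close> of the weak Jacobian is \<open>\<partial>\<^sub>i v\<^sub>j\<close>. The inner product and norm of the type of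
  matrices are the Frobenius ones.\<close>

definition wjac :: "(real^2) set \<Rightarrow> (real^2 \<Rightarrow> real^2) \<Rightarrow> real^2 \<Rightarrow> real^2^2" where
  "wjac \<Omega> v x = (\<chi> j. wgrad \<Omega> (\<lambda>y. v y $ j) x)"

definition V :: "(real^2) set \<Rightarrow> (real^2 \<Rightarrow> real^2) set" where
  "V \<Omega> = {v. (\<forall>j. (\<lambda>x. v x $ j) \<in> H1 \<Omega>) \<and>
             (AE x in lebesgue_on \<Omega>. (\<Sum>i\<in>UNIV. wjac \<Omega> v x $ i $ i) = 0) \<and>
             (\<forall>j. zero_trace_on \<Omega> (frontier \<Omega>) (\<lambda>x. v x $ j))}"

definition V_norm :: "(real^2) set \<Rightarrow> (real^2 \<Rightarrow> real^2) \<Rightarrow> real" where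
  "V_norm \<Omega> v = sqrt (\<integral>x. (norm (wjac \<Omega> v x))\<^sup>2 \<partial>lebesgue_on \<Omega>)"

text \<open>Bounded linear functionals on a space \<open>X\<close> of functions with norm \<open>N\<close>; their values outside
  \<open>X\<close> are irrelevant. Boundedness forces equal values on functions that agree almost everywhere.\<close>

definition dual_space ::
  "('a \<Rightarrow> 'b::real_vector) set \<Rightarrow> (('a \<Rightarrow> 'b) \<Rightarrow> real) \<Rightarrow> (('a \<Rightarrow> 'b) \<Rightarrow> real) set" where
  "dual_space X N =
     {g. (\<forall>\<phi>\<in>X. \<forall>\<psi>\<in>X. g (\<lambda>x. \<phi> x + \<psi> x) = g \<phi> + g \<psi>) \<and>
         (\<forall>c. \<forall>\<phi>\<in>X. g (\<lambda>x. c *\<^sub>R \<phi> x) = c * g \<phi>) \<and>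
         (\<exists>C. \<forall>\<phi>\<in>X. \<bar>g \<phi>\<bar> \<le> C * N \<phi>)}"

definition dual_norm ::
  "('a \<Rightarrow> 'b::real_vector) set \<Rightarrow> (('a \<Rightarrow> 'b) \<Rightarrow> real) \<Rightarrow> (('a \<Rightarrow> 'b) \<Rightarrow> real) \<Rightarrow> real" where
  "dual_norm X N g = (SUP \<phi> \<in> {\<phi> \<in> X. N \<phi> \<le> 1}. \<bar>g \<phi>\<bar>)"

definition e_vec :: "real^2" where
  "e_vec = axis 2 1"

text \<open>With the above convention for the Jacobian, \<open>v \<cdot> \<nabla>w\<close> is the matrix-vector product of the
  Jacobian of \<open>w\<close> with \<open>v\<close>.\<close>

definition weak_solution ::
  "(real^2) set \<Rightarrow> real \<Rightarrow> real \<Rightarrow> real \<Rightarrow> ((real^2 \<Rightarrow> real^2) \<Rightarrow> real) \<Rightarrow>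
   ((real^2 \<Rightarrow> real) \<Rightarrow> real) \<Rightarrow> (real^2 \<Rightarrow> real) \<Rightarrow> (real^2 \<Rightarrow> real^2) \<Rightarrow> (real^2 \<Rightarrow> real) \<Rightarrow> bool" where
  "weak_solution \<Omega> Rey Pra Gra g1 g2 Td v T \<longleftrightarrow>
     v \<in> V \<Omega> \<and> T \<in> H1 \<Omega> \<and> (\<lambda>x. T x - Td x) \<in> H10 \<Omega> \<and>
     (\<forall>\<phi> \<in> V \<Omega>.
        (\<integral>x. (wjac \<Omega> v x *v v x) \<bullet> \<phi> x \<partial>lebesgue_on \<Omega>)
        + 1 / Rey * (\<integral>x. wjac \<Omega> v x \<bullet> wjac \<Omega> \<phi> x \<partial>lebesgue_on \<Omega>)
        - Gra / Rey\<^sup>2 * (\<integral>x. (T x *\<^sub>R e_vec) \<bullet> \<phi> x \<partial>lebesgue_on \<Omega>) = g1 \<phi>) \<and>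
     (\<forall>\<phi> \<in> H10 \<Omega>.
        (\<integral>x. (v x \<bullet> wgrad \<Omega> T x) * \<phi> x \<partial>lebesgue_on \<Omega>)
        + 1 / (Rey * Pra) * (\<integral>x. wgrad \<Omega> T x \<bullet> wgrad \<Omega> \<phi> x \<partial>lebesgue_on \<Omega>) = g2 \<phi>)"

end

theory Submission
  imports Defs
begin

text \<open>After multiplication by \<open>Rey\<close> and \<open>Rey * Pra\<close> the system is a small perturbation of a linear
  elliptic one in the energy space \<open>V \<times> H\<^sub>0\<^sup>1\<close>. A contraction argument yields a solution that is unique
  in the unit ball. The transport terms vanish when a solution is tested with itself, whence
  every solution lies in that ball.

  Functions with zero trace are limits of smooth functions whose boundary values tend to zero
  in \<open>L\<^sup>2\<close>. The inequalities needed (Poincare, Ladyzhenskaya, and the antisymmetry of the transport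
  terms) are proved for smooth functions by restriction to lines parallel to the axes, with remainders
  that are quadratic in the boundary values. Eilenberg's inequality controls the sums over the end points of the
  slices by integrals with respect to the Hausdorff measure.\<close>

section \<open>Contractive variational problems for semidefinite forms\<close>

text \<open>A zero trace provides smooth approximants that need not vanish on the boundary; their
  boundary values are small only in the mean square. The slice estimates are therefore applied to
  \<open>f^2\<close> or \<open>g f^2\<close>: what is left on the boundary is an integral of
  \<open>f^2\<close>, which tends to zero along the approximation.

  Dimension two enters through Ladyzhenskaya's inequality. It embeds the zero-trace space into L4,
  and a product of two L4 functions and one L2 gradient is integrable, which makes the transport
  terms bounded trilinear forms.

  These terms are quadratic in the unknown and contract only on a ball, so uniqueness among all
  solutions requires the separate a priori bound. The unknown is \<open>T - Td\<close> instead of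
  \<open>T\<close>, so that it may be used as a test function; the price is terms with
  \<open>Td\<close> that are constant or linear in the unknown and small with \<open>Td\<close>.

  Origin of the constants: the velocity transport term consists of four scalar forms, each costing
  \<open>emb^2\<close>. A parameter below \<open>1 / (64 * emb^2)\<close> turns the total into
  \<open>1 / 16\<close>, and few enough such terms occur for the Lipschitz constant to stay below
  \<open>1 / 2\<close>.\<close>

lemma quadratic_nonneg_discriminant:
  fixes a b c :: real
  assumes "\<And>t. 0 \<le> a + 2 * t * b + t\<^sup>2 * c"
  shows "b\<^sup>2 \<le> a * c"
proof (cases "c = 0")
  case True
  show ?thesis
  proof (cases "b = 0")
    case False
    have "0 \<le> a + 2 * (- (a + 1) / (2 * b)) * b + (- (a + 1) / (2 * b))\<^sup>2 * c"
      by (rule assms)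
    also have "\<dots> = - 1" using False True by (simp add: field_simps)
    finally show ?thesis by simp
  qed (use True in simp)
next
  case False
  \<comment> \<open>If \<open>c\<close> were negative, the quadratic would be negative for large
    \<open>t\<close>. The chosen \<open>t\<close> is at least 1 and makes \<open>- c * t\<close>
    exceed \<open>2 * \<bar>b\<bar> + \<bar>a\<bar>\<close>, so that the leading term beats the
    other two.\<close>
  have "0 \<le> c"
  proof (rule ccontr)
    assume "\<not> 0 \<le> c"
    then have c: "c < 0" by simp
    define t where "t = 1 + \<bar>a\<bar> + 2 * \<bar>b\<bar> / (- c) + \<bar>a\<bar> / (- c)"
    have t1: "1 \<le> t" 
    proof -
      have "0 \<le> 2 * \<bar>b\<bar> / (- c)" "0 \<le> \<bar>a\<bar> / (- c)" using c by (auto intro: divide_nonneg_neg)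
      then show ?thesis unfolding t_def by linarith
    qed
    have ct: "2 * \<bar>b\<bar> + \<bar>a\<bar> - c \<le> - c * t"
    proof -
      have "- c * t = - c + (- c) * \<bar>a\<bar> + 2 * \<bar>b\<bar> + \<bar>a\<bar>" using c unfolding t_def by (simp add: field_simps)
      then show ?thesis using c by (simp add: mult_nonpos_nonneg)
    qed
    have "(2 * \<bar>b\<bar> + \<bar>a\<bar> - c) * t \<le> (- c * t) * t" using ct t1 by (intro mult_right_mono) auto
    then have "t\<^sup>2 * c \<le> c * t - 2 * (\<bar>b\<bar> * t) - \<bar>a\<bar> * t"
      by (simp add: algebra_simps power2_eq_square)
    moreover have "\<bar>a\<bar> \<le> \<bar>a\<bar> * t" "c * t \<le> c"
      using t1 c mult_left_mono[of 1 t "\<bar>a\<bar>"] mult_left_mono_neg[of 1 t c] by auto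
    moreover have "t * b \<le> \<bar>b\<bar> * t" using t1 mult_left_mono[of b "\<bar>b\<bar>" t] by (simp add: mult.commute)
    ultimately have "a + 2 * t * b + t\<^sup>2 * c < 0"
      using c by linarith
    with assms[of t] show False by simp
  qed
  with False have c: "0 < c" by simp
  have "0 \<le> a + 2 * (- b / c) * b + (- b / c)\<^sup>2 * c" by (rule assms)
  also have "\<dots> = a - b\<^sup>2 / c" using c by (simp add: field_simps power2_eq_square)
  finally show ?thesis using c by (simp add: field_simps)
qed

text \<open>Vector space laws are not required: all
  computations take place after pairing with the form. Elements at distance zero are not identified,
  so that functions defined up to null sets need no quotient.\<close>

locale form_space =
  fixes X :: "'v set" and add :: "'v \<Rightarrow> 'v \<Rightarrow> 'v" and smul :: "real \<Rightarrow> 'v \<Rightarrow> 'v"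
    and B :: "'v \<Rightarrow> 'v \<Rightarrow> real"
  assumes nonempty: "X \<noteq> {}"
    and add_closed: "u \<in> X \<Longrightarrow> v \<in> X \<Longrightarrow> add u v \<in> X"
    and smul_closed: "u \<in> X \<Longrightarrow> smul c u \<in> X"
    and B_sym: "u \<in> X \<Longrightarrow> v \<in> X \<Longrightarrow> B u v = B v u"
    and B_add: "u \<in> X \<Longrightarrow> v \<in> X \<Longrightarrow> w \<in> X \<Longrightarrow> B (add u v) w = B u w + B v w"
    and B_smul: "u \<in> X \<Longrightarrow> w \<in> X \<Longrightarrow> B (smul c u) w = c * B u w"
    and B_nonneg: "u \<in> X \<Longrightarrow> 0 \<le> B u u"
begin

definition N :: "'v \<Rightarrow> real" where "N u = sqrt (B u u)"
definition sub :: "'v \<Rightarrow> 'v \<Rightarrow> 'v" where "sub u v = add u (smul (- 1) v)"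

lemma sub_closed: "u \<in> X \<Longrightarrow> v \<in> X \<Longrightarrow> sub u v \<in> X"
  by (simp add: sub_def add_closed smul_closed)

lemma B_sub: "u \<in> X \<Longrightarrow> v \<in> X \<Longrightarrow> w \<in> X \<Longrightarrow> B (sub u v) w = B u w - B v w"
  by (simp add: sub_def B_add B_smul smul_closed)

lemma B_add_right: "u \<in> X \<Longrightarrow> v \<in> X \<Longrightarrow> w \<in> X \<Longrightarrow> B w (add u v) = B w u + B w v"
  by (metis B_add B_sym add_closed)

lemma B_smul_right: "u \<in> X \<Longrightarrow> w \<in> X \<Longrightarrow> B w (smul c u) = c * B w u"
  by (metis B_smul B_sym smul_closed)

lemma B_sub_right: "u \<in> X \<Longrightarrow> v \<in> X \<Longrightarrow> w \<in> X \<Longrightarrow> B w (sub u v) = B w u - B w v"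
  by (metis B_sub B_sym sub_closed)

lemmas B_simps = B_add B_smul B_sub B_add_right B_smul_right B_sub_right
  add_closed smul_closed sub_closed

lemma N_nonneg: "u \<in> X \<Longrightarrow> 0 \<le> N u"
  by (simp add: N_def B_nonneg)

lemma N_sq: "u \<in> X \<Longrightarrow> (N u)\<^sup>2 = B u u"
  by (simp add: N_def B_nonneg)

lemma Cauchy_Schwarz:
  assumes u: "u \<in> X" and v: "v \<in> X"
  shows "\<bar>B u v\<bar> \<le> N u * N v"
proof -
  have "0 \<le> B u u + 2 * t * B u v + t\<^sup>2 * B v v" for t
  proof -
    have "0 \<le> B (add u (smul t v)) (add u (smul t v))"
      by (rule B_nonneg) (use u v in \<open>simp add: B_simps\<close>)
    also have "\<dots> = B u u + 2 * t * B u v + t\<^sup>2 * B v v"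
      using u v by (simp add: B_simps B_sym[of v u] power2_eq_square algebra_simps)
    finally show ?thesis .
  qed
  then have "(B u v)\<^sup>2 \<le> B u u * B v v" by (rule quadratic_nonneg_discriminant)
  then have "sqrt ((B u v)\<^sup>2) \<le> sqrt (B u u * B v v)" by (rule real_sqrt_le_mono)
  then show ?thesis by (simp add: N_def real_sqrt_mult)
qed

lemma N_add:
  assumes u: "u \<in> X" and v: "v \<in> X"
  shows "N (add u v) \<le> N u + N v"
proof (rule power2_le_imp_le)
  have "(N (add u v))\<^sup>2 = (N u)\<^sup>2 + 2 * B u v + (N v)\<^sup>2"
    using u v by (simp add: N_sq B_simps B_sym[of v u])
  also have "\<dots> \<le> (N u)\<^sup>2 + 2 * (N u * N v) + (N v)\<^sup>2"
    using Cauchy_Schwarz[OF u v] by simp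
  finally show "(N (add u v))\<^sup>2 \<le> (N u + N v)\<^sup>2" by (simp add: power2_sum)
qed (use u v N_nonneg in auto)

lemma N_smul: "u \<in> X \<Longrightarrow> N (smul c u) = \<bar>c\<bar> * N u"
  by (simp add: N_def B_simps real_sqrt_mult flip: mult.assoc)

lemma N_sub_triangle:
  assumes a: "a \<in> X" and b: "b \<in> X" and c: "c \<in> X"
  shows "N (sub a c) \<le> N (sub a b) + N (sub b c)"
proof -
  have "B (sub a c) (sub a c) = B (add (sub a b) (sub b c)) (add (sub a b) (sub b c))"
    using a b c by (simp add: B_simps)
  then have "N (sub a c) = N (add (sub a b) (sub b c))" by (simp add: N_def)
  then show ?thesis using N_add[of "sub a b" "sub b c"] a b c by (simp add: sub_closed)
qed

lemma N_sub_commute: "u \<in> X \<Longrightarrow> v \<in> X \<Longrightarrow> N (sub u v) = N (sub v u)"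
  by (simp add: N_def B_simps)

lemma N_le_sub:
  assumes u: "u \<in> X" and v: "v \<in> X"
  shows "N u \<le> N v + N (sub u v)"
proof -
  have "B u u = B (add v (sub u v)) (add v (sub u v))"
    using u v by (simp add: B_simps)
  then have "N u = N (add v (sub u v))" by (simp add: N_def)
  then show ?thesis using N_add[of v "sub u v"] u v by (simp add: sub_closed)
qed

definition linear_fun :: "('v \<Rightarrow> real) \<Rightarrow> bool" where
  "linear_fun g \<longleftrightarrow> (\<forall>u\<in>X. \<forall>v\<in>X. g (add u v) = g u + g v) \<and> (\<forall>c. \<forall>u\<in>X. g (smul c u) = c * g u)"

definition complete_form :: bool where
  "complete_form \<longleftrightarrow> (\<forall>s. range s \<subseteq> X \<longrightarrow>
     (\<forall>e>0. \<exists>K::nat. \<forall>m\<ge>K. \<forall>n\<ge>K. N (sub (s m) (s n)) < e) \<longrightarrow>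
     (\<exists>l\<in>X. (\<lambda>n. N (sub (s n) l)) \<longlonglongrightarrow> 0))"

lemma B_tendsto:
  assumes s: "range s \<subseteq> X" and l: "l \<in> X" and lim: "(\<lambda>n. N (sub (s n) l)) \<longlonglongrightarrow> 0" and w: "w \<in> X"
  shows "(\<lambda>n. B (s n) w) \<longlonglongrightarrow> B l w"
proof -
  have sn: "s n \<in> X" for n using s by auto
  have "norm (B (s n) w - B l w) \<le> N (sub (s n) l) * N w" for n
    using Cauchy_Schwarz[of "sub (s n) l" w] sn l w by (simp add: B_simps)
  moreover have "(\<lambda>n. N (sub (s n) l) * N w) \<longlonglongrightarrow> 0"
    using tendsto_mult_right[OF lim, of "N w"] by simp
  ultimately have "(\<lambda>n. B (s n) w - B l w) \<longlonglongrightarrow> 0"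
    by (rule_tac Lim_null_comparison[rotated]) auto
  then show ?thesis by (simp add: LIM_zero_cancel)
qed

text \<open>Minimisation of \<open>J u = B u u - 2 * g u\<close>: by the parallelogram identity a
  minimising sequence is Cauchy. The limit is not shown to attain the minimum; the variation in
  direction \<open>w\<close> is taken along the sequence, and only the resulting inequality is
  passed to the limit. No decomposition into kernel and complement occurs, so a seminorm causes no
  difficulty.\<close>

theorem Riesz_representation:
  assumes complete: complete_form and lin: "linear_fun g"
    and bdd: "\<And>u. u \<in> X \<Longrightarrow> \<bar>g u\<bar> \<le> C * N u"
  shows "\<exists>u\<in>X. \<forall>w\<in>X. B u w = g w"
proof -
  define J where "J u = B u u - 2 * g u" for u
  have g_add: "g (add u v) = g u + g v" if "u \<in> X" "v \<in> X" for u v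
    using lin that by (simp add: linear_fun_def)
  have g_smul: "g (smul c u) = c * g u" if "u \<in> X" for u c
    using lin that by (simp add: linear_fun_def)
  have J_lower: "- C\<^sup>2 \<le> J u" if "u \<in> X" for u
  proof -
    have "0 \<le> (N u - C)\<^sup>2" by simp
    then show ?thesis using bdd[OF that] N_sq[OF that]
      unfolding J_def power2_diff by (simp add: algebra_simps abs_le_iff)
  qed
  have bddJ: "bdd_below (J ` X)" using J_lower by (meson bdd_belowI2)
  define m where "m = (INF u\<in>X. J u)"
  have m_le: "m \<le> J u" if "u \<in> X" for u
    unfolding m_def using bddJ that by (rule cINF_lower)
  have "\<exists>u\<in>X. J u < m + 1 / real (Suc n)" for n
  proof -
    have "(INF u\<in>X. J u) < m + 1 / real (Suc n)" by (simp add: m_def)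
    then show ?thesis using cINF_less_iff[OF nonempty bddJ] by blast
  qed
  then obtain s where s: "\<And>n. s n \<in> X" and Js: "\<And>n. J (s n) < m + 1 / real (Suc n)"
    by metis
  \<comment> \<open>The parallelogram identity; the midpoint has \<open>J\<close> at least
    \<open>m\<close>, and four times this lower bound is split between the two excesses.\<close>
  have par: "B (sub u v) (sub u v) \<le> 2 * (J u - m) + 2 * (J v - m)" if "u \<in> X" "v \<in> X" for u v
  proof -
    have "B (sub u v) (sub u v) = 2 * J u + 2 * J v - 4 * J (smul (1/2) (add u v))"
      using that by (simp add: J_def B_simps g_smul g_add algebra_simps B_sym[of v u])
    also have "\<dots> \<le> 2 * (J u - m) + 2 * (J v - m)"
      using m_le[of "smul (1/2) (add u v)"] that by (simp add: B_simps)
    finally show ?thesis .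
  qed
  have "\<exists>K. \<forall>m\<ge>K. \<forall>n\<ge>K. N (sub (s m) (s n)) < e" if e: "e > 0" for e
  proof -
    \<comment> \<open>Beyond \<open>K\<close> both excesses over \<open>m\<close> are below
      \<open>1 / K\<close>, so \<open>par\<close> bounds the squared distance by
      \<open>4 / K\<close>, which is less than \<open>e^2\<close>.\<close>
    obtain K :: nat where K: "4 / e\<^sup>2 < real K" using reals_Archimedean2 by blast
    show ?thesis
    proof (intro exI allI impI)
      fix i j assume ij: "i \<ge> K" "j \<ge> K"
      have "0 < 4 / e\<^sup>2" using e by simp
      then have K0: "0 < real K" using K by linarith
      have "1 / real (Suc i) < 1 / real K" "1 / real (Suc j) < 1 / real K"
        using ij K0 by (auto simp: field_simps)
      then have "J (s i) - m < 1 / real K" "J (s j) - m < 1 / real K"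
        using Js[of i] Js[of j] by linarith+
      then have "B (sub (s i) (s j)) (sub (s i) (s j)) < 2 * (1 / real K) + 2 * (1 / real K)"
        using par[OF s s, of i j] by (smt (verit))
      also have "2 * (1 / real K) + 2 * (1 / real K) = 4 * (1 / real K)" by simp
      also have "4 * (1 / real K) = 4 / real K" by simp
      also have "\<dots> < e\<^sup>2" using K K0 e by (simp add: field_simps)
      finally have "(N (sub (s i) (s j)))\<^sup>2 < e\<^sup>2" using s by (simp add: N_sq sub_closed)
      then show "N (sub (s i) (s j)) < e" using e by (rule power_less_imp_less_base[OF _ less_imp_le])
    qed
  qed
  then obtain l where l: "l \<in> X" and lim: "(\<lambda>n. N (sub (s n) l)) \<longlonglongrightarrow> 0"
    using complete s unfolding complete_form_def by (metis image_subsetI)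
  have "B l w = g w" if w: "w \<in> X" for w
  proof -
    \<comment> \<open>The explicit leading 0 is the coefficient \<open>a\<close> of
      \<open>quadratic_nonneg_discriminant\<close>; with it the square of \<open>B l w - g w\<close>
      is at most zero.\<close>
    have "0 \<le> 0 + 2 * t * (B l w - g w) + t\<^sup>2 * B w w" for t
    proof -
      have "- (1 / real (Suc n)) \<le> 2 * t * (B (s n) w - g w) + t\<^sup>2 * B w w" for n
      proof -
        have "m \<le> J (add (s n) (smul t w))" using s w by (intro m_le) (simp add: B_simps)
        also have "\<dots> = J (s n) + 2 * t * (B (s n) w - g w) + t\<^sup>2 * B w w"
          using s[of n] w by (simp add: J_def B_simps g_smul g_add B_sym[of w "s n"] algebra_simps power2_eq_square)
        finally show ?thesis using Js[of n] by linarith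
      qed
      moreover have "(\<lambda>n. 2 * t * (B (s n) w - g w) + t\<^sup>2 * B w w) \<longlonglongrightarrow> 2 * t * (B l w - g w) + t\<^sup>2 * B w w"
        using B_tendsto[OF _ l lim w] s by (intro tendsto_intros) auto
      moreover have "(\<lambda>n. - (1 / real (Suc n))) \<longlonglongrightarrow> - 0"
        by (intro tendsto_minus LIMSEQ_Suc lim_1_over_n)
      ultimately show ?thesis using LIMSEQ_le[of "\<lambda>n. - (1 / real (Suc n))"] by fastforce
    qed
    then have "(B l w - g w)\<^sup>2 \<le> 0 * B w w" by (rule quadratic_nonneg_discriminant)
    then show ?thesis by simp
  qed
  with l show ?thesis by blast
qed

lemma geometric_Cauchy:
  assumes s: "\<And>n. s n \<in> X" and q: "0 \<le> q" "q < 1"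
    and step: "\<And>n. N (sub (s (Suc n)) (s n)) \<le> D * q ^ n"
    and e: "e > 0"
  shows "\<exists>K. \<forall>m\<ge>K. \<forall>n\<ge>K. N (sub (s m) (s n)) < e"
proof -
  have D: "0 \<le> D" using step[of 0] N_nonneg[of "sub (s (Suc 0)) (s 0)"] s by (simp add: sub_closed)
  have tail: "N (sub (s (n + k)) (s n)) \<le> D * q ^ n * (\<Sum>i<k. q ^ i)" for n k
  proof (induction k)
    case 0
    have "B (sub (s n) (s n)) (sub (s n) (s n)) = 0" using s by (simp add: B_simps)
    then show ?case by (simp add: N_def)
  next
    case (Suc k)
    have "N (sub (s (n + Suc k)) (s n)) \<le> N (sub (s (n + Suc k)) (s (n + k))) + N (sub (s (n + k)) (s n))"
      by (rule N_sub_triangle) (rule s)+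
    also have "\<dots> \<le> D * q ^ (n + k) + D * q ^ n * (\<Sum>i<k. q ^ i)"
      using Suc step[of "n + k"] by simp
    finally show ?case by (simp add: algebra_simps power_add)
  qed
  have tail': "N (sub (s (n + k)) (s n)) \<le> D / (1 - q) * q ^ n" for n k
  proof -
    have "(\<Sum>i<k. q ^ i) = (1 - q ^ k) / (1 - q)" using q by (simp add: sum_gp_strict)
    also have "\<dots> \<le> 1 / (1 - q)" using q by (intro divide_right_mono) auto
    finally have "D * q ^ n * (\<Sum>i<k. q ^ i) \<le> D * q ^ n * (1 / (1 - q))"
      using D q by (intro mult_left_mono) auto
    with tail[of n k] show ?thesis by (simp add: mult.commute)
  qed
  have "(\<lambda>n. D / (1 - q) * q ^ n) \<longlonglongrightarrow> D / (1 - q) * 0"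
    using q by (intro tendsto_mult tendsto_const LIMSEQ_realpow_zero) auto
  then have "\<forall>\<^sub>F n in sequentially. D / (1 - q) * q ^ n < e / 2"
    using e by (intro order_tendstoD(2)[of _ "D / (1 - q) * 0"]) auto
  then obtain K where K: "D / (1 - q) * q ^ K < e / 2" by (auto simp: eventually_sequentially)
  show ?thesis
  proof (intro exI allI impI)
    fix m n assume "m \<ge> K" "n \<ge> K"
    then have "N (sub (s m) (s K)) \<le> D / (1 - q) * q ^ K" "N (sub (s n) (s K)) \<le> D / (1 - q) * q ^ K"
      using tail'[of K "m - K"] tail'[of K "n - K"] by (simp_all del: times_divide_eq_left)
    then have "N (sub (s m) (s K)) < e / 2" "N (sub (s n) (s K)) < e / 2" using K by linarith+
    then show "N (sub (s m) (s n)) < e"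
      using N_sub_triangle[of "s m" "s K" "s n"] N_sub_commute[of "s n" "s K"] s by fastforce
  qed
qed

text \<open>For \<open>u\<close> in the unit ball, Riesz representation turns the functional
  \<open>F u\<close> into an element \<open>R u\<close>. The bound on \<open>F\<close> makes
  \<open>R\<close> map the ball into itself and the Lipschitz condition makes it a contraction, so
  Banach's iteration converges. As \<open>N\<close> is only a seminorm, the fixed point is expressed
  by the equation tested against every \<open>w\<close>, not by an equality of elements.\<close>

theorem contractive_Lax_Milgram:
  assumes complete: complete_form
    and lin: "\<And>u. u \<in> X \<Longrightarrow> linear_fun (F u)"
    and bdd: "\<And>u w. u \<in> X \<Longrightarrow> w \<in> X \<Longrightarrow> N u \<le> 1 \<Longrightarrow> \<bar>F u w\<bar> \<le> N w"
    and lip: "\<And>u v w. u \<in> X \<Longrightarrow> v \<in> X \<Longrightarrow> w \<in> X \<Longrightarrow> N u \<le> 1 \<Longrightarrow> N v \<le> 1 \<Longrightarrow>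
                \<bar>F u w - F v w\<bar> \<le> q * N (sub u v) * N w"
    and q: "0 \<le> q" "q < 1"
  shows "\<exists>u\<in>X. N u \<le> 1 \<and> (\<forall>w\<in>X. B u w = F u w)"
proof -
  have "\<exists>v\<in>X. \<forall>w\<in>X. B v w = F u w" if "u \<in> X" "N u \<le> 1" for u
    using Riesz_representation[OF complete lin[OF that(1)], of 1] bdd[OF that(1) _ that(2)] by simp
  then obtain R where R: "\<And>u. u \<in> X \<Longrightarrow> N u \<le> 1 \<Longrightarrow> R u \<in> X"
    and BR: "\<And>u w. u \<in> X \<Longrightarrow> N u \<le> 1 \<Longrightarrow> w \<in> X \<Longrightarrow> B (R u) w = F u w" by metis
  \<comment> \<open>Testing with \<open>R u\<close> itself gives
    \<open>(N (R u))^2 \<le> N (R u)\<close>.\<close>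
  have NR: "N (R u) \<le> 1" if u: "u \<in> X" "N u \<le> 1" for u
  proof (rule ccontr)
    assume *: "\<not> N (R u) \<le> 1"
    have "(N (R u))\<^sup>2 \<le> N (R u)"
      using BR[OF u R[OF u]] bdd[OF u(1) R[OF u] u(2)] N_sq[OF R[OF u]] by simp
    with * show False using mult_strict_right_mono[of 1 "N (R u)" "N (R u)"] by (simp add: power2_eq_square)
  qed
  have contr: "N (sub (R u) (R v)) \<le> q * N (sub u v)"
    if u: "u \<in> X" "N u \<le> 1" and v: "v \<in> X" "N v \<le> 1" for u v
  proof -
    let ?d = "sub (R u) (R v)"
    have d: "?d \<in> X" using R u v by (simp add: sub_closed)
    have "(N ?d)\<^sup>2 = F u ?d - F v ?d"
      unfolding N_sq[OF d] using R[OF u] R[OF v] d BR[OF u d] BR[OF v d] by (simp add: B_sub)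
    also have "\<dots> \<le> q * N (sub u v) * N ?d" using lip[OF u(1) v(1) d u(2) v(2)] by simp
    finally have "N ?d * N ?d \<le> (q * N (sub u v)) * N ?d" by (simp add: power2_eq_square)
    moreover have "0 \<le> q * N (sub u v)" using q N_nonneg u v by (simp add: sub_closed)
    ultimately show ?thesis using N_nonneg[OF d]
      by (metis mult_right_le_imp_le order_le_less)
  qed
  obtain z where z: "z \<in> X" using nonempty by blast
  \<comment> \<open>The structure has no zero element; \<open>smul 0 z\<close> is a point of
    seminorm zero and hence an admissible start in the unit ball.\<close>
  define s where "s n = (R ^^ n) (smul 0 z)" for n
  have s: "s n \<in> X \<and> N (s n) \<le> 1" for n
  proof (induction n)
    case 0
    have "smul 0 z \<in> X" using z by (rule smul_closed)
    moreover have "N (smul 0 z) = 0" using z by (simp add: N_smul)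
    ultimately show ?case by (simp add: s_def)
  next
    case (Suc n) then show ?case by (simp add: s_def R NR)
  qed
  have sX: "s n \<in> X" and sN: "N (s n) \<le> 1" for n using s by auto
  have Rs: "R (s n) = s (Suc n)" for n by (simp add: s_def)
  have step: "N (sub (s (Suc n)) (s n)) \<le> N (sub (s 1) (s 0)) * q ^ n" for n
  proof (induction n)
    case 0 then show ?case by simp
  next
    case (Suc n)
    have "N (sub (s (Suc (Suc n))) (s (Suc n))) \<le> q * N (sub (s (Suc n)) (s n))"
      using contr[OF sX sN sX sN, of "Suc n" n] by (simp add: Rs)
    also have "\<dots> \<le> q * (N (sub (s 1) (s 0)) * q ^ n)" using Suc q by (intro mult_left_mono)
    finally show ?case by (simp add: algebra_simps)
  qed
  have "\<forall>e>0. \<exists>K. \<forall>m\<ge>K. \<forall>n\<ge>K. N (sub (s m) (s n)) < e"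
    using geometric_Cauchy[OF sX q step] by blast
  then obtain l where l: "l \<in> X" and lim: "(\<lambda>n. N (sub (s n) l)) \<longlonglongrightarrow> 0"
    using complete sX unfolding complete_form_def by (metis image_subsetI)
  have "N l \<le> 1 + N (sub (s n) l)" for n
    using N_le_sub[OF l sX, of n] sN[of n] N_sub_commute[OF l sX, of n] by simp
  moreover have "(\<lambda>n. 1 + N (sub (s n) l)) \<longlonglongrightarrow> 1 + 0" by (intro tendsto_intros lim)
  ultimately have Nl: "N l \<le> 1" by (intro LIMSEQ_le_const[of _ 1]) auto
  have "B l w = F l w" if w: "w \<in> X" for w
  proof -
    have "(\<lambda>n. B (s (Suc n)) w) \<longlonglongrightarrow> B l w"
      using B_tendsto[OF _ l lim w] sX by (intro LIMSEQ_Suc) auto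
    moreover have "(\<lambda>n. B (s (Suc n)) w) \<longlonglongrightarrow> F l w"
    proof -
      have "norm (B (s (Suc n)) w - F l w) \<le> q * N (sub (s n) l) * N w" for n
        using lip[OF sX l w sN Nl, of n] BR[OF sX sN w, of n] by (simp add: Rs)
      moreover have "(\<lambda>n. q * N (sub (s n) l) * N w) \<longlonglongrightarrow> q * 0 * N w"
        by (intro tendsto_intros lim)
      ultimately have "(\<lambda>n. B (s (Suc n)) w - F l w) \<longlonglongrightarrow> 0"
        by (rule_tac Lim_null_comparison[rotated]) auto
      then show ?thesis by (simp add: LIM_zero_cancel)
    qed
    ultimately show ?thesis by (rule LIMSEQ_unique)
  qed
  with l Nl show ?thesis by blast
qed

text \<open>The difference of the equations is tested with the difference of the solutions. The
  Lipschitz bound is required only for the given pair, and the result is distance zero, which later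
  has to be converted into equality almost everywhere.\<close>

lemma contractive_solution_unique:
  assumes u: "u \<in> X" "N u \<le> 1" "\<And>w. w \<in> X \<Longrightarrow> B u w = F u w"
    and v: "v \<in> X" "N v \<le> 1" "\<And>w. w \<in> X \<Longrightarrow> B v w = F v w"
    and lip: "\<And>w. w \<in> X \<Longrightarrow> \<bar>F u w - F v w\<bar> \<le> q * N (sub u v) * N w"
    and q: "q < 1"
  shows "N (sub u v) = 0"
proof (rule ccontr)
  assume *: "N (sub u v) \<noteq> 0"
  let ?d = "sub u v"
  have d: "?d \<in> X" using u v by (simp add: sub_closed)
  then have pos: "0 < N ?d" using * N_nonneg[OF d] by simp
  have "(N ?d)\<^sup>2 = F u ?d - F v ?d"
    unfolding N_sq[OF d] using u v d by (simp add: B_sub)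
  also have "\<dots> \<le> q * (N ?d)\<^sup>2" using lip[OF d] by (simp add: power2_eq_square mult.assoc)
  finally have "(1 - q) * (N ?d)\<^sup>2 \<le> 0" by (simp add: algebra_simps)
  then show False using q pos by (simp add: mult_le_0_iff)
qed

end

section \<open>Square integrable functions\<close>

text \<open>The vector-valued counterpart of \<open>L2\<close>, so that functions and their
  gradients are covered by one theory.\<close>

definition sq_int :: "'a measure \<Rightarrow> ('a \<Rightarrow> 'b::euclidean_space) set" where
  "sq_int M = {f \<in> borel_measurable M. integrable M (\<lambda>x. (norm (f x))\<^sup>2)}"

definition ip :: "'a measure \<Rightarrow> ('a \<Rightarrow> 'b::euclidean_space) \<Rightarrow> ('a \<Rightarrow> 'b) \<Rightarrow> real" where
  "ip M f g = (\<integral>x. f x \<bullet> g x \<partial>M)"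

definition nrm :: "'a measure \<Rightarrow> ('a \<Rightarrow> 'b::euclidean_space) \<Rightarrow> real" where
  "nrm M f = sqrt (\<integral>x. (norm (f x))\<^sup>2 \<partial>M)"

lemma L2_eq_sq_int: "L2 M = sq_int M"
  by (simp add: L2_def sq_int_def)

lemma sq_int_measurable: "f \<in> sq_int M \<Longrightarrow> f \<in> borel_measurable M"
  by (simp add: sq_int_def)

lemma sq_int_integrable: "f \<in> sq_int M \<Longrightarrow> integrable M (\<lambda>x. (norm (f x))\<^sup>2)"
  by (simp add: sq_int_def)

lemma sq_int_norm_mult:
  fixes f :: "'a \<Rightarrow> 'b::euclidean_space" and g :: "'a \<Rightarrow> 'c::euclidean_space"
  assumes f: "f \<in> sq_int M" and g: "g \<in> sq_int M"
  shows "integrable M (\<lambda>x. norm (f x) * norm (g x))"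
proof (rule Bochner_Integration.integrable_bound)
  show "integrable M (\<lambda>x. (norm (f x))\<^sup>2 + (norm (g x))\<^sup>2)"
    using f g by (intro Bochner_Integration.integrable_add sq_int_integrable)
  show "(\<lambda>x. norm (f x) * norm (g x)) \<in> borel_measurable M" using f g by (auto dest!: sq_int_measurable)
  have "a * b \<le> a\<^sup>2 + b\<^sup>2" if "0 \<le> a" "0 \<le> b" for a b :: real
    using sum_squares_bound[of a b] mult_nonneg_nonneg[OF that] by linarith
  then show "AE x in M. norm (norm (f x) * norm (g x)) \<le> norm ((norm (f x))\<^sup>2 + (norm (g x))\<^sup>2)"
    by auto
qed

lemma sq_int_inner:
  assumes f: "f \<in> sq_int M" and g: "g \<in> sq_int M"
  shows "integrable M (\<lambda>x. f x \<bullet> g x)"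
proof (rule Bochner_Integration.integrable_bound[OF sq_int_norm_mult[OF f g]])
  show "(\<lambda>x. f x \<bullet> g x) \<in> borel_measurable M" using f g by (auto dest!: sq_int_measurable)
qed (auto simp: Cauchy_Schwarz_ineq2)

lemma sq_int_mult:
  fixes f g :: "'a \<Rightarrow> real"
  assumes "f \<in> sq_int M" "g \<in> sq_int M"
  shows "integrable M (\<lambda>x. f x * g x)"
  using sq_int_inner[OF assms] by simp

lemma sq_int_bounded:
  assumes g: "g \<in> sq_int M" and f: "f \<in> borel_measurable M"
    and le: "AE x in M. norm (f x) \<le> c * norm (g x)"
  shows "f \<in> sq_int M"
proof -
  have "integrable M (\<lambda>x. (norm (f x))\<^sup>2)"
  proof (rule Bochner_Integration.integrable_bound)
    show "integrable M (\<lambda>x. c\<^sup>2 * (norm (g x))\<^sup>2)" using g by (intro integrable_mult_right sq_int_integrable)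
    show "AE x in M. norm ((norm (f x))\<^sup>2) \<le> norm (c\<^sup>2 * (norm (g x))\<^sup>2)"
      using le
    proof eventually_elim
      case (elim x)
      then show ?case using power_mono[OF elim, of 2] by (simp add: power_mult_distrib)
    qed
  qed (use f in measurable)
  with f show ?thesis by (simp add: sq_int_def)
qed

lemma sq_int_scaleR: "f \<in> sq_int M \<Longrightarrow> (\<lambda>x. c *\<^sub>R f x) \<in> sq_int M"
  by (rule sq_int_bounded[of f _ _ "\<bar>c\<bar>"]) (auto dest: sq_int_measurable)

lemma sq_int_add:
  assumes f: "f \<in> sq_int M" and g: "g \<in> sq_int M"
  shows "(\<lambda>x. f x + g x) \<in> sq_int M"
proof -
  have "(norm (f x + g x))\<^sup>2 = (norm (f x))\<^sup>2 + 2 * (f x \<bullet> g x) + (norm (g x))\<^sup>2" for x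
    by (simp add: power2_norm_eq_inner inner_add inner_commute)
  moreover have "integrable M (\<lambda>x. (norm (f x))\<^sup>2 + 2 * (f x \<bullet> g x) + (norm (g x))\<^sup>2)"
    by (intro Bochner_Integration.integrable_add sq_int_integrable integrable_mult_right sq_int_inner f g)
  moreover have "(\<lambda>x. f x + g x) \<in> borel_measurable M"
    using f g by (intro borel_measurable_add sq_int_measurable)
  ultimately show ?thesis by (simp add: sq_int_def)
qed

lemma sq_int_diff:
  assumes f: "f \<in> sq_int M" and g: "g \<in> sq_int M"
  shows "(\<lambda>x. f x - g x) \<in> sq_int M"
  using sq_int_add[OF f sq_int_scaleR[OF g, of "- 1"]] by simp

lemma sq_int_zero: "(\<lambda>x. 0) \<in> sq_int M"
  by (simp add: sq_int_def)

lemma nrm_ip: "nrm M f = sqrt (ip M f f)"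
  by (simp add: nrm_def ip_def power2_norm_eq_inner)

lemma ip_commute: "ip M f g = ip M g f"
  by (simp add: ip_def inner_commute)

lemma ip_add_left:
  "f \<in> sq_int M \<Longrightarrow> g \<in> sq_int M \<Longrightarrow> h \<in> sq_int M \<Longrightarrow> ip M (\<lambda>x. f x + g x) h = ip M f h + ip M g h"
  by (simp add: ip_def inner_add_left sq_int_inner)

lemma ip_scaleR_left: "ip M (\<lambda>x. c *\<^sub>R f x) h = c * ip M f h"
  by (simp add: ip_def)

lemma ip_nonneg: "0 \<le> ip M f f"
  by (simp add: ip_def)

text \<open>Through this instance the Cauchy-Schwarz and Minkowski inequalities for integrals are
  inherited from the abstract semidefinite form.\<close>

lemma form_space_sq_int: "form_space (sq_int M) (\<lambda>f g x. f x + g x) (\<lambda>c f x. c *\<^sub>R f x) (ip M)"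
proof
  show "ip M f g = ip M g f" for f g :: "'a \<Rightarrow> 'b" by (rule ip_commute)
qed (use sq_int_zero in \<open>auto simp: sq_int_add sq_int_scaleR ip_add_left ip_scaleR_left ip_nonneg\<close>)

lemma nrm_nonneg [simp]: "0 \<le> nrm M f"
  by (simp add: nrm_def)

lemma nrm_sq: "(nrm M f)\<^sup>2 = (\<integral>x. (norm (f x))\<^sup>2 \<partial>M)"
  by (simp add: nrm_def)

lemma nn_integral_sq: "f \<in> sq_int M \<Longrightarrow> (\<integral>\<^sup>+x. ennreal ((norm (f x))\<^sup>2) \<partial>M) = ennreal ((nrm M f)\<^sup>2)"
  by (simp add: nrm_sq nn_integral_eq_integral sq_int_integrable)

lemma sq_intI:
  assumes f: "f \<in> borel_measurable M" and le: "(\<integral>\<^sup>+x. ennreal ((norm (f x))\<^sup>2) \<partial>M) \<le> ennreal (c\<^sup>2)"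
  shows "f \<in> sq_int M" and "0 \<le> c \<Longrightarrow> nrm M f \<le> c"
proof -
  have "integrable M (\<lambda>x. (norm (f x))\<^sup>2)"
    using f le by (intro integrableI_nonneg) (auto simp: less_top[symmetric] top_unique)
  with f show *: "f \<in> sq_int M" by (simp add: sq_int_def)
  have "ennreal ((nrm M f)\<^sup>2) \<le> ennreal (c\<^sup>2)" using le nn_integral_sq[OF *] by simp
  then have "(nrm M f)\<^sup>2 \<le> c\<^sup>2" by simp
  then show "nrm M f \<le> c" if "0 \<le> c" using that by (rule power2_le_imp_le)
qed

lemma ip_Cauchy_Schwarz:
  assumes "f \<in> sq_int M" "g \<in> sq_int M"
  shows "\<bar>ip M f g\<bar> \<le> nrm M f * nrm M g"
  using form_space.Cauchy_Schwarz[OF form_space_sq_int assms]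
  by (simp add: form_space.N_def[OF form_space_sq_int] nrm_ip)

lemma nrm_norm [simp]: "nrm M (\<lambda>x. norm (f x)) = nrm M f"
  by (simp add: nrm_def)

lemma sq_int_norm: "f \<in> sq_int M \<Longrightarrow> (\<lambda>x. norm (f x)) \<in> sq_int M"
  by (auto simp: sq_int_def)

lemma integral_norm_mult_le:
  fixes f :: "'a \<Rightarrow> 'b::euclidean_space" and g :: "'a \<Rightarrow> 'c::euclidean_space"
  assumes "f \<in> sq_int M" "g \<in> sq_int M"
  shows "(\<integral>x. norm (f x) * norm (g x) \<partial>M) \<le> nrm M f * nrm M g"
  using ip_Cauchy_Schwarz[OF sq_int_norm[OF assms(1)] sq_int_norm[OF assms(2)]]
  by (simp add: ip_def)

lemma nrm_add:
  assumes "f \<in> sq_int M" "g \<in> sq_int M"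
  shows "nrm M (\<lambda>x. f x + g x) \<le> nrm M f + nrm M g"
  using form_space.N_add[OF form_space_sq_int assms]
  by (simp add: form_space.N_def[OF form_space_sq_int] nrm_ip)

lemma nrm_scaleR: "nrm M (\<lambda>x. c *\<^sub>R f x) = \<bar>c\<bar> * nrm M f"
  by (simp add: nrm_def power_mult_distrib real_sqrt_mult)

lemma nrm_minus_commute: "nrm M (\<lambda>x. f x - g x) = nrm M (\<lambda>x. g x - f x)"
  by (simp add: nrm_def norm_minus_commute)

lemma nrm_triangle:
  assumes f: "f \<in> sq_int M" and g: "g \<in> sq_int M" and h: "h \<in> sq_int M"
  shows "nrm M (\<lambda>x. f x - h x) \<le> nrm M (\<lambda>x. f x - g x) + nrm M (\<lambda>x. g x - h x)"
  using nrm_add[OF sq_int_diff[OF f g] sq_int_diff[OF g h]] by simp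

lemma nrm_diff_ge:
  assumes f: "f \<in> sq_int M" and g: "g \<in> sq_int M"
  shows "\<bar>nrm M f - nrm M g\<bar> \<le> nrm M (\<lambda>x. f x - g x)"
  using nrm_add[OF sq_int_diff[OF f g] g] nrm_add[OF sq_int_diff[OF g f] f]
  by (simp add: nrm_minus_commute[of M g f] abs_le_iff)

lemma nrm_mono:
  assumes g: "g \<in> sq_int M" and f: "f \<in> borel_measurable M" and c: "0 \<le> c"
    and le: "AE x in M. norm (f x) \<le> c * norm (g x)"
  shows "nrm M f \<le> c * nrm M g"
proof -
  have fs: "f \<in> sq_int M" by (rule sq_int_bounded[OF g f le])
  have "(\<integral>x. (norm (f x))\<^sup>2 \<partial>M) \<le> (\<integral>x. c\<^sup>2 * (norm (g x))\<^sup>2 \<partial>M)"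
  proof (rule integral_mono_AE)
    show "AE x in M. (norm (f x))\<^sup>2 \<le> c\<^sup>2 * (norm (g x))\<^sup>2"
      using le
    proof eventually_elim
      case (elim x)
      then show ?case using power_mono[OF elim, of 2] by (simp add: power_mult_distrib)
    qed
  qed (use fs g in \<open>auto intro: sq_int_integrable\<close>)
  then have "(nrm M f)\<^sup>2 \<le> (c * nrm M g)\<^sup>2" by (simp add: nrm_sq power_mult_distrib)
  then show ?thesis by (rule power2_le_imp_le) (use c in simp)
qed

lemma nrm_cong_AE: 
  assumes "f \<in> borel_measurable M" "g \<in> borel_measurable M" "AE x in M. f x = g x"
  shows "nrm M f = nrm M g"
  unfolding nrm_def using assms by (intro arg_cong[where f=sqrt] integral_cong_AE) auto

lemma nrm_eq_0_AE:
  assumes f: "f \<in> sq_int M" and "nrm M f = 0"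
  shows "AE x in M. f x = 0"
proof -
  have "(\<integral>x. (norm (f x))\<^sup>2 \<partial>M) = 0" using assms(2) nrm_sq[of M f] by simp
  then have "AE x in M. (norm (f x))\<^sup>2 = 0"
    using integral_nonneg_eq_0_iff_AE[OF sq_int_integrable[OF f]] by simp
  then show ?thesis by simp
qed

lemma sq_int_tendsto_nrm:
  assumes f: "\<And>n. f n \<in> sq_int M" and g: "g \<in> sq_int M" and lim: "(\<lambda>n. nrm M (\<lambda>x. f n x - g x)) \<longlonglongrightarrow> 0"
  shows "(\<lambda>n. nrm M (f n)) \<longlonglongrightarrow> nrm M g"
proof -
  have "(\<lambda>n. nrm M (f n) - nrm M g) \<longlonglongrightarrow> 0"
    by (rule Lim_null_comparison[OF _ lim]) (use nrm_diff_ge[OF f g] in auto)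
  then show ?thesis by (simp add: LIM_zero_cancel)
qed

lemma ip_tendsto:
  assumes f: "\<And>n. f n \<in> sq_int M" and f': "f' \<in> sq_int M" and limf: "(\<lambda>n. nrm M (\<lambda>x. f n x - f' x)) \<longlonglongrightarrow> 0"
    and g: "\<And>n. g n \<in> sq_int M" and g': "g' \<in> sq_int M" and limg: "(\<lambda>n. nrm M (\<lambda>x. g n x - g' x)) \<longlonglongrightarrow> 0"
  shows "(\<lambda>n. ip M (f n) (g n)) \<longlonglongrightarrow> ip M f' g'"
proof -
  have "norm (ip M (f n) (g n) - ip M f' g') \<le>
      nrm M (\<lambda>x. f n x - f' x) * nrm M (g n) + nrm M f' * nrm M (\<lambda>x. g n x - g' x)" for n
  proof -
    have "ip M (f n) (g n) - ip M f' g' = ip M (\<lambda>x. f n x - f' x) (g n) + ip M f' (\<lambda>x. g n x - g' x)"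
      unfolding ip_def by (simp add: inner_diff sq_int_inner f f' g g')
    then show ?thesis
      using ip_Cauchy_Schwarz[OF sq_int_diff[OF f f'] g, of n n]
        ip_Cauchy_Schwarz[OF f' sq_int_diff[OF g g'], of n]
      by (simp add: abs_le_iff)
  qed
  moreover have "(\<lambda>n. nrm M (\<lambda>x. f n x - f' x) * nrm M (g n) + nrm M f' * nrm M (\<lambda>x. g n x - g' x))
      \<longlonglongrightarrow> 0 * nrm M g' + nrm M f' * 0"
    by (intro tendsto_intros limf limg sq_int_tendsto_nrm g g')
  ultimately have "(\<lambda>n. ip M (f n) (g n) - ip M f' g') \<longlonglongrightarrow> 0"
    by (rule_tac Lim_null_comparison[rotated]) auto
  then show ?thesis by (simp add: LIM_zero_cancel)
qed

lemma sq_int_AE_subseq: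
  assumes f: "\<And>n. f n \<in> sq_int M" and g: "g \<in> sq_int M" and lim: "(\<lambda>n. nrm M (\<lambda>x. f n x - g x)) \<longlonglongrightarrow> 0"
  shows "\<exists>r::nat\<Rightarrow>nat. strict_mono r \<and> (AE x in M. (\<lambda>n. f (r n) x) \<longlonglongrightarrow> g x)"
proof -
  have "\<exists>r::nat\<Rightarrow>nat. strict_mono r \<and> (AE x in M. (\<lambda>n. (norm (f (r n) x - g x))\<^sup>2) \<longlonglongrightarrow> 0)"
  proof (rule tendsto_L1_AE_subseq)
    show "integrable M (\<lambda>x. (norm (f n x - g x))\<^sup>2)" for n
      by (intro sq_int_integrable sq_int_diff f g)
    have "(\<lambda>n. (nrm M (\<lambda>x. f n x - g x))\<^sup>2) \<longlonglongrightarrow> 0\<^sup>2" by (intro tendsto_intros lim)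
    then show "(\<lambda>n. \<integral>x. norm ((norm (f n x - g x))\<^sup>2) \<partial>M) \<longlonglongrightarrow> 0" by (simp add: nrm_sq)
  qed
  then obtain r :: "nat \<Rightarrow> nat" where r: "strict_mono r"
    and ae: "AE x in M. (\<lambda>n. (norm (f (r n) x - g x))\<^sup>2) \<longlonglongrightarrow> 0" by blast
  from ae have "AE x in M. (\<lambda>n. f (r n) x) \<longlonglongrightarrow> g x"
  proof eventually_elim
    case (elim x)
    then have "(\<lambda>n. sqrt ((norm (f (r n) x - g x))\<^sup>2)) \<longlonglongrightarrow> sqrt 0" by (intro tendsto_intros)
    then show ?case by (simp add: tendsto_norm_zero_iff LIM_zero_cancel)
  qed
  with r show ?thesis by blast
qed

text \<open>Fatou's lemma for the squared norms. Square integrability of the limit is part of the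
  conclusion; this serves both the completeness proof and the passage of fourth-power bounds to
  limits.\<close>

lemma nrm_le_of_AE_tendsto:
  assumes f: "\<And>n. f n \<in> sq_int M" and g: "g \<in> borel_measurable M" and ae: "AE x in M. (\<lambda>n. f n x) \<longlonglongrightarrow> g x"
    and le: "\<forall>\<^sub>F n in sequentially. nrm M (f n) \<le> c" and c: "0 \<le> c"
  shows "g \<in> sq_int M" and "nrm M g \<le> c"
proof -
  have "(\<integral>\<^sup>+x. ennreal ((norm (g x))\<^sup>2) \<partial>M) = (\<integral>\<^sup>+x. liminf (\<lambda>n. ennreal ((norm (f n x))\<^sup>2)) \<partial>M)"
  proof (rule nn_integral_cong_AE)
    show "AE x in M. ennreal ((norm (g x))\<^sup>2) = liminf (\<lambda>n. ennreal ((norm (f n x))\<^sup>2))"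
      using ae
    proof eventually_elim
      case (elim x)
      then have "(\<lambda>n. ennreal ((norm (f n x))\<^sup>2)) \<longlonglongrightarrow> ennreal ((norm (g x))\<^sup>2)"
        by (intro tendsto_intros tendsto_ennrealI)
      then show ?case by (metis lim_imp_Liminf sequentially_bot)
    qed
  qed
  also have "\<dots> \<le> liminf (\<lambda>n. \<integral>\<^sup>+x. ennreal ((norm (f n x))\<^sup>2) \<partial>M)"
    by (intro nn_integral_liminf) (use f[THEN sq_int_measurable] in measurable)
  also have "\<dots> \<le> ennreal (c\<^sup>2)"
  proof -
    have "\<forall>\<^sub>F n in sequentially. (\<integral>\<^sup>+x. ennreal ((norm (f n x))\<^sup>2) \<partial>M) \<le> ennreal (c\<^sup>2)"
      using le by eventually_elim (simp add: nn_integral_sq f power_mono ennreal_leI)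
    then have "limsup (\<lambda>n. \<integral>\<^sup>+x. ennreal ((norm (f n x))\<^sup>2) \<partial>M) \<le> ennreal (c\<^sup>2)"
      by (rule Limsup_bounded)
    then show ?thesis using Liminf_le_Limsup[OF sequentially_bot] order_trans by blast
  qed
  finally have *: "(\<integral>\<^sup>+x. ennreal ((norm (g x))\<^sup>2) \<partial>M) \<le> ennreal (c\<^sup>2)" .
  show "g \<in> sq_int M" "nrm M g \<le> c" using sq_intI[OF g *] c by auto
qed

text \<open>The Riesz-Fischer argument. A subsequence with geometrically small increments has, by
  Minkowski and monotone convergence, an almost everywhere finite sum of increments, hence a
  pointwise limit; Fatou then shows that the whole sequence converges to it in the mean.\<close>

theorem sq_int_complete:
  fixes s :: "nat \<Rightarrow> 'a \<Rightarrow> 'b::euclidean_space"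
  assumes s: "\<And>n. s n \<in> sq_int M"
    and cauchy: "\<And>e. e > 0 \<Longrightarrow> \<exists>K. \<forall>m\<ge>K. \<forall>n\<ge>K. nrm M (\<lambda>x. s m x - s n x) < e"
  shows "\<exists>g \<in> sq_int M. (\<lambda>n. nrm M (\<lambda>x. s n x - g x)) \<longlonglongrightarrow> 0"
proof -
  have "\<forall>k. \<exists>K. \<forall>m\<ge>K. \<forall>n\<ge>K. nrm M (\<lambda>x. s m x - s n x) < (1/2) ^ k" using cauchy by simp
  then obtain K where K: "\<And>k m n. m \<ge> K k \<Longrightarrow> n \<ge> K k \<Longrightarrow> nrm M (\<lambda>x. s m x - s n x) < (1/2) ^ k"
    by metis
  \<comment> \<open>The recursion makes \<open>r\<close> strictly increasing and keeps
    \<open>r k\<close> at least \<open>K k\<close>, so that consecutive members differ by less than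
    \<open>(1/2)^k\<close>.\<close>
  define r where "r = rec_nat (K 0) (\<lambda>k p. max (Suc p) (K (Suc k)))"
  have r0: "r 0 = K 0" and rS: "r (Suc k) = max (Suc (r k)) (K (Suc k))" for k by (auto simp: r_def)
  have rK: "K k \<le> r k" for k by (cases k) (auto simp: r0 rS)
  have r: "strict_mono r" by (auto simp: strict_mono_Suc_iff rS)
  define d where "d k x = s (r (Suc k)) x - s (r k) x" for k x
  have d: "d k \<in> sq_int M" for k unfolding d_def by (intro sq_int_diff s)
  have dn: "nrm M (d k) \<le> (1/2) ^ k" for k
    unfolding d_def using K[of k "r (Suc k)" "r k"] rK[of k] strict_monoD[OF r, of k "Suc k"] by simp
  define S where "S n x = (\<Sum>k<n. norm (d k x))" for n x
  have S: "S n \<in> sq_int M \<and> nrm M (S n) \<le> (\<Sum>k<n. (1/2) ^ k)" for n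
  proof (induction n)
    case 0 then show ?case by (simp add: S_def sq_int_zero nrm_def)
  next
    case (Suc n)
    have "S (Suc n) = (\<lambda>x. S n x + norm (d n x))" by (auto simp: S_def)
    with Suc nrm_add[of "S n" M "\<lambda>x. norm (d n x)"] sq_int_norm[OF d[of n]] dn[of n]
    show ?case by (auto intro: sq_int_add)
  qed
  have S2: "nrm M (S n) \<le> 2" for n
  proof -
    have "(\<Sum>k<n. (1/2::real) ^ k) = 2 * (1 - (1/2) ^ n)" by (simp add: sum_gp_strict)
    also have "\<dots> \<le> 2" by simp
    finally show ?thesis using S[of n] order_trans by blast
  qed
  have Sm [measurable]: "S n \<in> borel_measurable M" for n using S by (auto dest: sq_int_measurable)
  have "(\<integral>\<^sup>+x. (SUP n. ennreal ((norm (S n x))\<^sup>2)) \<partial>M) = (SUP n. \<integral>\<^sup>+x. ennreal ((norm (S n x))\<^sup>2) \<partial>M)"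
  proof (rule nn_integral_monotone_convergence_SUP)
    have "norm (S m x) \<le> norm (S n x)" if "m \<le> n" for m n x
    proof -
      have "S m x \<le> S n x" unfolding S_def using that by (intro sum_mono2) auto
      moreover have "0 \<le> S m x" unfolding S_def by (simp add: sum_nonneg)
      ultimately show ?thesis by simp
    qed
    then show "incseq (\<lambda>n x. ennreal ((norm (S n x))\<^sup>2))"
      unfolding incseq_def le_fun_def by (intro allI impI ennreal_leI power_mono) simp_all
  qed measurable
  also have "\<dots> \<le> ennreal (2\<^sup>2)"
  proof (rule SUP_least)
    fix n
    show "(\<integral>\<^sup>+x. ennreal ((norm (S n x))\<^sup>2) \<partial>M) \<le> ennreal (2\<^sup>2)"
      unfolding nn_integral_sq[OF conjunct1[OF S]] using S2[of n] by (intro ennreal_leI power_mono) simp_all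
  qed
  finally have "(\<integral>\<^sup>+x. (SUP n. ennreal ((norm (S n x))\<^sup>2)) \<partial>M) \<noteq> \<infinity>"
    by (auto simp: top_unique)
  then have "AE x in M. (SUP n. ennreal ((norm (S n x))\<^sup>2)) \<noteq> \<infinity>"
    by (intro nn_integral_PInf_AE) measurable
  then have conv: "AE x in M. convergent (\<lambda>k. s (r k) x)"
  proof eventually_elim
    case (elim x)
    then obtain b where b: "0 \<le> b" "(SUP n. ennreal ((norm (S n x))\<^sup>2)) = ennreal b"
      by (metis ennreal_cases infinity_ennreal_def)
    have "ennreal ((norm (S n x))\<^sup>2) \<le> ennreal b" for n
      unfolding b(2)[symmetric] by (rule SUP_upper) simp
    then have "(S n x)\<^sup>2 \<le> b" for n using b(1) by simp
    then have "\<bar>S n x\<bar> \<le> sqrt b" for n by (metis real_sqrt_abs real_sqrt_le_mono)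
    then have "S (Suc n) x \<le> sqrt b" for n by (meson abs_le_D1)
    then have "(\<Sum>k\<le>n. norm (d k x)) \<le> sqrt b" for n
      unfolding S_def lessThan_Suc_atMost .
    then have "summable (\<lambda>k. norm (d k x))" by (rule bounded_imp_summable[rotated]) simp
    then have "summable (\<lambda>k. d k x)" by (rule summable_norm_cancel)
    then have "convergent (\<lambda>n. \<Sum>k<n. d k x)" by (simp add: summable_iff_convergent)
    moreover have "(\<Sum>k<n. d k x) = s (r n) x - s (r 0) x" for n
      unfolding d_def by (rule sum_lessThan_telescope)
    ultimately have "convergent (\<lambda>n. (s (r n) x - s (r 0) x) + s (r 0) x)"
      by (intro convergent_add convergent_const) simp
    then show ?case by simp
  qed
  define g where "g x = lim (\<lambda>k. s (r k) x)" for x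
  have gm [measurable]: "g \<in> borel_measurable M"
    unfolding g_def using s[THEN sq_int_measurable] by measurable
  have gl: "AE x in M. (\<lambda>k. s (r k) x) \<longlonglongrightarrow> g x"
    using conv by eventually_elim (simp add: g_def convergent_LIMSEQ_iff)
  \<comment> \<open>The index \<open>m\<close> ranges over the full sequence, while the subsequence
    index is sent to infinity; this avoids a separate passage from the subsequence back to the
    sequence.\<close>
  have close: "(\<lambda>x. g x - s m x) \<in> sq_int M \<and> nrm M (\<lambda>x. g x - s m x) \<le> (1/2) ^ k" if m: "m \<ge> K k" for m k
  proof -
    have "\<forall>\<^sub>F n in sequentially. nrm M (\<lambda>x. s (r n) x - s m x) \<le> (1/2) ^ k"
    proof (rule eventually_sequentiallyI[of k])
      fix n assume "k \<le> n"
      then have "K k \<le> r n" using rK[of k] r by (meson monoD order_trans strict_mono_mono)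
      then show "nrm M (\<lambda>x. s (r n) x - s m x) \<le> (1/2) ^ k" using K[of k "r n" m] m by simp
    qed
    moreover have "AE x in M. (\<lambda>n. s (r n) x - s m x) \<longlonglongrightarrow> g x - s m x"
      using gl by eventually_elim (intro tendsto_intros)
    moreover have "(\<lambda>x. g x - s m x) \<in> borel_measurable M"
      by (intro borel_measurable_diff gm sq_int_measurable s)
    ultimately show ?thesis
      using nrm_le_of_AE_tendsto[of "\<lambda>n x. s (r n) x - s m x" M "\<lambda>x. g x - s m x" "(1/2) ^ k"] s
      by (simp add: sq_int_diff)
  qed
  have gs: "g \<in> sq_int M"
    using sq_int_add[OF conjunct1[OF close[OF order_refl]] s, of 0 "K 0"] by simp
  moreover have "(\<lambda>n. nrm M (\<lambda>x. s n x - g x)) \<longlonglongrightarrow> 0"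
  proof (rule LIMSEQ_I)
    fix e :: real assume "e > 0"
    then obtain k where k: "(1/2) ^ k < e" using real_arch_pow_inv[of e "1/2"] by auto
    have "norm (nrm M (\<lambda>x. s m x - g x) - 0) < e" if "m \<ge> K k" for m
      using close[OF that] k nrm_minus_commute[of M g "s m"] by simp
    then show "\<exists>no. \<forall>n\<ge>no. norm (nrm M (\<lambda>x. s n x - g x) - 0) < e" by blast
  qed
  ultimately show ?thesis by blast
qed

text \<open>The conditions that the squares are square integrable express membership in \<open>L\<^sup>4\<close>.\<close>

lemma triple_product:
  fixes u G w :: "'a \<Rightarrow> real"
  assumes u: "u \<in> borel_measurable M" "(\<lambda>x. (u x)\<^sup>2) \<in> sq_int M"
    and w: "w \<in> borel_measurable M" "(\<lambda>x. (w x)\<^sup>2) \<in> sq_int M"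
    and G: "G \<in> sq_int M"
  shows "integrable M (\<lambda>x. u x * G x * w x)"
    and "\<bar>\<integral>x. u x * G x * w x \<partial>M\<bar> \<le> sqrt (nrm M (\<lambda>x. (u x)\<^sup>2)) * nrm M G * sqrt (nrm M (\<lambda>x. (w x)\<^sup>2))"
proof -
  \<comment> \<open>Hoelder's inequality with exponents 4, 2, 4, obtained by two applications of
    Cauchy-Schwarz: one to the squares of \<open>u\<close> and \<open>w\<close>, one to the product
    \<open>u w\<close> and \<open>G\<close>.\<close>
  have uw: "(\<lambda>x. u x * w x) \<in> sq_int M"
    using sq_int_mult[OF u(2) w(2)] u(1) w(1) by (simp add: sq_int_def power_mult_distrib)
  have "(nrm M (\<lambda>x. u x * w x))\<^sup>2 = ip M (\<lambda>x. (u x)\<^sup>2) (\<lambda>x. (w x)\<^sup>2)"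
    by (simp add: nrm_sq ip_def power_mult_distrib)
  also have "\<dots> \<le> nrm M (\<lambda>x. (u x)\<^sup>2) * nrm M (\<lambda>x. (w x)\<^sup>2)"
    using ip_Cauchy_Schwarz[OF u(2) w(2)] by simp
  finally have "nrm M (\<lambda>x. u x * w x) \<le> sqrt (nrm M (\<lambda>x. (u x)\<^sup>2) * nrm M (\<lambda>x. (w x)\<^sup>2))"
    by (simp add: real_le_rsqrt)
  then have le: "nrm M (\<lambda>x. u x * w x) \<le> sqrt (nrm M (\<lambda>x. (u x)\<^sup>2)) * sqrt (nrm M (\<lambda>x. (w x)\<^sup>2))"
    by (simp add: real_sqrt_mult)
  have eq: "(\<lambda>x. u x * G x * w x) = (\<lambda>x. (u x * w x) * G x)" by (auto simp: algebra_simps)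
  show "integrable M (\<lambda>x. u x * G x * w x)" unfolding eq by (rule sq_int_mult[OF uw G])
  have "\<bar>\<integral>x. u x * G x * w x \<partial>M\<bar> \<le> nrm M (\<lambda>x. u x * w x) * nrm M G"
    unfolding eq using ip_Cauchy_Schwarz[OF uw G] by (simp add: ip_def)
  also have "\<dots> \<le> (sqrt (nrm M (\<lambda>x. (u x)\<^sup>2)) * sqrt (nrm M (\<lambda>x. (w x)\<^sup>2))) * nrm M G"
    by (intro mult_right_mono le) simp
  finally show "\<bar>\<integral>x. u x * G x * w x \<partial>M\<bar> \<le> sqrt (nrm M (\<lambda>x. (u x)\<^sup>2)) * nrm M G * sqrt (nrm M (\<lambda>x. (w x)\<^sup>2))"
    by (simp add: algebra_simps)
qed

section \<open>Hausdorff measure and slices of planar domains\<close>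

lemma space_hausdorff1 [simp]: "space hausdorff1 = UNIV"
  by (simp add: hausdorff1_def space_measure_of_conv)

lemma sets_hausdorff1 [simp, measurable_cong]: "sets hausdorff1 = sets borel"
  using sets.sigma_sets_eq[of "borel :: (real^2) measure"]
  by (simp add: hausdorff1_def sets_measure_of_conv)

text \<open>Were the outer measure not countably additive on the Borel sets, \<^const>\<open>measure_of\<close> would
  return the zero measure. A single set of nonzero measure rules this out.\<close>

lemma emeasure_hausdorff1:
  assumes "emeasure hausdorff1 G \<noteq> 0" and "A \<in> sets borel"
  shows "emeasure hausdorff1 A = hausdorff1_outer A"
proof -
  have sig: "sigma_sets UNIV (sets borel) = sets (borel :: (real^2) measure)"
    using sets.sigma_sets_eq[of "borel :: (real^2) measure"] by simp
  have "measure_space UNIV (sets borel) hausdorff1_outer"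
    using assms(1) unfolding hausdorff1_def emeasure_measure_of_conv sig by (metis (full_types))
  then show ?thesis using assms(2) unfolding hausdorff1_def emeasure_measure_of_conv sig by simp
qed

section \<open>Projections and Eilenberg's inequality\<close>

lemma projection_cover_approx:
  fixes A :: "(real^2) set" and k :: 2
  assumes fin: "hausdorff1_outer A \<noteq> \<infinity>" and r: "r > 0"
  obtains B where "B \<in> sets borel" "(\<lambda>x. x $ k) ` A \<subseteq> B"
    "emeasure lborel B \<le> 2 * (hausdorff1_outer A + ennreal r)"
proof -
  \<comment> \<open>Any fixed scale of the covers serves, because the outer measure is the supremum
    over all scales; fineness of the covers plays its part later, through the grid.\<close>
  have "hausdorff1_pre 1 A \<le> hausdorff1_outer A"
    unfolding hausdorff1_outer_def by (rule SUP_upper) simp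
  also have "\<dots> < hausdorff1_outer A + ennreal r"
    using fin r by (cases "hausdorff1_outer A") (auto simp: ennreal_less_iff simp flip: ennreal_plus)
  finally obtain S :: "nat \<Rightarrow> (real^2) set" where S: "A \<subseteq> (\<Union>n. S n)" "\<And>n. bounded (S n)"
    and le: "(\<Sum>n. ennreal (diameter (S n))) < hausdorff1_outer A + ennreal r"
    unfolding hausdorff1_pre_def INF_less_iff by auto
  define p where "p n = (SOME x. x \<in> S n) $ k" for n
  \<comment> \<open>The projection does not increase distances, so the interval of radius
    \<open>diameter (S n)\<close> about the image of one chosen point contains the image of
    \<open>S n\<close>. Its length is twice the diameter, whence the factor 2. For empty
    \<open>S n\<close> the point is arbitrary and the interval degenerate.\<close>
  define J where "J n = {p n - diameter (S n) .. p n + diameter (S n)}" for n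
  have "(\<lambda>x. x $ k) ` A \<subseteq> (\<Union>n. J n)"
  proof clarify
    fix x assume "x \<in> A"
    then obtain n where n: "x \<in> S n" using S(1) by auto
    then have s: "(SOME x. x \<in> S n) \<in> S n" by (metis someI)
    have "\<bar>x $ k - p n\<bar> \<le> norm (x - (SOME x. x \<in> S n))"
      unfolding p_def vector_minus_component[symmetric] by (rule component_le_norm_cart)
    also have "\<dots> \<le> diameter (S n)"
      using diameter_bounded_bound[OF S(2) n s] by (simp add: dist_norm)
    finally have "x $ k \<in> J n" by (simp add: J_def abs_le_iff algebra_simps)
    then show "x $ k \<in> (\<Union>n. J n)" by blast
  qed
  moreover have "emeasure lborel (\<Union>n. J n) \<le> 2 * (hausdorff1_outer A + ennreal r)"
  proof -
    have "emeasure lborel (\<Union>n. J n) \<le> (\<Sum>n. emeasure lborel (J n))"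
      by (rule emeasure_subadditive_countably) (auto simp: J_def)
    also have "\<dots> = (\<Sum>n. 2 * ennreal (diameter (S n)))"
      by (intro suminf_cong) (use S(2) in \<open>simp add: J_def diameter_ge_0 ennreal_mult'\<close>)
    also have "\<dots> = 2 * (\<Sum>n. ennreal (diameter (S n)))" by simp
    also have "\<dots> \<le> 2 * (hausdorff1_outer A + ennreal r)" using le by (intro mult_left_mono) auto
    finally show ?thesis .
  qed
  moreover have "(\<Union>n. J n) \<in> sets borel" by (auto simp: J_def)
  ultimately show ?thesis using that by blast
qed

text \<open>A Borel superset takes the place of the projection itself, because the projection of a
  Borel set need not be Borel. The error terms of the approximate covers disappear on intersecting
  countably many of them.\<close>

lemma projection_cover:
  fixes A :: "(real^2) set" and k :: 2
  shows "\<exists>B \<in> sets borel. (\<lambda>x. x $ k) ` A \<subseteq> B \<and> emeasure lborel B \<le> 2 * hausdorff1_outer A"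
proof (cases "hausdorff1_outer A = \<infinity>")
  case True
  then show ?thesis by (intro bexI[of _ UNIV]) (auto simp: ennreal_mult_top)
next
  case False
  have "\<exists>B. B \<in> sets borel \<and> (\<lambda>x. x $ k) ` A \<subseteq> B \<and>
      emeasure lborel B \<le> 2 * (hausdorff1_outer A + ennreal (1 / real (Suc n)))" for n
    by (rule projection_cover_approx[OF False, of "1 / real (Suc n)" k]) auto
  then obtain B where B: "\<And>n. B n \<in> sets borel" "\<And>n. (\<lambda>x. x $ k) ` A \<subseteq> B n"
    and le: "\<And>n. emeasure lborel (B n) \<le> 2 * (hausdorff1_outer A + ennreal (1 / real (Suc n)))"
    by metis
  have "emeasure lborel (\<Inter>n. B n) \<le> 2 * (hausdorff1_outer A + ennreal (1 / real (Suc n)))" for n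
    using B by (intro order_trans[OF emeasure_mono le]) auto
  moreover have "(\<lambda>n. 2 * (hausdorff1_outer A + ennreal (1 / real (Suc n)))) \<longlonglongrightarrow> 2 * (hausdorff1_outer A + ennreal 0)"
    by (intro ennreal_tendsto_cmult tendsto_add tendsto_const tendsto_ennrealI LIMSEQ_Suc lim_1_over_n) simp
  ultimately have "emeasure lborel (\<Inter>n. B n) \<le> 2 * (hausdorff1_outer A + ennreal 0)"
    by (intro LIMSEQ_le_const) auto
  moreover have "(\<Inter>n. B n) \<in> sets borel" using B by auto
  ultimately show ?thesis using B by (intro bexI[of _ "\<Inter>n. B n"]) auto
qed

text \<open>An extended nonnegative integral: boundary integrals may be added and compared without
  any integrability condition, and smallness is expressed by comparison with
  \<open>ennreal \<beta>\<close>.\<close>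

definition bd_int :: "(real^2) set \<Rightarrow> (real^2 \<Rightarrow> real) \<Rightarrow> ennreal" where
  "bd_int K F = (\<integral>\<^sup>+x. ennreal (F x) * indicator K x \<partial>hausdorff1)"

text \<open>Eilenberg's inequality (with a factor \<open>2\<close>) for the projection to a coordinate axis. The fibre sum
  is approximated from below by splitting \<open>K\<close> along ever finer grids.\<close>

proposition fibre_sum_bound:
  fixes K :: "(real^2) set" and F :: "real^2 \<Rightarrow> real" and k :: 2
  assumes pos: "emeasure hausdorff1 G \<noteq> 0"
    and K: "K \<in> sets borel" "bounded K" and F: "continuous_on UNIV F"
  shows "\<exists>S \<in> borel_measurable borel. (\<integral>\<^sup>+y. S y \<partial>lborel) \<le> 2 * bd_int K F \<and>
    (\<forall>y P. finite P \<longrightarrow> P \<subseteq> K \<longrightarrow> (\<forall>p\<in>P. p $ k = y) \<longrightarrow> (\<Sum>p\<in>P. ennreal (F p)) \<le> S y)"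
proof -
  \<comment> \<open>The index of the grid cell of side \<open>1 / Suc n\<close> that contains
    \<open>x\<close>. The cells cut \<open>K\<close> into finitely many Borel pieces, each of
    diameter at most \<open>2 / Suc n\<close>.\<close>
  define q where "q n x = (\<lfloor>real (Suc n) * (x $ 1)\<rfloor>, \<lfloor>real (Suc n) * (x $ 2)\<rfloor>)" for n and x :: "real^2"
  have q_meas: "{x. q n x = c} \<in> sets borel" for n c
  proof -
    have "{x. q n x = c} = {x. \<lfloor>real (Suc n) * (x $ 1)\<rfloor> = fst c} \<inter> {x. \<lfloor>real (Suc n) * (x $ 2)\<rfloor> = snd c}"
      by (auto simp: q_def)
    also have "\<dots> = {x. of_int (fst c) \<le> real (Suc n) * (x $ 1) \<and> real (Suc n) * (x $ 1) < of_int (fst c) + 1} \<inter>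
       {x. of_int (snd c) \<le> real (Suc n) * (x $ 2) \<and> real (Suc n) * (x $ 2) < of_int (snd c) + 1}"
      by (simp add: floor_eq_iff)
    also have "\<dots> \<in> sets borel" by measurable
    finally show ?thesis .
  qed
  have q_close: "norm (x - y) \<le> 2 / real (Suc n)" if "q n x = q n y" for n x y
  proof -
    have "\<bar>x $ j - y $ j\<bar> \<le> 1 / real (Suc n)" for j :: 2
    proof -
      have "\<lfloor>real (Suc n) * (x $ j)\<rfloor> = \<lfloor>real (Suc n) * (y $ j)\<rfloor>"
        using that exhaust_2[of j] by (auto simp: q_def)
      then have "\<bar>real (Suc n) * (x $ j) - real (Suc n) * (y $ j)\<bar> < 1" by linarith
      then have "real (Suc n) * \<bar>x $ j - y $ j\<bar> < 1"
        by (simp add: abs_mult right_diff_distrib[symmetric] del: of_nat_Suc)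
      then show ?thesis by (simp add: field_simps)
    qed
    then have "(\<Sum>j\<in>UNIV. \<bar>(x - y) $ j\<bar>) \<le> (\<Sum>j\<in>(UNIV::2 set). 1 / real (Suc n))"
      by (intro sum_mono) simp
    then show ?thesis using norm_le_l1_cart[of "x - y"] by (simp add: UNIV_2)
  qed
  have q_fin: "finite (q n ` K)" for n
  proof -
    obtain R where R: "\<And>x. x \<in> K \<Longrightarrow> norm x \<le> R" using K(2) by (auto simp: bounded_iff)
    have "\<lfloor>real (Suc n) * (x $ j)\<rfloor> \<in> {\<lfloor>- (real (Suc n) * R)\<rfloor>..\<lfloor>real (Suc n) * R\<rfloor>}" if "x \<in> K" for x and j :: 2
    proof -
      have "\<bar>x $ j\<bar> \<le> R" using component_le_norm_cart[of x j] R[OF that] by linarith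
      then have "- (real (Suc n) * R) \<le> real (Suc n) * (x $ j)" "real (Suc n) * (x $ j) \<le> real (Suc n) * R"
        using mult_left_mono[of "- R" "x $ j" "real (Suc n)"] mult_left_mono[of "x $ j" R "real (Suc n)"]
        by (auto simp: abs_le_iff)
      then show ?thesis by (auto intro: floor_mono)
    qed
    then have "q n ` K \<subseteq> {\<lfloor>- (real (Suc n) * R)\<rfloor>..\<lfloor>real (Suc n) * R\<rfloor>} \<times> {\<lfloor>- (real (Suc n) * R)\<rfloor>..\<lfloor>real (Suc n) * R\<rfloor>}"
      unfolding q_def by blast
    then show ?thesis by (rule finite_subset) simp
  qed
  define A where "A n c = K \<inter> {x. q n x = c}" for n c
  have A_meas [measurable]: "A n c \<in> sets borel" for n c using K(1) q_meas by (auto simp: A_def)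
  obtain B where B: "\<And>n c. B n c \<in> sets borel" "\<And>n c. (\<lambda>x. x $ k) ` A n c \<subseteq> B n c"
    and B_le: "\<And>n c. emeasure lborel (B n c) \<le> 2 * hausdorff1_outer (A n c)"
    using projection_cover[of k "A _ _"] by metis
  \<comment> \<open>\<open>S n\<close> is a lower sum: each cell contributes the infimum of
    \<open>F\<close> on it above a Borel set that covers its projection. The lower limit of the
    \<open>S n\<close> will be the required function, with Fatou's lemma for its integral.\<close>
  define m where "m n c = (INF x\<in>A n c. ennreal (F x))" for n c
  define S where "S n y = (\<Sum>c\<in>q n ` K. m n c * indicator (B n c) y)" for n y
  have S_meas [measurable]: "S n \<in> borel_measurable borel" for n
    unfolding S_def using B by measurable
  have S_int: "(\<integral>\<^sup>+y. S n y \<partial>lborel) \<le> 2 * bd_int K F" for n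
  proof -
    have "(\<integral>\<^sup>+y. S n y \<partial>lborel) = (\<Sum>c\<in>q n ` K. m n c * emeasure lborel (B n c))"
      unfolding S_def using B by (subst nn_integral_sum) (auto simp: nn_integral_cmult_indicator)
    also have "\<dots> \<le> (\<Sum>c\<in>q n ` K. m n c * (2 * emeasure hausdorff1 (A n c)))"
      using B_le emeasure_hausdorff1[OF pos A_meas] by (intro sum_mono mult_left_mono) auto
    also have "\<dots> = 2 * (\<Sum>c\<in>q n ` K. m n c * emeasure hausdorff1 (A n c))"
      by (simp add: sum_distrib_left mult_ac)
    also have "(\<Sum>c\<in>q n ` K. m n c * emeasure hausdorff1 (A n c)) =
        (\<integral>\<^sup>+x. (\<Sum>c\<in>q n ` K. m n c * indicator (A n c) x) \<partial>hausdorff1)"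
      by (subst nn_integral_sum) (auto simp: nn_integral_cmult_indicator)
    also have "\<dots> \<le> bd_int K F"
      unfolding bd_int_def
    proof (rule nn_integral_mono)
      fix x
      show "(\<Sum>c\<in>q n ` K. m n c * indicator (A n c) x) \<le> ennreal (F x) * indicator K x"
      proof (cases "x \<in> K")
        case True
        have "(\<Sum>c\<in>q n ` K. m n c * indicator (A n c) x) = (\<Sum>c\<in>{q n x}. m n c * indicator (A n c) x)"
          using q_fin True by (intro sum.mono_neutral_right) (auto simp: A_def indicator_def)
        also have "\<dots> \<le> ennreal (F x)"
          using True by (auto simp: A_def m_def intro!: INF_lower2[of x])
        finally show ?thesis using True by simp
      next
        case False then show ?thesis by (simp add: A_def)
      qed
    qed
    finally show ?thesis by (simp add: mult_left_mono)
  qed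
  \<comment> \<open>As soon as the grid separates the finitely many points of \<open>P\<close>, they
    lie in different cells, each of which contributes at height \<open>y\<close>. By continuity the
    infimum of \<open>F\<close> over the cell of \<open>p\<close> is at least \<open>F p - e\<close>
    for fine grids.\<close>
  have lower: "(\<Sum>p\<in>P. ennreal (F p)) \<le> liminf (\<lambda>n. S n y)"
    if P: "finite P" "P \<subseteq> K" "\<forall>p\<in>P. p $ k = y" for y P
  proof -
    have *: "(\<Sum>p\<in>P. ennreal (F p - e)) \<le> liminf (\<lambda>n. S n y)" if e: "e > 0" for e
    proof (rule Liminf_bounded)
      have ev1: "\<forall>\<^sub>F n in sequentially. ennreal (F p - e) \<le> m n (q n p)" if p: "p \<in> P" for p
      proof -
        have "isCont F p" using F by (simp add: continuous_on_eq_continuous_at)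
        then obtain d where d: "d > 0" "\<And>x. norm (x - p) < d \<Longrightarrow> \<bar>F x - F p\<bar> < e"
          using e unfolding continuous_at_eps_delta dist_norm real_norm_def by blast
        have "(\<lambda>n. 2 / real (Suc n)) \<longlonglongrightarrow> 0" by (intro LIMSEQ_Suc lim_const_over_n)
        then have "\<forall>\<^sub>F n in sequentially. 2 / real (Suc n) < d"
          using d(1) by (intro order_tendstoD(2)[of _ 0]) auto
        then show ?thesis
        proof eventually_elim
          case (elim n)
          show ?case unfolding m_def
          proof (rule INF_greatest)
            fix x assume "x \<in> A n (q n p)"
            then have "norm (x - p) < d" using q_close[of n x p] elim by (auto simp: A_def)
            then have "F p - e \<le> F x" using d(2)[of x] by (simp add: abs_less_iff)
            then show "ennreal (F p - e) \<le> ennreal (F x)" by (rule ennreal_leI)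
          qed
        qed
      qed
      have ev2: "\<forall>\<^sub>F n in sequentially. q n p \<noteq> q n p'" if "p \<noteq> p'" for p p'
      proof -
        have "(\<lambda>n. 2 / real (Suc n)) \<longlonglongrightarrow> 0" by (intro LIMSEQ_Suc lim_const_over_n)
        then have "\<forall>\<^sub>F n in sequentially. 2 / real (Suc n) < norm (p - p')"
          using that by (intro order_tendstoD(2)[of _ 0]) auto
        then show ?thesis by eventually_elim (use q_close in fastforce)
      qed
      have "\<forall>\<^sub>F n in sequentially. (\<forall>p\<in>P. ennreal (F p - e) \<le> m n (q n p)) \<and> (\<forall>p\<in>P. \<forall>p'\<in>P. p \<noteq> p' \<longrightarrow> q n p \<noteq> q n p')"
        using P(1) ev1 ev2 by (simp add: eventually_conj_iff eventually_ball_finite_distrib)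
      then show "\<forall>\<^sub>F n in sequentially. (\<Sum>p\<in>P. ennreal (F p - e)) \<le> S n y"
      proof eventually_elim
        case (elim n)
        then have inj: "inj_on (q n) P" by (auto simp: inj_on_def)
        have "(\<Sum>p\<in>P. ennreal (F p - e)) \<le> (\<Sum>p\<in>P. m n (q n p) * indicator (B n (q n p)) y)"
        proof (rule sum_mono)
          fix p assume p: "p \<in> P"
          then have "p $ k \<in> (\<lambda>x. x $ k) ` A n (q n p)" using P by (auto simp: A_def)
          then have "y \<in> B n (q n p)" using B(2)[of n "q n p"] P(3) p by auto
          then show "ennreal (F p - e) \<le> m n (q n p) * indicator (B n (q n p)) y" using elim p by simp
        qed
        also have "\<dots> = (\<Sum>c\<in>q n ` P. m n c * indicator (B n c) y)"
          by (simp add: sum.reindex[OF inj])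
        also have "\<dots> \<le> S n y" unfolding S_def using P q_fin by (intro sum_mono2) auto
        finally show ?case .
      qed
    qed
    have "(\<lambda>j. \<Sum>p\<in>P. ennreal (F p - 1 / real (Suc j))) \<longlonglongrightarrow> (\<Sum>p\<in>P. ennreal (F p - 0))"
      by (intro tendsto_sum tendsto_ennrealI tendsto_diff tendsto_const LIMSEQ_Suc lim_1_over_n)
    then have "(\<Sum>p\<in>P. ennreal (F p - 0)) \<le> liminf (\<lambda>n. S n y)"
      using * by (intro LIMSEQ_le_const2) auto
    then show ?thesis by simp
  qed
  show ?thesis
  proof (intro bexI[of _ "\<lambda>y. liminf (\<lambda>n. S n y)"] conjI allI impI)
    have "(\<integral>\<^sup>+y. liminf (\<lambda>n. S n y) \<partial>lborel) \<le> liminf (\<lambda>n. \<integral>\<^sup>+y. S n y \<partial>lborel)"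
      by (rule nn_integral_liminf) simp
    also have "\<dots> \<le> limsup (\<lambda>n. \<integral>\<^sup>+y. S n y \<partial>lborel)" by (rule Liminf_le_Limsup) simp
    also have "\<dots> \<le> 2 * bd_int K F" using S_int by (intro Limsup_bounded) auto
    finally show "(\<integral>\<^sup>+y. liminf (\<lambda>n. S n y) \<partial>lborel) \<le> 2 * bd_int K F" .
  qed (use lower in auto)
qed

section \<open>The fundamental theorem of calculus on bounded open sets of reals\<close>

lemma bounded_open_real_component:
  fixes U :: "real set"
  assumes U: "open U" "bounded U" and C: "C \<in> components U"
  shows "Inf C < Sup C" "C = {Inf C<..<Sup C}" "Inf C \<in> frontier U" "Sup C \<in> frontier U"
proof -
  have ne: "C \<noteq> {}" and sub: "C \<subseteq> U" and conn: "connected C"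
    using in_components_nonempty[OF C] in_components_subset[OF C] in_components_connected[OF C] by auto
  have op: "open C" using open_components[OF U(1) C] .
  have bdd: "bdd_above C" "bdd_below C"
    using bounded_subset[OF U(2) sub] by (auto simp: bounded_imp_bdd_above bounded_imp_bdd_below)
  have notin: "Inf C \<notin> C" "Sup C \<notin> C"
  proof -
    show "Inf C \<notin> C"
    proof
      assume "Inf C \<in> C"
      then obtain e where "e > 0" "ball (Inf C) e \<subseteq> C" using op open_contains_ball by blast
      then have "Inf C - e / 2 \<in> C" by (auto simp: subset_eq dist_real_def)
      then show False using cInf_lower[OF _ bdd(2)] \<open>e > 0\<close> by fastforce
    qed
    show "Sup C \<notin> C"
    proof
      assume "Sup C \<in> C"
      then obtain e where "e > 0" "ball (Sup C) e \<subseteq> C" using op open_contains_ball by blast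
      then have "Sup C + e / 2 \<in> C" by (auto simp: subset_eq dist_real_def)
      then show False using cSup_upper[OF _ bdd(1)] \<open>e > 0\<close> by fastforce
    qed
  qed
  show eq: "C = {Inf C<..<Sup C}"
  proof (intro equalityI subsetI)
    fix x assume x: "x \<in> C"
    then show "x \<in> {Inf C<..<Sup C}"
      using cInf_lower[OF x bdd(2)] cSup_upper[OF x bdd(1)] notin by (auto simp: less_le)
  next
    fix x assume "x \<in> {Inf C<..<Sup C}"
    then obtain a b where "a \<in> C" "a < x" "b \<in> C" "x < b"
      using cInf_lessD[OF ne, of x] less_cSupD[OF ne, of x] by auto
    then show "x \<in> C" using conn by (meson connected_iff_interval less_imp_le)
  qed
  show lt: "Inf C < Sup C" using eq ne by (metis greaterThanLessThan_empty_iff not_le)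
  have "closure C = {Inf C..Sup C}" using eq lt closure_greaterThanLessThan by metis
  then have "Inf C \<in> closure U" "Sup C \<in> closure U"
    using closure_mono[OF sub] lt by auto
  \<comment> \<open>An end point inside \<open>U\<close> could be adjoined to \<open>C\<close>,
    giving a larger connected subset of \<open>U\<close> against maximality of the
    component.\<close>
  moreover have "Inf C \<notin> U"
  proof
    assume *: "Inf C \<in> U"
    have "connected {Inf C..<Sup C}" by simp
    moreover have "{Inf C..<Sup C} \<subseteq> U"
    proof
      fix x assume "x \<in> {Inf C..<Sup C}"
      then show "x \<in> U" using * sub eq by (cases "x = Inf C") auto
    qed
    moreover have "C \<subseteq> {Inf C..<Sup C}" by (subst (1) eq) auto
    then have "C \<inter> {Inf C..<Sup C} \<noteq> {}" using ne by blast
    ultimately have "{Inf C..<Sup C} \<subseteq> C" using C components_maximal by blast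
    then show False using lt notin(1) by auto
  qed
  moreover have "Sup C \<notin> U"
  proof
    assume *: "Sup C \<in> U"
    have "connected {Inf C<..Sup C}" by simp
    moreover have "{Inf C<..Sup C} \<subseteq> U"
    proof
      fix x assume "x \<in> {Inf C<..Sup C}"
      then show "x \<in> U" using * sub eq by (cases "x = Sup C") auto
    qed
    moreover have "C \<subseteq> {Inf C<..Sup C}" by (subst (1) eq) auto
    then have "C \<inter> {Inf C<..Sup C} \<noteq> {}" using ne by blast
    ultimately have "{Inf C<..Sup C} \<subseteq> C" using C components_maximal by blast
    then show False using lt notin(2) by auto
  qed
  ultimately show "Inf C \<in> frontier U" "Sup C \<in> frontier U"
    using U(1) by (auto simp: frontier_def interior_open)
qed

lemma integral_indicator_Ioo_FTC:
  fixes g g' :: "real \<Rightarrow> real"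
  assumes g: "\<And>t. (g has_real_derivative g' t) (at t)" and g': "continuous_on UNIV g'" and ab: "a \<le> b"
  shows "(\<integral>t. indicator {a<..<b} t * g' t \<partial>lborel) = g b - g a"
proof -
  have [measurable]: "g' \<in> borel_measurable borel" using g' by (rule borel_measurable_continuous_onI)
  have "(\<integral>t. indicator {a<..<b} t * g' t \<partial>lborel) = (\<integral>t. g' t * indicator {a..b} t \<partial>lborel)"
  proof (rule integral_cong_AE)
    show "AE t in lborel. indicator {a<..<b} t * g' t = g' t * indicator {a..b} t"
      using AE_lborel_singleton[of a] AE_lborel_singleton[of b]
      by eventually_elim (auto simp: indicator_def)
  qed measurable
  also have "\<dots> = g b - g a"
    using g g' by (intro integral_FTC_Icc_real[OF ab]) (auto simp: continuous_on_eq_continuous_at)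
  finally show ?thesis .
qed

lemma integrable_bounded_continuous:
  fixes f :: "'a::euclidean_space \<Rightarrow> real"
  assumes U: "U \<in> sets borel" "bounded U" and f: "continuous_on UNIV f"
  shows "integrable lborel (\<lambda>x. indicator U x * f x)"
proof -
  have [measurable]: "f \<in> borel_measurable borel" using f by (rule borel_measurable_continuous_onI)
  have "compact (closure U)" using U(2) by (simp add: compact_closure)
  then have "integrable lborel (\<lambda>x. indicator (closure U) x *\<^sub>R f x)"
    by (rule borel_integrable_compact) (rule continuous_on_subset[OF f], simp)
  then show ?thesis
  proof (rule Bochner_Integration.integrable_bound)
    show "AE x in lborel. norm (indicator U x * f x) \<le> norm (indicator (closure U) x *\<^sub>R f x)"
      using closure_subset[of U] by (auto simp: indicator_def)
    show "(\<lambda>x. indicator U x * f x) \<in> borel_measurable lborel" using U(1) by measurable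
  qed
qed

text \<open>Integrate the derivative from the left end of the component of \<open>x\<close> up to
  \<open>x\<close>. Enlarging the domain of integration to all of \<open>U\<close> makes the second
  summand independent of \<open>x\<close>, as a majorant for a whole slice requires.\<close>

lemma bounded_open_real_sup_bound:
  fixes g g' :: "real \<Rightarrow> real"
  assumes U: "open U" "bounded U" and x: "x \<in> U"
    and g: "\<And>t. (g has_real_derivative g' t) (at t)" and g': "continuous_on UNIV g'"
  shows "\<exists>a \<in> frontier U. ennreal \<bar>g x\<bar> \<le> ennreal \<bar>g a\<bar> + (\<integral>\<^sup>+t. ennreal \<bar>g' t\<bar> * indicator U t \<partial>lborel)"
proof -
  obtain C where C: "C \<in> components U" "x \<in> C" using x Union_components[of U] by blast
  note comp = bounded_open_real_component[OF U C(1)]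
  let ?a = "Inf C"
  have x': "x \<in> {?a<..<Sup C}" using C(2) comp(2) by simp
  then have ax: "?a < x" by simp
  have "{?a<..<x} \<subseteq> C" using x' by (subst comp(2)) auto
  then have ax2: "{?a<..<x} \<subseteq> U" using in_components_subset[OF C(1)] by simp
  have int: "integrable lborel (\<lambda>t. indicator {?a<..<x} t * g' t)"
    by (rule integrable_bounded_continuous) (auto intro: g')
  have "ennreal \<bar>g x - g ?a\<bar> = ennreal (norm (\<integral>t. indicator {?a<..<x} t * g' t \<partial>lborel))"
    using integral_indicator_Ioo_FTC[OF g g', of ?a x] ax by simp
  also have "\<dots> \<le> (\<integral>\<^sup>+t. ennreal (norm (indicator {?a<..<x} t * g' t)) \<partial>lborel)"
    by (rule integral_norm_bound_ennreal[OF int])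
  also have "\<dots> \<le> (\<integral>\<^sup>+t. ennreal \<bar>g' t\<bar> * indicator U t \<partial>lborel)"
    using ax2 by (intro nn_integral_mono) (auto simp: indicator_def)
  finally have *: "ennreal \<bar>g x - g ?a\<bar> \<le> (\<integral>\<^sup>+t. ennreal \<bar>g' t\<bar> * indicator U t \<partial>lborel)" .
  have "ennreal \<bar>g x\<bar> \<le> ennreal (\<bar>g ?a\<bar> + \<bar>g x - g ?a\<bar>)" by (intro ennreal_leI) simp
  also have "\<dots> = ennreal \<bar>g ?a\<bar> + ennreal \<bar>g x - g ?a\<bar>" by simp
  also have "\<dots> \<le> ennreal \<bar>g ?a\<bar> + (\<integral>\<^sup>+t. ennreal \<bar>g' t\<bar> * indicator U t \<partial>lborel)"
    by (intro add_left_mono *)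
  finally show ?thesis using comp(3) by blast
qed

text \<open>On each component the integral is the difference of the values at its ends. Neighbouring
  components may share an end point, but distinct ones have distinct right ends and distinct left
  ends; summing right and left ends separately gives the factor 2. Only finite sums are controlled
  by \<open>S\<close>, so \<open>U\<close> is exhausted by finite unions of components and dominated
  convergence concludes.\<close>

lemma bounded_open_real_integral_bound:
  fixes g g' :: "real \<Rightarrow> real"
  assumes U: "open U" "bounded U"
    and g: "\<And>t. (g has_real_derivative g' t) (at t)" and g': "continuous_on UNIV g'"
    and S: "\<And>P. finite P \<Longrightarrow> P \<subseteq> frontier U \<Longrightarrow> (\<Sum>p\<in>P. ennreal \<bar>g p\<bar>) \<le> S"
  shows "ennreal \<bar>\<integral>t. indicator U t * g' t \<partial>lborel\<bar> \<le> 2 * S"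
proof (cases "U = {}")
  case False
  let ?C = "components U"
  have ne: "?C \<noteq> {}" using False by simp
  have cnt: "countable ?C"
    using pairwise_disjoint_components[of U] open_components[OF U(1)]
    by (intro countable_disjoint_open_subsets) (auto simp: pairwise_def disjnt_def)
  \<comment> \<open>With finitely many components the enumeration repeats members; since
    \<open>W n\<close> is a union over an image set, repetitions do not matter.\<close>
  define c where "c = from_nat_into ?C"
  have c: "c n \<in> ?C" for n unfolding c_def using ne by (rule from_nat_into)
  have rc: "range c = ?C" unfolding c_def using ne cnt by (rule range_from_nat_into)
  define W where "W n = \<Union> (c ` {..<n})" for n
  have Wo: "open (W n)" for n using open_components[OF U(1) c] by (auto simp: W_def)
  have WU: "W n \<subseteq> U" for n using in_components_subset[OF c] by (auto simp: W_def)
  have bound: "ennreal \<bar>\<integral>t. indicator (W n) t * g' t \<partial>lborel\<bar> \<le> 2 * S" for n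
  proof -
    let ?F = "c ` {..<n}"
    have F: "finite ?F" "?F \<subseteq> ?C" using c by auto
    have disj: "disjoint_family_on (\<lambda>X. X) ?F"
      using pairwise_disjoint_components[of U] F(2) by (auto simp: disjoint_family_on_def pairwise_def disjnt_def)
    have int: "integrable lborel (\<lambda>t. indicator X t * g' t)" if "X \<in> ?C" for X
      using open_components[OF U(1) that] in_components_subset[OF that] U(2)
      by (intro integrable_bounded_continuous g') (auto intro: bounded_subset)
    have ind: "indicator (W n) t = (\<Sum>X\<in>?F. indicator X t :: real)" for t
      using indicator_UN_disjoint[OF F(1) disj, of t] by (simp add: W_def)
    have "(\<integral>t. indicator (W n) t * g' t \<partial>lborel) = (\<Sum>X\<in>?F. \<integral>t. indicator X t * g' t \<partial>lborel)"
      unfolding ind sum_distrib_right by (rule Bochner_Integration.integral_sum) (use int F in auto)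
    also have "\<dots> = (\<Sum>X\<in>?F. g (Sup X) - g (Inf X))"
    proof (rule sum.cong)
      fix X assume "X \<in> ?F"
      then have X: "X \<in> ?C" using F by auto
      show "(\<integral>t. indicator X t * g' t \<partial>lborel) = g (Sup X) - g (Inf X)"
        using integral_indicator_Ioo_FTC[OF g g', of "Inf X" "Sup X"] bounded_open_real_component(1,2)[OF U X]
        by simp
    qed simp
    finally have "\<bar>\<integral>t. indicator (W n) t * g' t \<partial>lborel\<bar> \<le> (\<Sum>X\<in>?F. \<bar>g (Sup X)\<bar> + \<bar>g (Inf X)\<bar>)"
      using sum_abs[of "\<lambda>X. g (Sup X) - g (Inf X)" ?F]
        sum_mono[of ?F "\<lambda>X. \<bar>g (Sup X) - g (Inf X)\<bar>" "\<lambda>X. \<bar>g (Sup X)\<bar> + \<bar>g (Inf X)\<bar>"]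
      by (smt (verit) abs_triangle_ineq4)
    then have "ennreal \<bar>\<integral>t. indicator (W n) t * g' t \<partial>lborel\<bar> \<le> (\<Sum>X\<in>?F. ennreal (\<bar>g (Sup X)\<bar> + \<bar>g (Inf X)\<bar>))"
      by (subst sum_ennreal) (auto intro: ennreal_leI)
    also have "\<dots> = (\<Sum>X\<in>?F. ennreal \<bar>g (Sup X)\<bar>) + (\<Sum>X\<in>?F. ennreal \<bar>g (Inf X)\<bar>)"
      by (simp add: sum.distrib)
    also have "\<dots> \<le> S + S"
    proof (rule add_mono)
      \<comment> \<open>Two components with a common right end, or a common left end, overlap just
        inside it and therefore coincide. This makes the reindexing by end points injective.\<close>
      have eq: "X = Y" if "X \<in> ?F" "Y \<in> ?F" "Sup X = Sup Y \<or> Inf X = Inf Y" for X Y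
      proof (rule ccontr)
        assume ne: "X \<noteq> Y"
        have XY: "X \<in> ?C" "Y \<in> ?C" using that F by auto
        note cX = bounded_open_real_component(1,2)[OF U XY(1)] and cY = bounded_open_real_component(1,2)[OF U XY(2)]
        have "\<exists>z. Inf X < z \<and> Inf Y < z \<and> z < Sup X \<and> z < Sup Y"
          using that(3) cX(1) cY(1) dense[of "max (Inf X) (Inf Y)" "min (Sup X) (Sup Y)"] by auto
        then have "X \<inter> Y \<noteq> {}" using cX(2) cY(2) by (metis Int_iff empty_iff greaterThanLessThan_iff)
        then show False using ne XY pairwise_disjoint_components[of U] by (auto simp: pairwise_def disjnt_def)
      qed
      have "(\<Sum>X\<in>?F. ennreal \<bar>g (Sup X)\<bar>) = (\<Sum>p\<in>Sup ` ?F. ennreal \<bar>g p\<bar>)"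
        using eq by (subst sum.reindex) (auto simp: inj_on_def)
      then show "(\<Sum>X\<in>?F. ennreal \<bar>g (Sup X)\<bar>) \<le> S"
        using S[of "Sup ` ?F"] F bounded_open_real_component(4)[OF U] by auto
      have "(\<Sum>X\<in>?F. ennreal \<bar>g (Inf X)\<bar>) = (\<Sum>p\<in>Inf ` ?F. ennreal \<bar>g p\<bar>)"
        using eq by (subst sum.reindex) (auto simp: inj_on_def)
      then show "(\<Sum>X\<in>?F. ennreal \<bar>g (Inf X)\<bar>) \<le> S"
        using S[of "Inf ` ?F"] F bounded_open_real_component(3)[OF U] by auto
    qed
    finally show ?thesis by (simp add: mult_2)
  qed
  have [measurable]: "g' \<in> borel_measurable borel" using g' by (rule borel_measurable_continuous_onI)
  have [measurable]: "U \<in> sets borel" "W n \<in> sets borel" for n using U Wo by auto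
  have "(\<lambda>n. \<integral>t. indicator (W n) t * g' t \<partial>lborel) \<longlonglongrightarrow> (\<integral>t. indicator U t * g' t \<partial>lborel)"
  proof (rule integral_dominated_convergence)
    show "integrable lborel (\<lambda>t. norm (indicator U t * g' t))"
      using U g' by (intro integrable_norm integrable_bounded_continuous) auto
    show "AE t in lborel. (\<lambda>n. indicator (W n) t * g' t) \<longlonglongrightarrow> indicator U t * g' t"
    proof (rule AE_I2)
      fix t
      show "(\<lambda>n. indicator (W n) t * g' t) \<longlonglongrightarrow> indicator U t * g' t"
      proof (cases "t \<in> U")
        case True
        then obtain k where "t \<in> c k" using rc Union_components[of U] by (metis UnionE rangeE)
        then have "\<forall>n\<ge>Suc k. indicator (W n) t * g' t = indicator U t * g' t"
          using True by (auto simp: W_def indicator_def)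
        then show ?thesis by (intro tendsto_eventually) (auto simp: eventually_sequentially)
      next
        case False
        then have "t \<notin> W n" for n using WU by auto
        with False show ?thesis by simp
      qed
    qed
    show "AE t in lborel. norm (indicator (W n) t * g' t) \<le> norm (indicator U t * g' t)" for n
      using WU[of n] by (auto simp: indicator_def)
  qed measurable
  then have "(\<lambda>n. ennreal \<bar>\<integral>t. indicator (W n) t * g' t \<partial>lborel\<bar>) \<longlonglongrightarrow> ennreal \<bar>\<integral>t. indicator U t * g' t \<partial>lborel\<bar>"
    by (intro tendsto_ennrealI tendsto_rabs)
  then show ?thesis by (rule LIMSEQ_le_const2) (use bound in blast)
qed simp

section \<open>Slices parallel to the axes\<close>

definition other :: "2 \<Rightarrow> 2" where "other i = (if i = 1 then 2 else 1)"

definition slice_pt :: "2 \<Rightarrow> real \<Rightarrow> real \<Rightarrow> real^2" where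
  "slice_pt i t y = (\<chi> k. if k = i then t else y)"

lemma other_neq [simp]: "other i \<noteq> i" "i \<noteq> other i"
  using exhaust_2[of i] by (auto simp: other_def)

lemma slice_pt_same [simp]: "slice_pt i t y $ i = t"
  by (simp add: slice_pt_def)

lemma slice_pt_other [simp]: "slice_pt i t y $ other i = y"
  by (simp add: slice_pt_def)

lemma UNIV_other: "UNIV = {i, other i}"
  using exhaust_2[of i] by (auto simp: other_def UNIV_2)

lemma slice_pt_components [simp]: "slice_pt i (x $ i) (x $ other i) = x"
proof -
  have "\<forall>k\<in>{i, other i}. slice_pt i (x $ i) (x $ other i) $ k = x $ k" by simp
  then show ?thesis unfolding vec_eq_iff UNIV_other[of i, symmetric] by simp
qed

lemma slice_pt_eq: "slice_pt i t y = slice_pt i 0 y + t *\<^sub>R axis i 1"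
  by (simp add: slice_pt_def vec_eq_iff axis_def)

lemma continuous_slice_pt: "continuous_on UNIV (\<lambda>z. slice_pt i (snd z) (fst z))"
  unfolding slice_pt_def
  by (intro continuous_on_vec_lambda, rename_tac k, case_tac "k = i") (auto intro!: continuous_intros)

lemma measurable_slice_pt [measurable]: "(\<lambda>z. slice_pt i (snd z) (fst z)) \<in> borel_measurable borel"
  by (rule borel_measurable_continuous_onI[OF continuous_slice_pt])

lemma continuous_slice_pt1: "continuous_on UNIV (\<lambda>t. slice_pt i t y)"
  unfolding slice_pt_def
  by (intro continuous_on_vec_lambda, rename_tac k, case_tac "k = i") (auto intro!: continuous_intros)

lemma Basis_vec_real: "(Basis :: (real^'n::finite) set) = range (\<lambda>j. axis j 1)"
  by (auto simp: Basis_vec_def)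

text \<open>Lebesgue measure is determined by its values on boxes, and here boxes pull back to
  rectangles. The transverse coordinate is the first component of the pair, so that iterated
  integration has the line in direction \<open>i\<close> as its inner variable.\<close>

lemma distr_slice_pt: "distr (lborel \<Otimes>\<^sub>M lborel) borel (\<lambda>z. slice_pt i (snd z) (fst z)) = lborel"
proof (rule lborel_eqI[symmetric])
  fix l u :: "real^2" assume le: "\<And>b. b \<in> Basis \<Longrightarrow> l \<bullet> b \<le> u \<bullet> b"
  have le': "l $ j \<le> u $ j" for j using le[of "axis j 1"] by (auto simp: Basis_vec_real inner_axis)
  have "(\<lambda>z. slice_pt i (snd z) (fst z)) -` box l u = {l $ other i <..< u $ other i} \<times> {l $ i <..< u $ i}"
  proof -
    have "slice_pt i t y \<in> box l u \<longleftrightarrow> l $ i < t \<and> t < u $ i \<and> l $ other i < y \<and> y < u $ other i" for t y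
    proof -
      have "slice_pt i t y \<in> box l u \<longleftrightarrow> (\<forall>k\<in>UNIV. l $ k < slice_pt i t y $ k \<and> slice_pt i t y $ k < u $ k)"
        by (simp add: mem_box_cart)
      then show ?thesis unfolding UNIV_other[of i] by auto
    qed
    then show ?thesis by auto
  qed
  then have "emeasure (distr (lborel \<Otimes>\<^sub>M lborel) borel (\<lambda>z. slice_pt i (snd z) (fst z))) (box l u) =
      emeasure (lborel \<Otimes>\<^sub>M lborel) ({l $ other i <..< u $ other i} \<times> {l $ i <..< u $ i})"
    by (subst emeasure_distr) (auto simp: lborel_prod space_pair_measure intro: measurable_slice_pt)
  also have "\<dots> = ennreal ((u $ other i - l $ other i) * (u $ i - l $ i))"
    using le' by (simp add: lborel.emeasure_pair_measure_Times ennreal_mult)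
  also have "(u $ other i - l $ other i) * (u $ i - l $ i) = (\<Prod>j\<in>UNIV. u $ j - l $ j)"
    unfolding UNIV_other[of i] by (simp add: mult.commute)
  also have "\<dots> = (\<Prod>b\<in>Basis. (u - l) \<bullet> b)"
    unfolding Basis_vec_real
    by (subst prod.reindex) (auto simp: inj_on_def axis_eq_axis inner_axis inner_diff_left)
  finally show "emeasure (distr (lborel \<Otimes>\<^sub>M lborel) borel (\<lambda>z. slice_pt i (snd z) (fst z))) (box l u) = (\<Prod>b\<in>Basis. (u - l) \<bullet> b)" .
qed simp

lemma measurable_slice_pt_pair [measurable]: "(\<lambda>z. slice_pt i (snd z) (fst z)) \<in> lborel \<Otimes>\<^sub>M lborel \<rightarrow>\<^sub>M borel"
  using measurable_slice_pt[of i] by (simp add: lborel_prod)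

lemma nn_integral_slice_pt:
  assumes [measurable]: "f \<in> borel_measurable borel"
  shows "(\<integral>\<^sup>+x. f x \<partial>lborel) = (\<integral>\<^sup>+y. \<integral>\<^sup>+t. f (slice_pt i t y) \<partial>lborel \<partial>lborel)"
proof -
  have "(\<integral>\<^sup>+x. f x \<partial>lborel) = (\<integral>\<^sup>+z. f (slice_pt i (snd z) (fst z)) \<partial>(lborel \<Otimes>\<^sub>M lborel))"
    by (subst distr_slice_pt[of i, symmetric], subst nn_integral_distr) simp_all
  also have "\<dots> = (\<integral>\<^sup>+y. \<integral>\<^sup>+t. f (slice_pt i t y) \<partial>lborel \<partial>lborel)"
    by (subst lborel.nn_integral_fst[symmetric]) simp_all
  finally show ?thesis .
qed

lemma integral_slice_pt:
  fixes f :: "real^2 \<Rightarrow> real"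
  assumes f: "integrable lborel f"
  shows "integrable lborel (\<lambda>y. \<integral>t. f (slice_pt i t y) \<partial>lborel)"
    and "(\<integral>x. f x \<partial>lborel) = (\<integral>y. \<integral>t. f (slice_pt i t y) \<partial>lborel \<partial>lborel)"
proof -
  have [measurable]: "f \<in> borel_measurable borel" using borel_measurable_integrable[OF f] by simp
  have int: "integrable (lborel \<Otimes>\<^sub>M lborel) (\<lambda>z. f (slice_pt i (snd z) (fst z)))"
    using f by (subst (asm) distr_slice_pt[of i, symmetric], subst (asm) integrable_distr_eq) simp_all
  show "integrable lborel (\<lambda>y. \<integral>t. f (slice_pt i t y) \<partial>lborel)"
    using lborel_pair.integrable_fst'[OF int] by simp
  have "(\<integral>x. f x \<partial>lborel) = (\<integral>z. f (slice_pt i (snd z) (fst z)) \<partial>(lborel \<Otimes>\<^sub>M lborel))"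
    by (subst distr_slice_pt[of i, symmetric], subst integral_distr) simp_all
  also have "\<dots> = (\<integral>y. \<integral>t. f (slice_pt i t y) \<partial>lborel \<partial>lborel)"
    using lborel_pair.integral_fst'[OF int] by simp
  finally show "(\<integral>x. f x \<partial>lborel) = (\<integral>y. \<integral>t. f (slice_pt i t y) \<partial>lborel \<partial>lborel)" .
qed

lemma Ck1_slice_derivative:
  assumes "Ck (Suc 0) F"
  shows "((\<lambda>t. F (slice_pt i t y)) has_real_derivative partial i F (slice_pt i t y)) (at t)"
proof -
  have "F differentiable (at (slice_pt i t y))" using assms by simp
  then have dF: "(F has_derivative frechet_derivative F (at (slice_pt i t y))) (at (slice_pt i t y))"
    by (simp add: frechet_derivative_works)
  have dm: "((\<lambda>t. slice_pt i t y) has_derivative (\<lambda>h. h *\<^sub>R axis i 1)) (at t)"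
    by (subst slice_pt_eq) (auto intro!: derivative_eq_intros)
  have "((\<lambda>t. F (slice_pt i t y)) has_derivative (\<lambda>h. frechet_derivative F (at (slice_pt i t y)) (h *\<^sub>R axis i 1))) (at t)"
    by (rule has_derivative_compose[OF dm dF])
  moreover have "frechet_derivative F (at (slice_pt i t y)) (h *\<^sub>R axis i 1) = partial i F (slice_pt i t y) * h" for h
    using has_derivative_linear[OF dF] by (simp add: partial_def linear_cmul)
  ultimately show ?thesis by (simp add: has_field_derivative_def)
qed

lemma Ck1_continuous: "Ck (Suc 0) F \<Longrightarrow> continuous_on UNIV F"
  by (simp add: continuous_at_imp_continuous_on differentiable_imp_continuous_within)

lemma Ck1_partial_continuous: "Ck (Suc 0) F \<Longrightarrow> continuous_on UNIV (partial i F)"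
  by simp

lemma slice:
  assumes "open \<Omega>" "bounded \<Omega>"
  shows open_slice: "open {t. slice_pt i t y \<in> \<Omega>}" and bounded_slice: "bounded {t. slice_pt i t y \<in> \<Omega>}"
    and frontier_slice: "t \<in> frontier {t. slice_pt i t y \<in> \<Omega>} \<Longrightarrow> slice_pt i t y \<in> frontier \<Omega>"
proof -
  have eq: "{t. slice_pt i t y \<in> \<Omega>} = (\<lambda>t. slice_pt i t y) -` \<Omega>" by auto
  show op: "open {t. slice_pt i t y \<in> \<Omega>}"
    unfolding eq using assms(1) continuous_slice_pt1 by (intro open_vimage) auto
  obtain R where R: "\<And>x. x \<in> \<Omega> \<Longrightarrow> norm x \<le> R" using assms(2) by (auto simp: bounded_iff)
  show "bounded {t. slice_pt i t y \<in> \<Omega>}"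
    unfolding bounded_iff
  proof (intro exI ballI)
    fix t assume "t \<in> {t. slice_pt i t y \<in> \<Omega>}"
    then have "norm (slice_pt i t y) \<le> R" using R by simp
    then show "norm t \<le> R" using component_le_norm_cart[of "slice_pt i t y" i] by simp
  qed
  assume t: "t \<in> frontier {t. slice_pt i t y \<in> \<Omega>}"
  have "closed ((\<lambda>t. slice_pt i t y) -` closure \<Omega>)" using continuous_slice_pt1 by (intro closed_vimage) auto
  then have "closure {t. slice_pt i t y \<in> \<Omega>} \<subseteq> (\<lambda>t. slice_pt i t y) -` closure \<Omega>"
    using closure_subset[of \<Omega>] by (intro closure_minimal) auto
  then show "slice_pt i t y \<in> frontier \<Omega>"
    using t op assms(1) by (auto simp: frontier_def interior_open)
qed

lemma frontier_measurable: "frontier \<Omega> \<in> sets borel"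
  by (intro borel_closed frontier_closed)

lemma indicator_slice: "indicator \<Omega> (slice_pt i t y) = indicator {t. slice_pt i t y \<in> \<Omega>} t"
  by (simp add: indicator_def)

text \<open>The link between the two kinds of sums: boundary points of a slice, on which the
  one-dimensional estimates depend, are distinct points of the frontier in one fibre of the
  projection, to which Eilenberg's inequality applies.\<close>

lemma slice_fibre_sum:
  assumes \<Omega>: "open \<Omega>" "bounded \<Omega>"
    and S: "\<And>y P. finite P \<Longrightarrow> P \<subseteq> frontier \<Omega> \<Longrightarrow> \<forall>p\<in>P. p $ other i = y \<Longrightarrow> (\<Sum>p\<in>P. ennreal \<bar>F p\<bar>) \<le> S y"
    and P: "finite P" "P \<subseteq> frontier {t. slice_pt i t y \<in> \<Omega>}"
  shows "(\<Sum>p\<in>P. ennreal \<bar>F (slice_pt i p y)\<bar>) \<le> S y"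
proof -
  have inj: "inj_on (\<lambda>t. slice_pt i t y) P" by (rule inj_onI) (metis slice_pt_same)
  have "(\<Sum>p\<in>P. ennreal \<bar>F (slice_pt i p y)\<bar>) = (\<Sum>p\<in>(\<lambda>t. slice_pt i t y) ` P. ennreal \<bar>F p\<bar>)"
    by (simp add: sum.reindex[OF inj])
  also have "\<dots> \<le> S y"
    using P frontier_slice[OF \<Omega>, of _ i y] by (intro S) auto
  finally show ?thesis .
qed

text \<open>On each line in direction \<open>i\<close> the function is dominated by one boundary
  value plus the integral of its derivative along the line. Replacing the boundary value by the
  whole fibre sum gives a measurable majorant of the transverse coordinate alone, whose integral is
  controlled; this is the basis of both Poincare's and Ladyzhenskaya's inequality.\<close>

lemma sup_on_slices:
  assumes pos: "emeasure hausdorff1 G \<noteq> 0" and \<Omega>: "open \<Omega>" "bounded \<Omega>" and F: "Ck (Suc 0) F"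
  shows "\<exists>A \<in> borel_measurable borel. (\<forall>x\<in>\<Omega>. ennreal \<bar>F x\<bar> \<le> A (x $ other i)) \<and>
    (\<integral>\<^sup>+y. A y \<partial>lborel) \<le> 2 * bd_int (frontier \<Omega>) (\<lambda>x. \<bar>F x\<bar>)
        + (\<integral>\<^sup>+x. ennreal \<bar>partial i F x\<bar> * indicator \<Omega> x \<partial>lborel)"
proof -
  have cont: "continuous_on UNIV (\<lambda>x. \<bar>F x\<bar>)" using Ck1_continuous[OF F] by (intro continuous_intros)
  have bd: "bounded (frontier \<Omega>)" 
    using bounded_subset[OF bounded_closure[OF \<Omega>(2)]] by (simp add: frontier_def)
  from fibre_sum_bound[OF pos frontier_measurable bd cont, of "other i"]
  obtain S where [measurable]: "S \<in> borel_measurable borel"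
    and S_int: "(\<integral>\<^sup>+y. S y \<partial>lborel) \<le> 2 * bd_int (frontier \<Omega>) (\<lambda>x. \<bar>F x\<bar>)"
    and S: "\<And>y P. finite P \<Longrightarrow> P \<subseteq> frontier \<Omega> \<Longrightarrow> \<forall>p\<in>P. p $ other i = y \<Longrightarrow> (\<Sum>p\<in>P. ennreal \<bar>F p\<bar>) \<le> S y"
    by blast
  have [measurable]: "partial i F \<in> borel_measurable borel"
    using Ck1_partial_continuous[OF F] by (rule borel_measurable_continuous_onI)
  have [measurable]: "\<Omega> \<in> sets borel" using \<Omega> by auto
  define D where "D y = (\<integral>\<^sup>+t. ennreal \<bar>partial i F (slice_pt i t y)\<bar> * indicator \<Omega> (slice_pt i t y) \<partial>lborel)" for y
  have [measurable]: "D \<in> borel_measurable borel"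
  proof -
    have "(\<lambda>y. \<integral>\<^sup>+t. (\<lambda>z. ennreal \<bar>partial i F (slice_pt i (snd z) (fst z))\<bar> * indicator \<Omega> (slice_pt i (snd z) (fst z))) (y, t) \<partial>lborel) \<in> borel_measurable lborel"
      by (rule lborel.borel_measurable_nn_integral_fst) measurable
    then show ?thesis by (simp add: D_def[abs_def])
  qed
  show ?thesis
  proof (intro bexI[of _ "\<lambda>y. S y + D y"] conjI ballI)
    fix x assume x: "x \<in> \<Omega>"
    let ?y = "x $ other i"
    have xs: "x $ i \<in> {t. slice_pt i t ?y \<in> \<Omega>}" using x by simp
    have "continuous_on UNIV (\<lambda>t. partial i F (slice_pt i t ?y))"
      by (rule continuous_on_compose2[OF Ck1_partial_continuous[OF F] continuous_slice_pt1]) simp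
    from bounded_open_real_sup_bound[OF open_slice[OF \<Omega>] bounded_slice[OF \<Omega>] xs Ck1_slice_derivative[OF F] this]
    obtain a where a: "a \<in> frontier {t. slice_pt i t ?y \<in> \<Omega>}" and
      le: "ennreal \<bar>F (slice_pt i (x $ i) ?y)\<bar> \<le> ennreal \<bar>F (slice_pt i a ?y)\<bar>
         + (\<integral>\<^sup>+t. ennreal \<bar>partial i F (slice_pt i t ?y)\<bar> * indicator {t. slice_pt i t ?y \<in> \<Omega>} t \<partial>lborel)" by blast
    have le': "ennreal \<bar>F x\<bar> \<le> ennreal \<bar>F (slice_pt i a ?y)\<bar> + D ?y"
      using le by (simp only: D_def indicator_slice slice_pt_components)
    have "(\<Sum>p\<in>{a}. ennreal \<bar>F (slice_pt i p ?y)\<bar>) \<le> S ?y"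
      by (rule slice_fibre_sum[OF \<Omega> S]) (use a in auto)
    then have "ennreal \<bar>F (slice_pt i a ?y)\<bar> + D ?y \<le> S ?y + D ?y" by (simp add: add_right_mono)
    with le' show "ennreal \<bar>F x\<bar> \<le> S ?y + D ?y" by (rule order_trans)
  next
    have "(\<integral>\<^sup>+y. S y + D y \<partial>lborel) = (\<integral>\<^sup>+y. S y \<partial>lborel) + (\<integral>\<^sup>+y. D y \<partial>lborel)"
      by (rule nn_integral_add) simp_all
    also have "(\<integral>\<^sup>+y. D y \<partial>lborel) = (\<integral>\<^sup>+x. ennreal \<bar>partial i F x\<bar> * indicator \<Omega> x \<partial>lborel)"
      unfolding D_def by (rule nn_integral_slice_pt[symmetric]) simp
    finally show "(\<integral>\<^sup>+y. S y + D y \<partial>lborel) \<le> 2 * bd_int (frontier \<Omega>) (\<lambda>x. \<bar>F x\<bar>)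
        + (\<integral>\<^sup>+x. ennreal \<bar>partial i F x\<bar> * indicator \<Omega> x \<partial>lborel)"
      using S_int by (simp add: add_right_mono)
  qed simp
qed

text \<open>The divergence theorem weakened to an inequality: the boundary term only has to tend to
  zero, so neither a normal vector nor its sign is involved. The 4 is the product of 2 for left and
  right ends on each slice and 2 from the projection estimate.\<close>

lemma integral_partial_bound:
  assumes pos: "emeasure hausdorff1 G \<noteq> 0" and \<Omega>: "open \<Omega>" "bounded \<Omega>" and F: "Ck (Suc 0) F"
  shows "ennreal \<bar>\<integral>x. indicator \<Omega> x * partial i F x \<partial>lborel\<bar> \<le> 4 * bd_int (frontier \<Omega>) (\<lambda>x. \<bar>F x\<bar>)"
proof -
  have cont: "continuous_on UNIV (\<lambda>x. \<bar>F x\<bar>)" using Ck1_continuous[OF F] by (intro continuous_intros)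
  have bd: "bounded (frontier \<Omega>)" 
    using bounded_subset[OF bounded_closure[OF \<Omega>(2)]] by (simp add: frontier_def)
  from fibre_sum_bound[OF pos frontier_measurable bd cont, of "other i"]
  obtain S where [measurable]: "S \<in> borel_measurable borel"
    and S_int: "(\<integral>\<^sup>+y. S y \<partial>lborel) \<le> 2 * bd_int (frontier \<Omega>) (\<lambda>x. \<bar>F x\<bar>)"
    and S: "\<And>y P. finite P \<Longrightarrow> P \<subseteq> frontier \<Omega> \<Longrightarrow> \<forall>p\<in>P. p $ other i = y \<Longrightarrow> (\<Sum>p\<in>P. ennreal \<bar>F p\<bar>) \<le> S y"
    by blast
  have int: "integrable lborel (\<lambda>x. indicator \<Omega> x * partial i F x)"
    using \<Omega> Ck1_partial_continuous[OF F] by (intro integrable_bounded_continuous) auto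
  have "ennreal \<bar>\<integral>x. indicator \<Omega> x * partial i F x \<partial>lborel\<bar>
      = ennreal (norm (\<integral>y. \<integral>t. indicator \<Omega> (slice_pt i t y) * partial i F (slice_pt i t y) \<partial>lborel \<partial>lborel))"
    by (subst integral_slice_pt(2)[OF int, of i]) simp
  also have "\<dots> \<le> (\<integral>\<^sup>+y. ennreal (norm (\<integral>t. indicator \<Omega> (slice_pt i t y) * partial i F (slice_pt i t y) \<partial>lborel)) \<partial>lborel)"
    by (rule integral_norm_bound_ennreal) (rule integral_slice_pt(1)[OF int])
  also have "\<dots> \<le> (\<integral>\<^sup>+y. 2 * S y \<partial>lborel)"
  proof (rule nn_integral_mono)
    fix y
    have "continuous_on UNIV (\<lambda>t. partial i F (slice_pt i t y))"
      by (rule continuous_on_compose2[OF Ck1_partial_continuous[OF F] continuous_slice_pt1]) simp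
    then have "ennreal \<bar>\<integral>t. indicator {t. slice_pt i t y \<in> \<Omega>} t * partial i F (slice_pt i t y) \<partial>lborel\<bar> \<le> 2 * S y"
    proof (rule bounded_open_real_integral_bound[OF open_slice[OF \<Omega>] bounded_slice[OF \<Omega>] Ck1_slice_derivative[OF F]])
      show "(\<Sum>p\<in>P. ennreal \<bar>F (slice_pt i p y)\<bar>) \<le> S y"
        if "finite P" "P \<subseteq> frontier {t. slice_pt i t y \<in> \<Omega>}" for P
        by (rule slice_fibre_sum[OF \<Omega> S that])
    qed
    then show "ennreal (norm (\<integral>t. indicator \<Omega> (slice_pt i t y) * partial i F (slice_pt i t y) \<partial>lborel)) \<le> 2 * S y"
      by (simp only: indicator_slice real_norm_def)
  qed
  also have "\<dots> = 2 * (\<integral>\<^sup>+y. S y \<partial>lborel)" by (rule nn_integral_cmult) simp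
  also have "\<dots> \<le> 2 * (2 * bd_int (frontier \<Omega>) (\<lambda>x. \<bar>F x\<bar>))" using S_int by (rule mult_left_mono) simp
  also have "\<dots> = 4 * bd_int (frontier \<Omega>) (\<lambda>x. \<bar>F x\<bar>)" by (simp flip: mult.assoc)
  finally show ?thesis .
qed

section \<open>Smooth functions\<close>

lemma partial_eqI:
  assumes "(f has_derivative f') (at x)"
  shows "partial i f x = f' (axis i 1)"
  using frechet_derivative_at[OF assms] by (simp add: partial_def)

lemma partial_add:
  assumes "\<And>x. f differentiable (at x)" "\<And>x. g differentiable (at x)"
  shows "partial i (\<lambda>x. f x + g x) = (\<lambda>x. partial i f x + partial i g x)"
proof
  fix x
  show "partial i (\<lambda>x. f x + g x) x = partial i f x + partial i g x"
    using has_derivative_add[OF frechet_derivative_works[THEN iffD1, OF assms(1)[of x]]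
        frechet_derivative_works[THEN iffD1, OF assms(2)[of x]]]
    by (subst partial_eqI) (auto simp: partial_def)
qed

lemma partial_mult:
  assumes "\<And>x. f differentiable (at x)" "\<And>x. g differentiable (at x)"
  shows "partial i (\<lambda>x. f x * g x) = (\<lambda>x. f x * partial i g x + partial i f x * g x)"
proof
  fix x
  show "partial i (\<lambda>x. f x * g x) x = f x * partial i g x + partial i f x * g x"
    using has_derivative_mult[OF frechet_derivative_works[THEN iffD1, OF assms(1)[of x]]
        frechet_derivative_works[THEN iffD1, OF assms(2)[of x]]]
    by (subst partial_eqI) (auto simp: partial_def)
qed

lemma partial_const: "partial i (\<lambda>x. c) = (\<lambda>x. 0)"
proof
  fix x show "partial i (\<lambda>x. c) x = 0" by (rule partial_eqI) simp
qed

lemma Ck_const: "Ck k (\<lambda>x. c)"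
  by (induction k arbitrary: c) (auto simp: partial_const)

lemma Ck_Suc_imp: "Ck (Suc k) f \<Longrightarrow> Ck k f"
proof (induction k arbitrary: f)
  case 0
  then show ?case by (simp add: continuous_at_imp_continuous_on differentiable_imp_continuous_within)
next
  case (Suc k)
  have "\<forall>i. Ck (Suc k) (partial i f)" using Suc.prems unfolding Ck.simps(2)[of "Suc k"] by blast
  then have "\<forall>i. Ck k (partial i f)" using Suc.IH by blast
  moreover have "\<forall>x. f differentiable (at x)" using Suc.prems by simp
  ultimately show ?case by simp
qed

lemma Ck_add: "Ck k f \<Longrightarrow> Ck k g \<Longrightarrow> Ck k (\<lambda>x. f x + g x)"
proof (induction k arbitrary: f g)
  case 0 then show ?case by (simp add: continuous_on_add)
next
  case (Suc k) then show ?case by (simp add: partial_add)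
qed

lemma Ck_mult: "Ck k f \<Longrightarrow> Ck k g \<Longrightarrow> Ck k (\<lambda>x. f x * g x)"
proof (induction k arbitrary: f g)
  case 0 then show ?case by (simp add: continuous_on_mult)
next
  case (Suc k)
  have "Ck k f" "Ck k g" using Suc.prems by (auto intro: Ck_Suc_imp)
  with Suc show ?case by (simp add: partial_mult Ck_add)
qed

lemma Ck_cmult: "Ck k f \<Longrightarrow> Ck k (\<lambda>x. c * f x)"
  by (intro Ck_mult Ck_const)

lemma Ck_diff: "Ck k f \<Longrightarrow> Ck k g \<Longrightarrow> Ck k (\<lambda>x. f x - g x)"
  using Ck_add[of k f "\<lambda>x. - 1 * g x"] Ck_cmult[of k g "- 1"] by simp

lemma smooth_const: "smooth (\<lambda>x. c)" by (simp add: smooth_def Ck_const)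
lemma smooth_add: "smooth f \<Longrightarrow> smooth g \<Longrightarrow> smooth (\<lambda>x. f x + g x)" by (simp add: smooth_def Ck_add)
lemma smooth_mult: "smooth f \<Longrightarrow> smooth g \<Longrightarrow> smooth (\<lambda>x. f x * g x)" by (simp add: smooth_def Ck_mult)
lemma smooth_diff: "smooth f \<Longrightarrow> smooth g \<Longrightarrow> smooth (\<lambda>x. f x - g x)" by (simp add: smooth_def Ck_diff)
lemma smooth_Ck1: "smooth f \<Longrightarrow> Ck (Suc 0) f" unfolding smooth_def by blast
lemma smooth_continuous: "smooth f \<Longrightarrow> continuous_on UNIV f"
  by (rule Ck1_continuous[OF smooth_Ck1])

section \<open>Bump functions and the fundamental lemma\<close>

text \<open>A family containing \<open>exp (- 1 / t)\<close> that is closed under differentiation up to linear combinations.\<close>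

definition flat_exp :: "nat \<Rightarrow> real \<Rightarrow> real" where
  "flat_exp m t = (if t > 0 then exp (- (1 / t)) / t ^ m else 0)"

lemma flat_exp_tendsto_0: "(flat_exp m \<longlongrightarrow> 0) (at 0)"
proof (rule filterlim_split_at)
  have "\<forall>\<^sub>F t in at_left 0. flat_exp m t = 0" by (auto simp: flat_exp_def eventually_at_filter)
  then show "(flat_exp m \<longlongrightarrow> 0) (at_left 0)" by (rule tendsto_eventually)
  have "((\<lambda>t. inverse t ^ m / exp (inverse t)) \<longlongrightarrow> (0::real)) (at_right 0)"
    by (rule filterlim_compose[OF tendsto_power_div_exp_0 filterlim_inverse_at_top_right])
  moreover have "\<forall>\<^sub>F t in at_right 0. inverse t ^ m / exp (inverse t) = flat_exp m t"
    by (auto simp: flat_exp_def eventually_at_filter exp_minus field_simps)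
  ultimately show "(flat_exp m \<longlongrightarrow> 0) (at_right 0)" by (rule Lim_transform_eventually)
qed

lemma flat_exp_has_derivative: "(flat_exp m has_real_derivative (flat_exp (m + 2) t - real m * flat_exp (m + 1) t)) (at t)"
proof (cases "t = 0")
  case True
  have "(\<lambda>h. (flat_exp m (0 + h) - flat_exp m 0) / h) \<midarrow>0\<rightarrow> 0"
  \<comment> \<open>At zero the difference quotient of a member of the family is the next member,
    which tends to zero.\<close>
  proof (rule Lim_transform_eventually[OF flat_exp_tendsto_0[of "Suc m"]])
    show "\<forall>\<^sub>F h in at 0. flat_exp (Suc m) h = (flat_exp m (0 + h) - flat_exp m 0) / h"
      by (auto simp: flat_exp_def eventually_at_filter)
  qed
  then show ?thesis unfolding True DERIV_def by (simp add: flat_exp_def)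
next
  case False
  show ?thesis
  proof (cases "t > 0")
    case True
    have "((\<lambda>t. exp (- (1 / t)) / t ^ m) has_real_derivative (flat_exp (m + 2) t - real m * flat_exp (m + 1) t)) (at t)"
    proof (cases m)
      case 0
      then show ?thesis using True
        by (auto intro!: derivative_eq_intros simp: flat_exp_def power2_eq_square)
    next
      case (Suc k)
      have "((\<lambda>t. exp (- (1 / t)) / t ^ m) has_real_derivative
         (exp (- (1 / t)) * (1 / t\<^sup>2) * t ^ m - exp (- (1 / t)) * (real m * t ^ (m - 1))) / (t ^ m * t ^ m)) (at t)"
        using True by (auto intro!: derivative_eq_intros simp: power2_eq_square)
      moreover have "(exp (- (1 / t)) * (1 / t\<^sup>2) * t ^ m - exp (- (1 / t)) * (real m * t ^ (m - 1))) / (t ^ m * t ^ m)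
          = flat_exp (m + 2) t - real m * flat_exp (m + 1) t"
        using True Suc by (simp add: flat_exp_def field_simps power2_eq_square)
      ultimately show ?thesis by simp
    qed
    moreover have "\<forall>\<^sub>F s in nhds t. exp (- (1 / s)) / s ^ m = flat_exp m s"
      using eventually_nhds_in_open[of "{0<..}" t] True by (auto elim!: eventually_mono simp: flat_exp_def)
    ultimately show ?thesis by (subst DERIV_cong_ev[OF refl _ refl, of _ "\<lambda>t. exp (- (1 / t)) / t ^ m"]) (auto elim: eventually_mono)
  next
    case neg: False
    have "((\<lambda>t. 0) has_real_derivative 0) (at t)" by simp
    moreover have "\<forall>\<^sub>F s in nhds t. flat_exp m s = 0"
      using eventually_nhds_in_open[of "{..<0}" t] neg False by (auto elim!: eventually_mono simp: flat_exp_def)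
    ultimately show ?thesis using neg
      by (subst DERIV_cong_ev[OF refl _ refl, of _ "\<lambda>t. 0"]) (auto simp: flat_exp_def)
  qed
qed

lemma Ck_flat_exp: "Ck k (\<lambda>x. flat_exp m (c * (x $ j) + d))"
proof (induction k arbitrary: m)
  case 0
  have "continuous_on UNIV (flat_exp m)"
    using DERIV_isCont[OF flat_exp_has_derivative] by (simp add: continuous_on_eq_continuous_at)
  then show ?case
    by (auto intro!: continuous_on_compose2[of UNIV "flat_exp m"] continuous_intros)
next
  case (Suc k)
  have der: "((\<lambda>x. flat_exp m (c * (x $ j) + d)) has_derivative
      (\<lambda>h. (flat_exp (m + 2) (c * (x $ j) + d) - real m * flat_exp (m + 1) (c * (x $ j) + d)) * (c * (h $ j)))) (at x)" for x
  proof -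
    have "((\<lambda>x. c * (x $ j) + d) has_derivative (\<lambda>h. c * (h $ j))) (at x)"
      by (auto intro!: derivative_eq_intros bounded_linear_imp_has_derivative bounded_linear_vec_nth)
    from has_derivative_compose[OF this flat_exp_has_derivative[unfolded has_field_derivative_def]]
    show ?thesis by simp
  qed
  have "partial i (\<lambda>x. flat_exp m (c * (x $ j) + d)) = (\<lambda>x. (c * (axis i 1 $ j)) *
      (flat_exp (m + 2) (c * (x $ j) + d) + (- real m) * flat_exp (m + 1) (c * (x $ j) + d)))" for i
    using partial_eqI[OF der] by (simp add: fun_eq_iff algebra_simps)
  then have "Ck k (partial i (\<lambda>x. flat_exp m (c * (x $ j) + d)))" for i
    by (simp only:) (intro Ck_cmult Ck_add Suc)
  then show ?case using der by (auto simp: differentiable_def)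
qed

lemma flat_exp0_bounds: "0 \<le> flat_exp 0 t" "flat_exp 0 t \<le> 1"
  by (auto simp: flat_exp_def)

lemma flat_exp0_pos_iff: "flat_exp 0 t \<noteq> 0 \<longleftrightarrow> t > 0"
  by (simp add: flat_exp_def)

lemma flat_exp0_tendsto: "(\<lambda>n. flat_exp 0 (real (Suc n) * t)) \<longlonglongrightarrow> (if t > 0 then 1 else 0)"
proof (cases "t > 0")
  case True
  have "(\<lambda>n. exp (- ((1 / t) / real (Suc n)))) \<longlonglongrightarrow> exp (- 0)"
    by (intro tendsto_intros LIMSEQ_Suc lim_const_over_n)
  moreover have "flat_exp 0 (real (Suc n) * t) = exp (- ((1 / t) / real (Suc n)))" for n
    using True mult_pos_pos[of "real (Suc n)" t] by (simp add: flat_exp_def mult.commute del: of_nat_Suc)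
  ultimately show ?thesis using True by simp
next
  case False
  then have "flat_exp 0 (real (Suc n) * t) = 0" for n by (simp add: flat_exp_def mult_le_0_iff not_less)
  then show ?thesis using False by simp
qed

text \<open>Smooth and nonzero exactly on the open box; the factor \<open>Suc n\<close> inside the
  exponentials drives each of the four factors to 1 there, so the bumps tend to the indicator of the
  box. Mollifiers and convolution are thereby avoided.\<close>

definition bump :: "real^2 \<Rightarrow> real^2 \<Rightarrow> nat \<Rightarrow> real^2 \<Rightarrow> real" where
  "bump a b n x = (flat_exp 0 (real (Suc n) * (x $ 1 - a $ 1)) * flat_exp 0 (real (Suc n) * (b $ 1 - x $ 1)))
     * (flat_exp 0 (real (Suc n) * (x $ 2 - a $ 2)) * flat_exp 0 (real (Suc n) * (b $ 2 - x $ 2)))"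

lemma bump_smooth: "smooth (bump a b n)"
proof -
  have "Ck k (\<lambda>x. flat_exp 0 (real (Suc n) * (x $ j - p)))" for k j p
    using Ck_flat_exp[of k 0 "real (Suc n)" j "- (real (Suc n) * p)"] by (simp add: right_diff_distrib del: of_nat_Suc)
  moreover have "Ck k (\<lambda>x. flat_exp 0 (real (Suc n) * (p - x $ j)))" for k j p
    using Ck_flat_exp[of k 0 "- real (Suc n)" j "real (Suc n) * p"] by (simp add: right_diff_distrib del: of_nat_Suc)
  ultimately show ?thesis unfolding smooth_def bump_def[abs_def] by (intro allI Ck_mult)
qed

lemma bump_nonzero_iff: "bump a b n x \<noteq> 0 \<longleftrightarrow> x \<in> box a b"
proof -
  have "0 < real (Suc n) * t \<longleftrightarrow> 0 < t" for t
    by (simp add: zero_less_mult_iff)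
  then show ?thesis
    by (auto simp: bump_def flat_exp0_pos_iff mem_box_cart forall_2 simp del: of_nat_Suc)
qed

lemma bump_bounds: "0 \<le> bump a b n x" "bump a b n x \<le> 1"
  unfolding bump_def using flat_exp0_bounds by (auto intro!: mult_nonneg_nonneg mult_le_one)

lemma bump_tendsto: "(\<lambda>n. bump a b n x) \<longlonglongrightarrow> indicator (box a b) x"
proof -
  have "indicator (box a b) x = ((if x $ 1 - a $ 1 > 0 then 1 else 0) * (if b $ 1 - x $ 1 > 0 then 1 else 0))
     * ((if x $ 2 - a $ 2 > 0 then 1 else 0) * (if b $ 2 - x $ 2 > 0 then 1 else 0 :: real))"
    by (auto simp: indicator_def mem_box_cart forall_2)
  then show ?thesis unfolding bump_def by (simp only:) (intro tendsto_mult flat_exp0_tendsto)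
qed

lemma bump_test_function:
  assumes "cbox a b \<subseteq> \<Omega>"
  shows "bump a b n \<in> test_functions \<Omega>"
proof -
  have "closure {x. bump a b n x \<noteq> 0} \<subseteq> cbox a b"
    unfolding bump_nonzero_iff using box_subset_cbox[of a b] by (intro closure_minimal) auto
  moreover from this have "compact (closure {x. bump a b n x \<noteq> 0})"
    by (meson bounded_cbox bounded_subset closed_closure compact_eq_bounded_closed)
  ultimately show ?thesis using assms by (auto simp: test_functions_def bump_smooth)
qed

text \<open>The positive and negative parts of \<open>h\<close> are densities of two measures that
  agree on open boxes, an intersection-stable generator of the Borel sets. Equality of the measures
  forces equality of the densities, and both parts cannot be nonzero at one point.\<close>

lemma AE_zero_of_box_integrals:
  fixes h :: "'a::euclidean_space \<Rightarrow> real"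
  assumes h: "integrable lborel h" and 0: "\<And>a b. (\<integral>x. h x * indicator (box a b) x \<partial>lborel) = 0"
  shows "AE x in lborel. h x = 0"
proof -
  have [measurable]: "h \<in> borel_measurable borel" using borel_measurable_integrable[OF h] by simp
  let ?P = "density lborel (\<lambda>x. ennreal (h x))" and ?M = "density lborel (\<lambda>x. ennreal (- h x))"
  have fin: "(\<integral>\<^sup>+x. ennreal (h x * indicator A x) \<partial>lborel) \<noteq> \<infinity>"
       "(\<integral>\<^sup>+x. ennreal (- (h x * indicator A x)) \<partial>lborel) \<noteq> \<infinity>" if "A \<in> sets borel" for A
    using integrable_mult_indicator[OF _ h, of A] that by (auto simp: real_integrable_def mult.commute)
  have P: "emeasure ?P A = (\<integral>\<^sup>+x. ennreal (h x * indicator A x) \<partial>lborel)"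
    and M: "emeasure ?M A = (\<integral>\<^sup>+x. ennreal (- (h x * indicator A x)) \<partial>lborel)" if "A \<in> sets borel" for A
    using that by (auto simp: emeasure_density indicator_def intro!: nn_integral_cong)
  have "?P = ?M"
  proof (rule measure_eqI_generator_eq)
    let ?E = "range (\<lambda>(a, b). box a b::'a set)"
    show "Int_stable ?E" by (auto simp: Int_stable_def box_Int_box)
    show "?E \<subseteq> Pow UNIV" "sets ?P = sigma_sets UNIV ?E" "sets ?M = sigma_sets UNIV ?E"
      by (simp_all add: borel_eq_box)
    let ?A = "\<lambda>n::nat. box (- (real n *\<^sub>R One)) (real n *\<^sub>R One) :: 'a set"
    show "range ?A \<subseteq> ?E" "(\<Union>i. ?A i) = UNIV" unfolding UN_box_eq_UNIV by auto
    show "emeasure ?P (?A i) \<noteq> \<infinity>" for i using fin[of "?A i"] P[of "?A i"] by simp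
    show "emeasure ?P X = emeasure ?M X" if X: "X \<in> ?E" for X
    proof -
      obtain a b where ab: "X = box a b" using X by auto
      have Xs: "X \<in> sets borel" using ab by simp
      have int: "integrable lborel (\<lambda>x. h x * indicator X x)"
        using integrable_mult_indicator[OF _ h, of X] Xs by (simp add: mult.commute)
      have "enn2real (\<integral>\<^sup>+x. ennreal (h x * indicator X x) \<partial>lborel)
          = enn2real (\<integral>\<^sup>+x. ennreal (- (h x * indicator X x)) \<partial>lborel)"
        using real_lebesgue_integral_def[OF int] 0[of a b] ab by simp
      then have "ennreal (enn2real (\<integral>\<^sup>+x. ennreal (h x * indicator X x) \<partial>lborel))
          = ennreal (enn2real (\<integral>\<^sup>+x. ennreal (- (h x * indicator X x)) \<partial>lborel))"
        by (rule arg_cong)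
      then show ?thesis unfolding P[OF Xs] M[OF Xs] using fin[OF Xs]
        by (simp only: ennreal_enn2real_if infinity_ennreal_def if_False)
    qed
  qed
  then have "AE x in lborel. ennreal (h x) = ennreal (- h x)"
    by (subst (asm) sigma_finite_measure.density_unique_iff[OF lborel.sigma_finite_measure_axioms]) simp_all
  then show ?thesis
  proof eventually_elim
    case (elim x)
    moreover have "ennreal (h x) = 0 \<or> ennreal (- h x) = 0"
      by (cases "h x \<le> 0") (auto simp: ennreal_neg)
    ultimately have "ennreal (h x) = 0" "ennreal (- h x) = 0" by auto
    then show ?case by (simp add: ennreal_eq_0_iff)
  qed
qed

text \<open>The function spaces live on the completed measure \<open>lebesgue_on\<close>, while
  iterated integration uses \<open>lborel\<close>; for Borel functions this passes between the
  two.\<close>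

lemma lebesgue_on_integral_eq:
  fixes f :: "'a::euclidean_space \<Rightarrow> real"
  assumes \<Omega>: "\<Omega> \<in> sets borel" and f: "f \<in> borel_measurable borel"
  shows "(\<integral>x. f x \<partial>lebesgue_on \<Omega>) = (\<integral>x. indicator \<Omega> x * f x \<partial>lborel)"
    and "integrable (lebesgue_on \<Omega>) f \<longleftrightarrow> integrable lborel (\<lambda>x. indicator \<Omega> x * f x)"
    and "f \<in> borel_measurable (lebesgue_on \<Omega>)"
proof -
  have m: "(\<lambda>x. indicator \<Omega> x * f x) \<in> borel_measurable lborel" using \<Omega> f by measurable
  have \<Omega>': "\<Omega> \<inter> space lebesgue \<in> sets lebesgue" using \<Omega> by auto
  show "(\<integral>x. f x \<partial>lebesgue_on \<Omega>) = (\<integral>x. indicator \<Omega> x * f x \<partial>lborel)"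
    using m by (simp add: integral_restrict_space[OF \<Omega>'] integral_completion)
  show "integrable (lebesgue_on \<Omega>) f \<longleftrightarrow> integrable lborel (\<lambda>x. indicator \<Omega> x * f x)"
    using m by (simp add: integrable_restrict_space[OF \<Omega>'] integrable_completion)
  show "f \<in> borel_measurable (lebesgue_on \<Omega>)"
    using f by (intro measurable_restrict_space1 measurable_completion) simp
qed

text \<open>After \<open>g\<close> is replaced by a Borel function \<open>h\<close> equal to it
  almost everywhere on \<open>\<Omega>\<close>, bumps approximate indicators, so \<open>h\<close>
  has integral zero over every box with closure in \<open>\<Omega>\<close>. This gives
  \<open>h = 0\<close> almost everywhere on each such box, and countably many of them cover
  \<open>\<Omega>\<close>.\<close>

lemma fundamental_lemma:
  fixes g :: "real^2 \<Rightarrow> real"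
  assumes \<Omega>: "open \<Omega>" and g: "integrable (lebesgue_on \<Omega>) g"
    and 0: "\<And>\<psi>. \<psi> \<in> test_functions \<Omega> \<Longrightarrow> (\<integral>x. g x * \<psi> x \<partial>lebesgue_on \<Omega>) = 0"
  shows "AE x in lebesgue_on \<Omega>. g x = 0"
proof -
  have \<Omega>b [measurable]: "\<Omega> \<in> sets borel" using \<Omega> by simp
  have \<Omega>': "\<Omega> \<inter> space lebesgue \<in> sets lebesgue" using \<Omega>b by auto
  have gl: "integrable lebesgue (\<lambda>x. indicator \<Omega> x * g x)"
    using g by (simp add: integrable_restrict_space[OF \<Omega>'])
  obtain h where h [measurable]: "h \<in> borel_measurable lborel" and gh: "AE x in lborel. indicator \<Omega> x * g x = h x"
    using completion_ex_borel_measurable_real[OF borel_measurable_integrable[OF gl]] by blast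
  have gh': "AE x in lebesgue. indicator \<Omega> x * g x = h x" using gh by (rule AE_completion)
  have hl: "h \<in> borel_measurable lebesgue" using h by (rule measurable_completion)
  have hi: "integrable lborel h"
    using integrable_cong_AE[THEN iffD1, OF borel_measurable_integrable[OF gl] hl gh' gl]
    by (simp add: integrable_completion)
  have box0: "(\<integral>x. h x * indicator (box a b) x \<partial>lborel) = 0" if ab: "cbox a b \<subseteq> \<Omega>" for a b
  proof -
    have [measurable]: "bump a b n \<in> borel_measurable borel" for n
      by (rule borel_measurable_continuous_onI[OF smooth_continuous[OF bump_smooth]])
    have "(\<integral>x. h x * bump a b n x \<partial>lborel) = 0" for n
    proof -
      have "(\<integral>x. h x * bump a b n x \<partial>lborel) = (\<integral>x. h x * bump a b n x \<partial>lebesgue)"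
        by (rule integral_completion[symmetric]) measurable
      also have "\<dots> = (\<integral>x. indicator \<Omega> x *\<^sub>R (g x * bump a b n x) \<partial>lebesgue)"
      proof (rule integral_cong_AE)
        show "AE x in lebesgue. h x * bump a b n x = indicator \<Omega> x *\<^sub>R (g x * bump a b n x)"
          using gh' by eventually_elim (simp flip: mult.assoc)
        show "(\<lambda>x. h x * bump a b n x) \<in> borel_measurable lebesgue" by (rule measurable_completion) measurable
        have "(\<lambda>x. (indicator \<Omega> x * g x) * bump a b n x) \<in> borel_measurable lebesgue"
          by (intro borel_measurable_times borel_measurable_integrable[OF gl] measurable_completion) simp
        then show "(\<lambda>x. indicator \<Omega> x *\<^sub>R (g x * bump a b n x)) \<in> borel_measurable lebesgue"
          by (simp add: mult.assoc)
      qed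
      also have "\<dots> = 0" using 0[OF bump_test_function[OF ab, of n]] integral_restrict_space[OF \<Omega>', of "\<lambda>x. g x * bump a b n x"] by simp
      finally show ?thesis .
    qed
    moreover have "(\<lambda>n. \<integral>x. h x * bump a b n x \<partial>lborel) \<longlonglongrightarrow> (\<integral>x. h x * indicator (box a b) x \<partial>lborel)"
    proof (rule integral_dominated_convergence)
      show "integrable lborel (\<lambda>x. norm (h x))" using hi by simp
      show "AE x in lborel. (\<lambda>n. h x * bump a b n x) \<longlonglongrightarrow> h x * indicator (box a b) x"
        by (intro AE_I2 tendsto_mult tendsto_const bump_tendsto)
      show "AE x in lborel. norm (h x * bump a b n x) \<le> norm (h x)" for n
        using bump_bounds[of a b n] by (auto simp: abs_mult mult_left_le)
    qed measurable
    ultimately show ?thesis by (simp add: LIMSEQ_const_iff)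
  qed
  have local: "AE x in lborel. x \<in> box c d \<longrightarrow> h x = 0" if cd: "cbox c d \<subseteq> \<Omega>" for c d
  proof -
    have "AE x in lborel. h x * indicator (box c d) x = 0"
    proof (rule AE_zero_of_box_integrals)
      show "integrable lborel (\<lambda>x. h x * indicator (box c d) x)"
        using integrable_mult_indicator[OF _ hi, of "box c d"] by (simp add: mult.commute)
      fix a b :: "real^2"
      obtain a' b' where ab': "box c d \<inter> box a b = box a' b'" unfolding box_Int_box by blast
      have "h x * indicator (box c d) x * indicator (box a b) x = h x * indicator (box a' b') x" for x
        unfolding ab'[symmetric] by (simp add: indicator_inter_arith mult.assoc)
      moreover have "(\<integral>x. h x * indicator (box a' b') x \<partial>lborel) = 0"
      \<comment> \<open>Only for a nonempty open box is the closed box its closure and hence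
        contained in \<open>\<Omega>\<close>; for the empty one the corners are unrelated to
        \<open>\<Omega>\<close>, but the integral is trivially zero.\<close>
      proof (cases "box a' b' = {}")
        case False
        then have "cbox a' b' = closure (box a' b')" by (simp add: closure_box)
        also have "\<dots> \<subseteq> closure (box c d)" unfolding ab'[symmetric] by (intro closure_mono) auto
        also have "\<dots> \<subseteq> cbox c d" using box_subset_cbox[of c d] by (intro closure_minimal) auto
        finally show ?thesis using cd by (intro box0) auto
      qed simp
      ultimately show "(\<integral>x. h x * indicator (box c d) x * indicator (box a b) x \<partial>lborel) = 0" by (simp only:)
    qed
    then show ?thesis by eventually_elim (auto simp: indicator_def)
  qed
  define \<F> where "\<F> = {box c d |c d. cbox c d \<subseteq> \<Omega>}"
  have "\<Union>\<F> = \<Omega>"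
  proof
    show "\<Union>\<F> \<subseteq> \<Omega>" using box_subset_cbox by (force simp: \<F>_def)
    show "\<Omega> \<subseteq> \<Union>\<F>"
    proof
      fix x assume "x \<in> \<Omega>"
      with \<Omega> obtain c d where "cbox c d \<subseteq> \<Omega>" "x \<in> box c d" by (rule open_contains_cbox)
      then show "x \<in> \<Union>\<F>" by (auto simp: \<F>_def)
    qed
  qed
  moreover obtain \<F>' where F': "\<F>' \<subseteq> \<F>" "countable \<F>'" "\<Union>\<F>' = \<Union>\<F>"
    by (rule Lindelof[of \<F>]) (auto simp: \<F>_def)
  moreover have "AE x in lborel. \<forall>B\<in>\<F>'. x \<in> B \<longrightarrow> h x = 0"
    using F' local by (subst AE_ball_countable) (auto simp: \<F>_def)
  ultimately have "AE x in lborel. x \<in> \<Omega> \<longrightarrow> h x = 0" by (auto elim!: eventually_mono)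
  then have "AE x in lebesgue. x \<in> \<Omega> \<longrightarrow> h x = 0" by (rule AE_completion)
  with gh' have "AE x in lebesgue. x \<in> \<Omega> \<longrightarrow> g x = 0" by eventually_elim auto
  then show ?thesis by (simp add: AE_restrict_space_iff[OF \<Omega>'])
qed

section \<open>Weak gradients and functions with zero trace\<close>

lemma sq_int_vec_iff:
  fixes G :: "'a \<Rightarrow> real^'n"
  shows "G \<in> sq_int M \<longleftrightarrow> (\<forall>i. (\<lambda>x. G x $ i) \<in> sq_int M)"
proof
  assume G: "G \<in> sq_int M"
  show "\<forall>i. (\<lambda>x. G x $ i) \<in> sq_int M"
  proof
    fix i
    have "(\<lambda>x. G x \<bullet> axis i 1) \<in> borel_measurable M"
      using sq_int_measurable[OF G] by (intro borel_measurable_inner) auto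
    then have "(\<lambda>x. G x $ i) \<in> borel_measurable M" by (simp add: inner_axis)
    then show "(\<lambda>x. G x $ i) \<in> sq_int M"
      by (rule sq_int_bounded[OF G, of _ 1]) (use component_le_norm_cart in auto)
  qed
next
  assume *: "\<forall>i. (\<lambda>x. G x $ i) \<in> sq_int M"
  have "G \<in> borel_measurable M"
    using * by (subst borel_measurable_euclidean_space) (auto simp: Basis_vec_real inner_axis dest: sq_int_measurable)
  moreover have "(norm (G x))\<^sup>2 = (\<Sum>i\<in>UNIV. (norm (G x $ i))\<^sup>2)" for x
    unfolding power2_norm_eq_inner by (simp add: inner_vec_def)
  moreover have "integrable M (\<lambda>x. \<Sum>i\<in>UNIV. (norm (G x $ i))\<^sup>2)"
    by (rule Bochner_Integration.integrable_sum) (use * sq_int_integrable in blast)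
  ultimately show "G \<in> sq_int M" by (simp add: sq_int_def)
qed

lemma nrm_component_le:
  fixes G :: "'a \<Rightarrow> real^'n"
  assumes "G \<in> sq_int M"
  shows "nrm M (\<lambda>x. G x $ i) \<le> nrm M G"
  using nrm_mono[OF assms, of "\<lambda>x. G x $ i" 1] assms component_le_norm_cart
  by (auto simp: sq_int_vec_iff dest: sq_int_measurable)

definition grad :: "(real^2 \<Rightarrow> real) \<Rightarrow> real^2 \<Rightarrow> real^2" where
  "grad f x = (\<chi> i. partial i f x)"

lemma grad_nth [simp]: "grad f x $ i = partial i f x"
  by (simp add: grad_def)

lemma grad_add: "Ck (Suc 0) f \<Longrightarrow> Ck (Suc 0) g \<Longrightarrow> grad (\<lambda>x. f x + g x) x = grad f x + grad g x"
  by (simp add: vec_eq_iff partial_add)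

lemma grad_cmult: "Ck (Suc 0) f \<Longrightarrow> grad (\<lambda>x. c * f x) x = c *\<^sub>R grad f x"
  using partial_mult[of "\<lambda>x. c" f] by (simp add: vec_eq_iff partial_const)

lemma grad_diff: "Ck (Suc 0) f \<Longrightarrow> Ck (Suc 0) g \<Longrightarrow> grad (\<lambda>x. f x - g x) x = grad f x - grad g x"
  using grad_add[of f "\<lambda>x. - 1 * g x"] Ck_cmult[of "Suc 0" g "- 1"] grad_cmult[of g "- 1"] by simp

text \<open>The set \<open>\<Gamma>\<close> of nonzero measure certifies that
  \<open>hausdorff1\<close> agrees with the outer measure on Borel sets, which Eilenberg's
  inequality requires.\<close>

locale bounded_domain =
  fixes \<Omega> \<Gamma> :: "(real^2) set"
  assumes open_dom: "open \<Omega>" and bounded_dom: "bounded \<Omega>"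
    and hausdorff_nonzero: "emeasure hausdorff1 \<Gamma> \<noteq> 0"
begin

abbreviation M :: "(real^2) measure" where "M \<equiv> lebesgue_on \<Omega>"

lemma dom_borel: "\<Omega> \<in> sets borel" using open_dom by simp

lemma dom_space: "\<Omega> \<inter> space lebesgue \<in> sets lebesgue" using dom_borel by auto

lemma finite_measure_dom: "finite_measure M"
  using open_dom bounded_dom by (intro finite_measure_lebesgue_on lmeasurable_open)

lemma nn_integral_dom: "(\<integral>\<^sup>+x. f x \<partial>M) = (\<integral>\<^sup>+x. f x * indicator \<Omega> x \<partial>lborel)"
  by (simp add: nn_integral_restrict_space[OF dom_space] nn_integral_completion)

lemma sq_int_imp_integrable:
  fixes f :: "real^2 \<Rightarrow> real"
  assumes f: "f \<in> sq_int M"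
  shows "integrable M f"
proof -
  have "(\<lambda>x. 1) \<in> sq_int M"
    using finite_measure.integrable_const[OF finite_measure_dom] by (simp add: sq_int_def)
  from sq_int_mult[OF f this] show ?thesis by simp
qed

lemma continuous_sq_int:
  fixes f :: "real^2 \<Rightarrow> real"
  assumes f: "continuous_on UNIV f"
  shows "f \<in> sq_int M"
proof -
  have fb: "f \<in> borel_measurable borel" using f by (rule borel_measurable_continuous_onI)
  have c2: "continuous_on UNIV (\<lambda>x. (norm (f x))\<^sup>2)" using f by (intro continuous_intros)
  have "integrable M (\<lambda>x. (norm (f x))\<^sup>2)"
    unfolding lebesgue_on_integral_eq(2)[OF dom_borel borel_measurable_continuous_onI[OF c2]]
    by (rule integrable_bounded_continuous[OF dom_borel bounded_dom c2])
  then show ?thesis using lebesgue_on_integral_eq(3)[OF dom_borel fb] by (simp add: sq_int_def)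
qed

lemma continuous_bounded_dom:
  fixes f :: "real^2 \<Rightarrow> real"
  assumes f: "continuous_on UNIV f"
  shows "\<exists>c\<ge>0. \<forall>x\<in>closure \<Omega>. \<bar>f x\<bar> \<le> c"
proof -
  have "compact (f ` closure \<Omega>)"
    using bounded_dom by (intro compact_continuous_image continuous_on_subset[OF f]) (auto simp: compact_closure)
  then have "bounded (f ` closure \<Omega>)" by (rule compact_imp_bounded)
  then obtain c where "\<forall>x\<in>closure \<Omega>. \<bar>f x\<bar> \<le> c" by (auto simp: bounded_iff)
  then show ?thesis by (intro exI[of _ "max c 0"]) (auto simp: le_max_iff_disj)
qed

lemma continuous_mult_sq_int:
  fixes f :: "real^2 \<Rightarrow> real"
  assumes f: "continuous_on UNIV f" and u: "u \<in> sq_int M"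
  shows "(\<lambda>x. f x * u x) \<in> sq_int M"
    and "\<exists>c\<ge>0. \<forall>u\<in>sq_int M. nrm M (\<lambda>x. f x * u x :: real) \<le> c * nrm M u"
proof -
  obtain c where c: "0 \<le> c" "\<And>x. x \<in> closure \<Omega> \<Longrightarrow> \<bar>f x\<bar> \<le> c" using continuous_bounded_dom[OF f] by blast
  have le: "AE x in M. norm (f x * u x) \<le> c * norm (u x)" for u :: "real^2 \<Rightarrow> real"
  proof (rule AE_I2)
    fix x assume "x \<in> space M"
    then have "x \<in> closure \<Omega>" using closure_subset[of \<Omega>] by (auto simp: space_restrict_space)
    then show "norm (f x * u x) \<le> c * norm (u x)" using c(2)[of x] by (simp add: abs_mult mult_right_mono)
  qed
  have m: "(\<lambda>x. f x * u x) \<in> borel_measurable M" if "u \<in> sq_int M" for u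
    by (intro borel_measurable_times sq_int_measurable[OF that] sq_int_measurable[OF continuous_sq_int[OF f]])
  show "(\<lambda>x. f x * u x) \<in> sq_int M" by (rule sq_int_bounded[OF u m[OF u] le])
  show "\<exists>c\<ge>0. \<forall>u\<in>sq_int M. nrm M (\<lambda>x. f x * u x :: real) \<le> c * nrm M u"
    using c(1) nrm_mono[OF _ m c(1) le] by blast
qed

lemma smooth_sq_int: "smooth f \<Longrightarrow> f \<in> sq_int M"
  by (intro continuous_sq_int smooth_continuous)

lemma partial_sq_int: "smooth f \<Longrightarrow> partial i f \<in> sq_int M"
  by (intro continuous_sq_int Ck1_partial_continuous smooth_Ck1)

lemma grad_sq_int: "smooth f \<Longrightarrow> grad f \<in> sq_int M"
  by (simp add: sq_int_vec_iff partial_sq_int)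

lemma test_function_smooth: "\<psi> \<in> test_functions \<Omega> \<Longrightarrow> smooth \<psi>"
  by (simp add: test_functions_def)

lemma has_weak_grad_alt:
  "has_weak_grad \<Omega> u G \<longleftrightarrow> G \<in> sq_int M \<and>
     (\<forall>\<psi> \<in> test_functions \<Omega>. \<forall>i. ip M u (partial i \<psi>) = - ip M (\<lambda>x. G x $ i) \<psi>)"
  by (simp add: has_weak_grad_def L2_eq_sq_int sq_int_vec_iff ip_def)

lemma weak_grad_unique:
  assumes G: "has_weak_grad \<Omega> u G" and H: "has_weak_grad \<Omega> u H"
  shows "AE x in M. G x = H x"
proof -
  have "AE x in M. G x $ i - H x $ i = 0" for i
  proof (rule fundamental_lemma[OF open_dom])
    have Gs: "(\<lambda>x. G x $ i) \<in> sq_int M" and Hs: "(\<lambda>x. H x $ i) \<in> sq_int M"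
      using G H by (auto simp: has_weak_grad_alt sq_int_vec_iff)
    then show "integrable M (\<lambda>x. G x $ i - H x $ i)" by (intro sq_int_imp_integrable sq_int_diff)
    fix \<psi> assume \<psi>: "\<psi> \<in> test_functions \<Omega>"
    have \<psi>s: "\<psi> \<in> sq_int M" using \<psi> by (intro smooth_sq_int test_function_smooth)
    have "(\<integral>x. (G x $ i - H x $ i) * \<psi> x \<partial>M) = ip M (\<lambda>x. G x $ i) \<psi> - ip M (\<lambda>x. H x $ i) \<psi>"
      using sq_int_mult[OF Gs \<psi>s] sq_int_mult[OF Hs \<psi>s] by (simp add: ip_def left_diff_distrib)
    also have "\<dots> = 0" using G H \<psi> unfolding has_weak_grad_alt by (metis diff_self neg_equal_iff_equal)
    finally show "(\<integral>x. (G x $ i - H x $ i) * \<psi> x \<partial>M) = 0" .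
  qed
  then have "AE x in M. \<forall>i. G x $ i - H x $ i = 0" by (simp add: AE_all_countable)
  then show ?thesis by eventually_elim (simp add: vec_eq_iff)
qed

lemma weak_grad_add:
  assumes u: "u \<in> sq_int M" "has_weak_grad \<Omega> u G" and w: "w \<in> sq_int M" "has_weak_grad \<Omega> w H"
  shows "has_weak_grad \<Omega> (\<lambda>x. u x + w x) (\<lambda>x. G x + H x)"
  unfolding has_weak_grad_alt
proof (intro conjI ballI allI)
  show "(\<lambda>x. G x + H x) \<in> sq_int M" using u w by (simp add: has_weak_grad_alt sq_int_add)
  fix \<psi> i assume \<psi>: "\<psi> \<in> test_functions \<Omega>"
  have s: "\<psi> \<in> sq_int M" "partial i \<psi> \<in> sq_int M"
    using \<psi> by (auto intro: smooth_sq_int partial_sq_int test_function_smooth)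
  have "(\<lambda>x. G x $ i) \<in> sq_int M" "(\<lambda>x. H x $ i) \<in> sq_int M"
    using u w by (auto simp: has_weak_grad_alt sq_int_vec_iff)
  then show "ip M (\<lambda>x. u x + w x) (partial i \<psi>) = - ip M (\<lambda>x. (G x + H x) $ i) \<psi>"
    using u w s \<psi> by (simp add: ip_add_left has_weak_grad_alt)
qed

lemma weak_grad_scale:
  assumes u: "has_weak_grad \<Omega> u G"
  shows "has_weak_grad \<Omega> (\<lambda>x. c * u x) (\<lambda>x. c *\<^sub>R G x)"
proof -
  have "ip M (\<lambda>x. c * f x) h = c * ip M f h" for f h :: "real^2 \<Rightarrow> real" by (simp add: ip_def mult.assoc)
  then show ?thesis using u by (simp add: has_weak_grad_alt sq_int_scaleR)
qed

text \<open>Integration by parts follows from \<open>integral_partial_bound\<close> for the product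
  with a test function: the product vanishes on the frontier, so the bound for the integral of its
  derivative is zero.\<close>

lemma weak_grad_smooth:
  assumes f: "smooth f"
  shows "has_weak_grad \<Omega> f (grad f)"
  unfolding has_weak_grad_alt
proof (intro conjI ballI allI)
  show "grad f \<in> sq_int M" using f by (rule grad_sq_int)
  fix \<psi> i assume \<psi>: "\<psi> \<in> test_functions \<Omega>"
  have \<psi>s: "smooth \<psi>" using \<psi> by (rule test_function_smooth)
  let ?F = "\<lambda>x. f x * \<psi> x"
  have F: "Ck (Suc 0) ?F" using f \<psi>s by (intro smooth_Ck1 smooth_mult)
  have zero: "\<psi> x = 0" if "x \<in> frontier \<Omega>" for x
  proof (rule ccontr)
    assume "\<psi> x \<noteq> 0"
    then have "x \<in> \<Omega>" using \<psi> closure_subset[of "{x. \<psi> x \<noteq> 0}"] by (auto simp: test_functions_def)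
    then show False using that open_dom by (simp add: frontier_def interior_open)
  qed
  have "bd_int (frontier \<Omega>) (\<lambda>x. \<bar>?F x\<bar>) = (\<integral>\<^sup>+x. 0 \<partial>hausdorff1)"
    unfolding bd_int_def using zero by (intro nn_integral_cong) (auto simp: indicator_def)
  then have "bd_int (frontier \<Omega>) (\<lambda>x. \<bar>?F x\<bar>) = 0" by simp
  then have 0: "(\<integral>x. indicator \<Omega> x * partial i ?F x \<partial>lborel) = 0"
    using integral_partial_bound[OF hausdorff_nonzero open_dom bounded_dom F, of i] by (simp add: ennreal_eq_0_iff)
  have pF: "partial i ?F = (\<lambda>x. f x * partial i \<psi> x + partial i f x * \<psi> x)"
    using smooth_Ck1[OF f] smooth_Ck1[OF \<psi>s] by (intro partial_mult) auto
  have "(\<integral>x. partial i ?F x \<partial>M) = 0"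
    using lebesgue_on_integral_eq(1)[OF dom_borel borel_measurable_continuous_onI[OF Ck1_partial_continuous[OF F]]] 0
    by simp
  then have "ip M f (partial i \<psi>) + ip M (partial i f) \<psi> = 0"
    unfolding pF ip_def
    using sq_int_mult[OF smooth_sq_int[OF f] partial_sq_int[OF \<psi>s]] sq_int_mult[OF partial_sq_int[OF f] smooth_sq_int[OF \<psi>s]]
    by simp
  then show "ip M f (partial i \<psi>) = - ip M (\<lambda>x. grad f x $ i) \<psi>" by simp
qed

lemma weak_grad_closed:
  assumes u: "u \<in> sq_int M" and G: "G \<in> sq_int M" and s: "\<And>n. s n \<in> sq_int M" and Hs: "\<And>n. has_weak_grad \<Omega> (s n) (H n)"
    and limu: "(\<lambda>n. nrm M (\<lambda>x. s n x - u x)) \<longlonglongrightarrow> 0" and limG: "(\<lambda>n. nrm M (\<lambda>x. H n x - G x)) \<longlonglongrightarrow> 0"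
  shows "has_weak_grad \<Omega> u G"
  unfolding has_weak_grad_alt
proof (intro conjI ballI allI)
  show "G \<in> sq_int M" by (rule G)
  fix \<psi> i assume \<psi>: "\<psi> \<in> test_functions \<Omega>"
  have \<psi>s: "\<psi> \<in> sq_int M" "partial i \<psi> \<in> sq_int M"
    using \<psi> by (auto intro: smooth_sq_int partial_sq_int test_function_smooth)
  have H: "H n \<in> sq_int M" for n using Hs by (simp add: has_weak_grad_alt)
  have z: "(\<lambda>n::nat. nrm M (\<lambda>x. \<psi> x - \<psi> x)) \<longlonglongrightarrow> 0" "(\<lambda>n::nat. nrm M (\<lambda>x. partial i \<psi> x - partial i \<psi> x)) \<longlonglongrightarrow> 0"
    by (simp_all add: nrm_def)
  have 1: "(\<lambda>n. ip M (s n) (partial i \<psi>)) \<longlonglongrightarrow> ip M u (partial i \<psi>)"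
    by (rule ip_tendsto[OF s u limu \<psi>s(2) \<psi>s(2) z(2)])
  have lim': "(\<lambda>n. nrm M (\<lambda>x. H n x $ i - G x $ i)) \<longlonglongrightarrow> 0"
  proof (rule tendsto_sandwich[OF _ _ tendsto_const limG])
    show "\<forall>\<^sub>F n in sequentially. nrm M (\<lambda>x. H n x $ i - G x $ i) \<le> nrm M (\<lambda>x. H n x - G x)"
      using nrm_component_le[OF sq_int_diff[OF H G], of _ i] by simp
  qed simp
  have 2: "(\<lambda>n. - ip M (\<lambda>x. H n x $ i) \<psi>) \<longlonglongrightarrow> - ip M (\<lambda>x. G x $ i) \<psi>"
    using H G by (intro tendsto_minus ip_tendsto[OF _ _ lim' \<psi>s(1) \<psi>s(1) z(1)]) (auto simp: sq_int_vec_iff)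
  have "ip M (s n) (partial i \<psi>) = - ip M (\<lambda>x. H n x $ i) \<psi>" for n
    using Hs \<psi> by (auto simp: has_weak_grad_alt)
  with 1 2 show "ip M u (partial i \<psi>) = - ip M (\<lambda>x. G x $ i) \<psi>"
    using LIMSEQ_unique by fastforce
qed

lemma H1_sq_int: "u \<in> H1 \<Omega> \<Longrightarrow> u \<in> sq_int M"
  by (simp add: H1_def L2_eq_sq_int)

lemma H1_wgrad: "u \<in> H1 \<Omega> \<Longrightarrow> has_weak_grad \<Omega> u (wgrad \<Omega> u)"
  unfolding H1_def wgrad_def by (auto intro: someI[of "has_weak_grad \<Omega> u"])

lemma wgrad_sq_int: "u \<in> H1 \<Omega> \<Longrightarrow> wgrad \<Omega> u \<in> sq_int M"
  using H1_wgrad by (simp add: has_weak_grad_alt)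

lemma H1_I: "u \<in> sq_int M \<Longrightarrow> has_weak_grad \<Omega> u G \<Longrightarrow> u \<in> H1 \<Omega>"
  by (auto simp: H1_def L2_eq_sq_int)

lemma wgrad_eq:
  assumes "has_weak_grad \<Omega> u G"
  shows "AE x in M. wgrad \<Omega> u x = G x"
proof -
  have "has_weak_grad \<Omega> u (wgrad \<Omega> u)" unfolding wgrad_def by (rule someI[of "has_weak_grad \<Omega> u", OF assms])
  then show ?thesis using assms by (rule weak_grad_unique)
qed

lemma H1_add: "u \<in> H1 \<Omega> \<Longrightarrow> w \<in> H1 \<Omega> \<Longrightarrow> (\<lambda>x. u x + w x) \<in> H1 \<Omega>"
  by (rule H1_I[OF sq_int_add weak_grad_add]) (auto intro: H1_sq_int H1_wgrad)

lemma wgrad_add: "u \<in> H1 \<Omega> \<Longrightarrow> w \<in> H1 \<Omega> \<Longrightarrow>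
    AE x in M. wgrad \<Omega> (\<lambda>x. u x + w x) x = wgrad \<Omega> u x + wgrad \<Omega> w x"
  by (intro wgrad_eq weak_grad_add H1_sq_int H1_wgrad)

lemma H1_scale: "u \<in> H1 \<Omega> \<Longrightarrow> (\<lambda>x. c * u x) \<in> H1 \<Omega>"
  using sq_int_scaleR[OF H1_sq_int, of u c] by (auto intro: H1_I weak_grad_scale H1_wgrad)

lemma wgrad_scale: "u \<in> H1 \<Omega> \<Longrightarrow> AE x in M. wgrad \<Omega> (\<lambda>x. c * u x) x = c *\<^sub>R wgrad \<Omega> u x"
  by (intro wgrad_eq weak_grad_scale H1_wgrad)

lemma weak_grad_diff:
  assumes u: "u \<in> sq_int M" "has_weak_grad \<Omega> u G" and w: "w \<in> sq_int M" "has_weak_grad \<Omega> w H"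
  shows "has_weak_grad \<Omega> (\<lambda>x. u x - w x) (\<lambda>x. G x - H x)"
  using weak_grad_add[OF u sq_int_scaleR[OF w(1), of "- 1", simplified] weak_grad_scale[OF w(2), of "- 1", simplified]] by simp

lemma H1_diff: "u \<in> H1 \<Omega> \<Longrightarrow> w \<in> H1 \<Omega> \<Longrightarrow> (\<lambda>x. u x - w x) \<in> H1 \<Omega>"
  by (rule H1_I[OF sq_int_diff weak_grad_diff]) (auto intro: H1_sq_int H1_wgrad)

lemma wgrad_diff: "u \<in> H1 \<Omega> \<Longrightarrow> w \<in> H1 \<Omega> \<Longrightarrow>
    AE x in M. wgrad \<Omega> (\<lambda>x. u x - w x) x = wgrad \<Omega> u x - wgrad \<Omega> w x"
  by (intro wgrad_eq weak_grad_diff H1_sq_int H1_wgrad)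

lemma smooth_H1: "smooth f \<Longrightarrow> f \<in> H1 \<Omega>"
  by (intro H1_I[OF smooth_sq_int weak_grad_smooth])

lemma h1_norm_eq: "h1_norm \<Omega> u = sqrt ((nrm M u)\<^sup>2 + (nrm M (wgrad \<Omega> u))\<^sup>2)"
  by (simp add: h1_norm_def nrm_sq)

lemma h10_norm_eq: "h10_norm \<Omega> u = nrm M (wgrad \<Omega> u)"
  by (simp add: h10_norm_def nrm_def)

lemma h1_norm_ge: "nrm M u \<le> h1_norm \<Omega> u" "nrm M (wgrad \<Omega> u) \<le> h1_norm \<Omega> u"
  by (auto simp: h1_norm_eq intro: real_le_rsqrt)

text \<open>Functions with zero trace are described by approximating sequences, so that their properties
  are inherited from inequalities for smooth functions in which the boundary values appear
  quadratically.\<close>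

definition bd_approx :: "(real^2 \<Rightarrow> real) \<Rightarrow> (real^2 \<Rightarrow> real^2) \<Rightarrow> (nat \<Rightarrow> real^2 \<Rightarrow> real) \<Rightarrow> bool" where
  "bd_approx u G f \<longleftrightarrow> u \<in> sq_int M \<and> G \<in> sq_int M \<and> (\<forall>n. smooth (f n)) \<and>
     (\<lambda>n. nrm M (\<lambda>x. f n x - u x)) \<longlonglongrightarrow> 0 \<and> (\<lambda>n. nrm M (\<lambda>x. grad (f n) x - G x)) \<longlonglongrightarrow> 0 \<and>
     (\<lambda>n. bd_int (frontier \<Omega>) (\<lambda>x. (f n x)\<^sup>2)) \<longlonglongrightarrow> 0"

lemma frontier_hausdorff: "frontier \<Omega> \<inter> space hausdorff1 \<in> sets hausdorff1"
  using frontier_measurable[of \<Omega>] by simp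

lemma nn_integral_boundary: "(\<integral>\<^sup>+x. ennreal (F x) \<partial>boundary_measure \<Omega>) = bd_int (frontier \<Omega>) F"
  by (simp add: boundary_measure_def nn_integral_restrict_space[OF frontier_hausdorff] bd_int_def)

text \<open>The trace vanishes almost everywhere on the frontier, so the distance of the
  approximants to the trace is just the boundary integral of their squares. The H1 distance splits
  into distances of functions and of gradients, the weak gradient of the difference being the
  difference of gradients almost everywhere.\<close>

lemma H10_imp_bd_approx:
  assumes u: "u \<in> H10 \<Omega>"
  shows "\<exists>f. bd_approx u (wgrad \<Omega> u) f"
proof -
  obtain w f where w: "has_trace \<Omega> u w" and w0: "AE x in boundary_measure \<Omega>. x \<in> frontier \<Omega> \<longrightarrow> w x = 0"
    using u by (auto simp: H10_def zero_trace_on_def)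
  from w obtain f where f: "\<And>n. smooth (f n)" and lim: "(\<lambda>n. h1_norm \<Omega> (\<lambda>x. f n x - u x)) \<longlonglongrightarrow> 0"
    and bd: "(\<lambda>n. \<integral>\<^sup>+x. ennreal ((f n x - w x)\<^sup>2) \<partial>boundary_measure \<Omega>) \<longlonglongrightarrow> 0"
    by (auto simp: has_trace_def)
  have uH: "u \<in> H1 \<Omega>" using u by (simp add: H10_def)
  have eq: "nrm M (\<lambda>x. grad (f n) x - wgrad \<Omega> u x) = nrm M (wgrad \<Omega> (\<lambda>x. f n x - u x))" for n
  proof (rule nrm_cong_AE)
    show "(\<lambda>x. grad (f n) x - wgrad \<Omega> u x) \<in> borel_measurable M"
      by (intro sq_int_measurable sq_int_diff grad_sq_int f wgrad_sq_int uH)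
    show "wgrad \<Omega> (\<lambda>x. f n x - u x) \<in> borel_measurable M"
      by (intro sq_int_measurable wgrad_sq_int H1_diff smooth_H1 f uH)
    have "AE x in M. wgrad \<Omega> (\<lambda>x. f n x - u x) x = grad (f n) x - wgrad \<Omega> u x"
      by (intro wgrad_eq weak_grad_diff weak_grad_smooth smooth_sq_int f H1_sq_int H1_wgrad uH)
    then show "AE x in M. grad (f n) x - wgrad \<Omega> u x = wgrad \<Omega> (\<lambda>x. f n x - u x) x" by eventually_elim simp
  qed
  have "(\<lambda>n. nrm M (\<lambda>x. f n x - u x)) \<longlonglongrightarrow> 0"
    by (rule tendsto_sandwich[OF _ _ tendsto_const lim]) (use h1_norm_ge(1) in auto)
  moreover have "(\<lambda>n. nrm M (\<lambda>x. grad (f n) x - wgrad \<Omega> u x)) \<longlonglongrightarrow> 0"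
    unfolding eq by (rule tendsto_sandwich[OF _ _ tendsto_const lim]) (use h1_norm_ge(2) in auto)
  moreover have "(\<integral>\<^sup>+x. ennreal ((f n x - w x)\<^sup>2) \<partial>boundary_measure \<Omega>) = bd_int (frontier \<Omega>) (\<lambda>x. (f n x)\<^sup>2)" for n
    unfolding nn_integral_boundary[symmetric]
  proof (rule nn_integral_cong_AE)
    have "AE x in boundary_measure \<Omega>. x \<in> frontier \<Omega>"
      by (rule AE_I2) (simp add: boundary_measure_def space_restrict_space)
    with w0 show "AE x in boundary_measure \<Omega>. ennreal ((f n x - w x)\<^sup>2) = ennreal ((f n x)\<^sup>2)"
      by eventually_elim simp
  qed
  ultimately show ?thesis using f bd uH by (auto simp: bd_approx_def H1_sq_int wgrad_sq_int)
qed

lemma bd_approx_weak_grad: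
  assumes "bd_approx u G f"
  shows "has_weak_grad \<Omega> u G"
  using assms unfolding bd_approx_def
  by (intro weak_grad_closed[of u G f "\<lambda>n. grad (f n)"]) (auto intro: smooth_sq_int weak_grad_smooth)

text \<open>The converse description, with the zero function as trace. Together the two directions
  allow closure properties and completeness of \<open>H10\<close> to be proved on approximating
  sequences.\<close>

lemma bd_approx_H10:
  assumes a: "bd_approx u G f"
  shows "u \<in> H10 \<Omega>" and "AE x in M. wgrad \<Omega> u x = G x"
proof -
  have wk: "has_weak_grad \<Omega> u G" using a by (rule bd_approx_weak_grad)
  then show "AE x in M. wgrad \<Omega> u x = G x" by (rule wgrad_eq)
  have us: "u \<in> sq_int M" and Gs: "G \<in> sq_int M" and f: "\<And>n. smooth (f n)" using a by (auto simp: bd_approx_def)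
  have uH: "u \<in> H1 \<Omega>" by (rule H1_I[OF us wk])
  have eq: "nrm M (wgrad \<Omega> (\<lambda>x. f n x - u x)) = nrm M (\<lambda>x. grad (f n) x - G x)" for n
  proof (rule nrm_cong_AE)
    show "(\<lambda>x. grad (f n) x - G x) \<in> borel_measurable M"
      by (intro sq_int_measurable sq_int_diff grad_sq_int f Gs)
    show "wgrad \<Omega> (\<lambda>x. f n x - u x) \<in> borel_measurable M"
      by (intro sq_int_measurable wgrad_sq_int H1_diff smooth_H1 f uH)
    show "AE x in M. wgrad \<Omega> (\<lambda>x. f n x - u x) x = grad (f n) x - G x"
      by (intro wgrad_eq weak_grad_diff weak_grad_smooth smooth_sq_int f us wk)
  qed
  have "(\<lambda>n. h1_norm \<Omega> (\<lambda>x. f n x - u x)) \<longlonglongrightarrow> sqrt (0\<^sup>2 + 0\<^sup>2)"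
    unfolding h1_norm_eq eq using a by (intro tendsto_intros) (auto simp: bd_approx_def)
  moreover have "(\<lambda>n. \<integral>\<^sup>+x. ennreal ((f n x - 0)\<^sup>2) \<partial>boundary_measure \<Omega>) \<longlonglongrightarrow> 0"
    using a by (simp add: nn_integral_boundary bd_approx_def)
  moreover have "(\<lambda>x. 0) \<in> L2 (boundary_measure \<Omega>)" by (simp add: L2_def)
  ultimately have "has_trace \<Omega> u (\<lambda>x. 0)"
    using uH f unfolding has_trace_def by auto
  then show "u \<in> H10 \<Omega>" using uH by (auto simp: H10_def zero_trace_on_def)
qed

lemma bd_int_add_sq:
  assumes "smooth f" "smooth g"
  shows "bd_int (frontier \<Omega>) (\<lambda>x. (f x + g x)\<^sup>2) \<le>
    2 * bd_int (frontier \<Omega>) (\<lambda>x. (f x)\<^sup>2) + 2 * bd_int (frontier \<Omega>) (\<lambda>x. (g x)\<^sup>2)"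
proof -
  have [measurable]: "f \<in> borel_measurable borel" "g \<in> borel_measurable borel"
    using assms by (auto intro: borel_measurable_continuous_onI smooth_continuous)
  have [measurable]: "frontier \<Omega> \<in> sets borel" by (rule frontier_measurable)
  have "bd_int (frontier \<Omega>) (\<lambda>x. (f x + g x)\<^sup>2) \<le> (\<integral>\<^sup>+x. 2 * (ennreal ((f x)\<^sup>2) * indicator (frontier \<Omega>) x)
      + 2 * (ennreal ((g x)\<^sup>2) * indicator (frontier \<Omega>) x) \<partial>hausdorff1)"
    unfolding bd_int_def
  proof (rule nn_integral_mono)
    fix x
    have "(f x + g x)\<^sup>2 \<le> 2 * (f x)\<^sup>2 + 2 * (g x)\<^sup>2"
      using sum_squares_bound[of "f x" "g x"] by (simp add: power2_sum)
    then have "ennreal ((f x + g x)\<^sup>2) \<le> ennreal (2 * (f x)\<^sup>2 + 2 * (g x)\<^sup>2)" by (rule ennreal_leI)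
    then show "ennreal ((f x + g x)\<^sup>2) * indicator (frontier \<Omega>) x \<le> 2 * (ennreal ((f x)\<^sup>2) * indicator (frontier \<Omega>) x)
      + 2 * (ennreal ((g x)\<^sup>2) * indicator (frontier \<Omega>) x)"
      by (auto simp: indicator_def ennreal_mult' simp flip: ennreal_numeral)
  qed
  also have "\<dots> = 2 * bd_int (frontier \<Omega>) (\<lambda>x. (f x)\<^sup>2) + 2 * bd_int (frontier \<Omega>) (\<lambda>x. (g x)\<^sup>2)"
    unfolding bd_int_def by (subst nn_integral_add) (auto simp: nn_integral_cmult)
  finally show ?thesis .
qed

lemma bd_int_cmult_sq:
  assumes "smooth f"
  shows "bd_int (frontier \<Omega>) (\<lambda>x. (c * f x)\<^sup>2) = ennreal (c\<^sup>2) * bd_int (frontier \<Omega>) (\<lambda>x. (f x)\<^sup>2)"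
proof -
  have [measurable]: "f \<in> borel_measurable borel"
    using assms by (auto intro: borel_measurable_continuous_onI smooth_continuous)
  have [measurable]: "frontier \<Omega> \<in> sets borel" by (rule frontier_measurable)
  show ?thesis
    unfolding bd_int_def by (subst nn_integral_cmult[symmetric]) (auto simp: power_mult_distrib ennreal_mult' mult.assoc)
qed

lemma tendsto_zero_ennreal_le:
  fixes f g :: "nat \<Rightarrow> ennreal"
  assumes "\<And>n. f n \<le> g n" "g \<longlonglongrightarrow> 0"
  shows "f \<longlonglongrightarrow> 0"
  by (rule tendsto_sandwich[OF _ _ tendsto_const assms(2)]) (use assms(1) in auto)

lemma bd_approx_add:
  assumes u: "bd_approx u G f" and w: "bd_approx w H g"
  shows "bd_approx (\<lambda>x. u x + w x) (\<lambda>x. G x + H x) (\<lambda>n x. f n x + g n x)"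
proof -
  have s: "u \<in> sq_int M" "G \<in> sq_int M" "w \<in> sq_int M" "H \<in> sq_int M" and
    f: "\<And>n. smooth (f n)" and g: "\<And>n. smooth (g n)" using u w by (auto simp: bd_approx_def)
  have "(\<lambda>n. nrm M (\<lambda>x. f n x + g n x - (u x + w x))) \<longlonglongrightarrow> 0"
  proof (rule tendsto_sandwich[OF _ _ tendsto_const])
    show "\<forall>\<^sub>F n in sequentially. nrm M (\<lambda>x. f n x + g n x - (u x + w x)) \<le> nrm M (\<lambda>x. f n x - u x) + nrm M (\<lambda>x. g n x - w x)"
      using nrm_add[OF sq_int_diff[OF smooth_sq_int[OF f] s(1)] sq_int_diff[OF smooth_sq_int[OF g] s(3)]]
      by (simp add: algebra_simps)
    show "(\<lambda>n. nrm M (\<lambda>x. f n x - u x) + nrm M (\<lambda>x. g n x - w x)) \<longlonglongrightarrow> 0"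
      using u w unfolding bd_approx_def by (intro tendsto_add_zero) auto
  qed simp
  moreover have "(\<lambda>n. nrm M (\<lambda>x. grad (\<lambda>x. f n x + g n x) x - (G x + H x))) \<longlonglongrightarrow> 0"
  proof (rule tendsto_sandwich[OF _ _ tendsto_const])
    show "\<forall>\<^sub>F n in sequentially. nrm M (\<lambda>x. grad (\<lambda>x. f n x + g n x) x - (G x + H x))
        \<le> nrm M (\<lambda>x. grad (f n) x - G x) + nrm M (\<lambda>x. grad (g n) x - H x)"
      using nrm_add[OF sq_int_diff[OF grad_sq_int[OF f] s(2)] sq_int_diff[OF grad_sq_int[OF g] s(4)]]
      by (simp add: algebra_simps grad_add[OF smooth_Ck1[OF f] smooth_Ck1[OF g]])
    show "(\<lambda>n. nrm M (\<lambda>x. grad (f n) x - G x) + nrm M (\<lambda>x. grad (g n) x - H x)) \<longlonglongrightarrow> 0"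
      using u w unfolding bd_approx_def by (intro tendsto_add_zero) auto
  qed simp
  moreover have "(\<lambda>n. bd_int (frontier \<Omega>) (\<lambda>x. (f n x + g n x)\<^sup>2)) \<longlonglongrightarrow> 0"
  proof (rule tendsto_zero_ennreal_le[OF bd_int_add_sq[OF f g]])
    have "(\<lambda>n. 2 * bd_int (frontier \<Omega>) (\<lambda>x. (f n x)\<^sup>2) + 2 * bd_int (frontier \<Omega>) (\<lambda>x. (g n x)\<^sup>2)) \<longlonglongrightarrow> 2 * 0 + 2 * 0"
      using u w unfolding bd_approx_def by (intro tendsto_add ennreal_tendsto_cmult) auto
    then show "(\<lambda>n. 2 * bd_int (frontier \<Omega>) (\<lambda>x. (f n x)\<^sup>2) + 2 * bd_int (frontier \<Omega>) (\<lambda>x. (g n x)\<^sup>2)) \<longlonglongrightarrow> 0" by simp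
  qed
  ultimately show ?thesis using s f g by (simp add: bd_approx_def sq_int_add smooth_add)
qed

lemma bd_approx_scale:
  assumes u: "bd_approx u G f"
  shows "bd_approx (\<lambda>x. c * u x) (\<lambda>x. c *\<^sub>R G x) (\<lambda>n x. c * f n x)"
proof -
  have s: "u \<in> sq_int M" "G \<in> sq_int M" and f: "\<And>n. smooth (f n)" using u by (auto simp: bd_approx_def)
  have "nrm M (\<lambda>x. c * f n x - c * u x) = \<bar>c\<bar> * nrm M (\<lambda>x. f n x - u x)" for n
    using nrm_scaleR[of M c "\<lambda>x. f n x - u x"] by (simp add: right_diff_distrib)
  moreover have "nrm M (\<lambda>x. grad (\<lambda>x. c * f n x) x - c *\<^sub>R G x) = \<bar>c\<bar> * nrm M (\<lambda>x. grad (f n) x - G x)" for n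
    using nrm_scaleR[of M c "\<lambda>x. grad (f n) x - G x"] by (simp add: scaleR_right_diff_distrib grad_cmult[OF smooth_Ck1[OF f]])
  moreover have "(\<lambda>n. ennreal (c\<^sup>2) * bd_int (frontier \<Omega>) (\<lambda>x. (f n x)\<^sup>2)) \<longlonglongrightarrow> ennreal (c\<^sup>2) * 0"
    using u unfolding bd_approx_def by (intro ennreal_tendsto_cmult) auto
  ultimately show ?thesis
    using u s sq_int_scaleR[OF s(1), of c] unfolding bd_approx_def
    by (auto simp: sq_int_scaleR smooth_mult smooth_const bd_int_cmult_sq intro!: tendsto_mult_right_zero)
qed

lemma H10_H1: "u \<in> H10 \<Omega> \<Longrightarrow> u \<in> H1 \<Omega>"
  by (simp add: H10_def)

lemma H10_add: "u \<in> H10 \<Omega> \<Longrightarrow> w \<in> H10 \<Omega> \<Longrightarrow> (\<lambda>x. u x + w x) \<in> H10 \<Omega>"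
  using H10_imp_bd_approx bd_approx_add bd_approx_H10(1) by meson

lemma H10_scale: "u \<in> H10 \<Omega> \<Longrightarrow> (\<lambda>x. c * u x) \<in> H10 \<Omega>"
  using H10_imp_bd_approx bd_approx_scale bd_approx_H10(1) by meson

lemma H10_zero: "(\<lambda>x. 0) \<in> H10 \<Omega>"
proof (rule bd_approx_H10(1))
  have "grad (\<lambda>x. 0) = (\<lambda>x. 0)" by (auto simp: fun_eq_iff vec_eq_iff partial_const)
  then show "bd_approx (\<lambda>x. 0) (\<lambda>x. 0) (\<lambda>n x. 0)"
    by (simp add: bd_approx_def sq_int_zero smooth_const nrm_def bd_int_def)
qed

end

section \<open>Inequalities for functions with zero trace\<close>

lemma other_other [simp]: "other (other i) = i"
  using exhaust_2[of i] by (auto simp: other_def)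

context bounded_domain
begin

text \<open>Apply the slice majorant to \<open>f * f\<close>: its derivative is twice the product of
  \<open>f\<close> and a partial derivative, so Cauchy-Schwarz bounds the interior term, and the
  boundary term is the quantity that tends to zero for a zero trace.\<close>

lemma sup_sq_on_slices:
  assumes f: "smooth f"
  shows "\<exists>A \<in> borel_measurable borel. (\<forall>x\<in>\<Omega>. ennreal ((f x)\<^sup>2) \<le> A (x $ other i)) \<and>
    (\<integral>\<^sup>+y. A y \<partial>lborel) \<le> 2 * bd_int (frontier \<Omega>) (\<lambda>x. (f x)\<^sup>2) + ennreal (2 * (nrm M f * nrm M (grad f)))"
proof -
  let ?F = "\<lambda>x. f x * f x"
  have F: "Ck (Suc 0) ?F" using f by (intro smooth_Ck1 smooth_mult)
  have pF: "partial i ?F = (\<lambda>x. f x * partial i f x + partial i f x * f x)"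
    using smooth_Ck1[OF f] by (intro partial_mult) auto
  have sq: "\<bar>?F x\<bar> = (f x)\<^sup>2" for x by (simp add: power2_eq_square)
  have int: "integrable M (\<lambda>x. norm (f x) * norm (partial i f x))"
    by (intro sq_int_norm_mult smooth_sq_int partial_sq_int f)
  have "(\<integral>\<^sup>+x. ennreal \<bar>partial i ?F x\<bar> * indicator \<Omega> x \<partial>lborel) = (\<integral>\<^sup>+x. ennreal \<bar>partial i ?F x\<bar> \<partial>M)"
    by (rule nn_integral_dom[symmetric])
  also have "\<dots> = (\<integral>\<^sup>+x. ennreal (2 * (norm (f x) * norm (partial i f x))) \<partial>M)"
    unfolding pF by (intro nn_integral_cong) (simp add: abs_mult)
  also have "\<dots> = ennreal (\<integral>x. 2 * (norm (f x) * norm (partial i f x)) \<partial>M)"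
    using int by (intro nn_integral_eq_integral integrable_mult_right) auto
  also have "\<dots> \<le> ennreal (2 * (nrm M f * nrm M (grad f)))"
  proof (rule ennreal_leI)
    have "(\<integral>x. norm (f x) * norm (partial i f x) \<partial>M) \<le> nrm M f * nrm M (partial i f)"
      by (intro integral_norm_mult_le smooth_sq_int partial_sq_int f)
    also have "\<dots> \<le> nrm M f * nrm M (grad f)"
      using nrm_component_le[OF grad_sq_int[OF f], of i] by (intro mult_left_mono) auto
    finally show "(\<integral>x. 2 * (norm (f x) * norm (partial i f x)) \<partial>M) \<le> 2 * (nrm M f * nrm M (grad f))" by simp
  qed
  finally have le: "(\<integral>\<^sup>+x. ennreal \<bar>partial i ?F x\<bar> * indicator \<Omega> x \<partial>lborel) \<le> ennreal (2 * (nrm M f * nrm M (grad f)))" .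
  from sup_on_slices[OF hausdorff_nonzero open_dom bounded_dom F, of i, unfolded sq]
  obtain A where "A \<in> borel_measurable borel" "\<forall>x\<in>\<Omega>. ennreal ((f x)\<^sup>2) \<le> A (x $ other i)"
    "(\<integral>\<^sup>+y. A y \<partial>lborel) \<le> 2 * bd_int (frontier \<Omega>) (\<lambda>x. (f x)\<^sup>2)
        + (\<integral>\<^sup>+x. ennreal \<bar>partial i ?F x\<bar> * indicator \<Omega> x \<partial>lborel)" by blast
  then show ?thesis using le by (meson add_left_mono order_trans)
qed

lemma sup_sq_on_slices_real:
  assumes f: "smooth f" and \<beta>: "bd_int (frontier \<Omega>) (\<lambda>x. (f x)\<^sup>2) \<le> ennreal \<beta>" "0 \<le> \<beta>"
  shows "\<exists>A \<in> borel_measurable borel. (\<forall>x\<in>\<Omega>. ennreal ((f x)\<^sup>2) \<le> A (x $ other i)) \<and>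
    (\<integral>\<^sup>+y. A y \<partial>lborel) \<le> ennreal (2 * \<beta> + 2 * (nrm M f * nrm M (grad f)))"
proof -
  have "2 * bd_int (frontier \<Omega>) (\<lambda>x. (f x)\<^sup>2) + ennreal (2 * (nrm M f * nrm M (grad f)))
      \<le> 2 * ennreal \<beta> + ennreal (2 * (nrm M f * nrm M (grad f)))"
    by (intro add_right_mono mult_left_mono \<beta>) simp
  also have "\<dots> = ennreal (2 * \<beta> + 2 * (nrm M f * nrm M (grad f)))"
    using \<beta>(2) by (simp add: ennreal_mult' flip: ennreal_numeral)
  finally show ?thesis using sup_sq_on_slices[OF f, of i] by (meson order_trans)
qed

text \<open>The majorant of \<open>f^2\<close> depends on one coordinate only; the other ranges over
  an interval of length \<open>2 * R\<close>, which gives the constant. The factor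
  \<open>nrm M f\<close> stays on the right, because it can be cancelled only in the limit, when
  \<open>\<beta>\<close> has disappeared.\<close>

lemma Poincare_smooth:
  "\<exists>D>0. \<forall>f \<beta>. smooth f \<longrightarrow> 0 \<le> \<beta> \<longrightarrow> bd_int (frontier \<Omega>) (\<lambda>x. (f x)\<^sup>2) \<le> ennreal \<beta> \<longrightarrow>
     (nrm M f)\<^sup>2 \<le> D * (2 * \<beta> + 2 * (nrm M f * nrm M (grad f)))"
proof -
  obtain R where R: "R > 0" "\<And>x. x \<in> \<Omega> \<Longrightarrow> norm x \<le> R"
    using bounded_dom by (auto simp: bounded_pos)
  have "(nrm M f)\<^sup>2 \<le> (2 * R) * (2 * \<beta> + 2 * (nrm M f * nrm M (grad f)))"
    if f: "smooth f" and \<beta>: "0 \<le> \<beta>" "bd_int (frontier \<Omega>) (\<lambda>x. (f x)\<^sup>2) \<le> ennreal \<beta>" for f \<beta>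
  proof -
    obtain A where [measurable]: "A \<in> borel_measurable borel"
      and le: "\<And>x. x \<in> \<Omega> \<Longrightarrow> ennreal ((f x)\<^sup>2) \<le> A (x $ other 1)"
      and A: "(\<integral>\<^sup>+y. A y \<partial>lborel) \<le> ennreal (2 * \<beta> + 2 * (nrm M f * nrm M (grad f)))"
      using sup_sq_on_slices_real[OF f \<beta>(2,1), of 1] by blast
    have "ennreal ((nrm M f)\<^sup>2) = (\<integral>\<^sup>+x. ennreal ((f x)\<^sup>2) * indicator \<Omega> x \<partial>lborel)"
      using nn_integral_sq[OF smooth_sq_int[OF f]] by (simp add: nn_integral_dom)
    also have "\<dots> \<le> (\<integral>\<^sup>+x. A (x $ other 1) * indicator {-R..R} (x $ 1) \<partial>lborel)"
    proof (rule nn_integral_mono)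
      fix x
      show "ennreal ((f x)\<^sup>2) * indicator \<Omega> x \<le> A (x $ other 1) * indicator {-R..R} (x $ 1)"
      proof (cases "x \<in> \<Omega>")
        case True
        then have "\<bar>x $ 1\<bar> \<le> R" using R(2)[OF True] component_le_norm_cart[of x 1] by linarith
        then show ?thesis using True le[OF True] by (simp add: abs_le_iff)
      qed simp
    qed
    also have "\<dots> = (\<integral>\<^sup>+y. \<integral>\<^sup>+t. A y * indicator {-R..R} t \<partial>lborel \<partial>lborel)"
      by (subst nn_integral_slice_pt[of _ 1]) simp_all
    also have "\<dots> = (\<integral>\<^sup>+y. ennreal (2 * R) * A y \<partial>lborel)"
      using R(1) by (simp add: nn_integral_cmult_indicator mult.commute)
    also have "\<dots> = ennreal (2 * R) * (\<integral>\<^sup>+y. A y \<partial>lborel)" by (rule nn_integral_cmult) simp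
    also have "\<dots> \<le> ennreal (2 * R) * ennreal (2 * \<beta> + 2 * (nrm M f * nrm M (grad f)))"
      by (intro mult_left_mono A) simp
    also have "\<dots> = ennreal ((2 * R) * (2 * \<beta> + 2 * (nrm M f * nrm M (grad f))))"
      using R(1) \<beta>(1) by (intro ennreal_mult[symmetric]) auto
    finally show ?thesis using R(1) \<beta>(1) by (subst (asm) ennreal_le_iff) auto
  qed
  then show ?thesis using R(1) by (intro exI[of _ "2 * R"]) auto
qed

text \<open>Slices in both directions give two majorants of \<open>f^2\<close>, one for each
  coordinate. Their product dominates \<open>f^4\<close>, and its integral over the plane factorises
  into two integrals over the line.\<close>

lemma Ladyzhenskaya_smooth:
  assumes f: "smooth f" and \<beta>: "0 \<le> \<beta>" "bd_int (frontier \<Omega>) (\<lambda>x. (f x)\<^sup>2) \<le> ennreal \<beta>"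
  shows "nrm M (\<lambda>x. (f x)\<^sup>2) \<le> 2 * \<beta> + 2 * (nrm M f * nrm M (grad f))" (is "_ \<le> ?c")
proof -
  obtain A where [measurable]: "A \<in> borel_measurable borel"
    and leA: "\<And>x. x \<in> \<Omega> \<Longrightarrow> ennreal ((f x)\<^sup>2) \<le> A (x $ other 1)" and A: "(\<integral>\<^sup>+y. A y \<partial>lborel) \<le> ennreal ?c"
    using sup_sq_on_slices_real[OF f \<beta>(2,1), of 1] by blast
  obtain B where [measurable]: "B \<in> borel_measurable borel"
    and leB: "\<And>x. x \<in> \<Omega> \<Longrightarrow> ennreal ((f x)\<^sup>2) \<le> B (x $ 1)" and B: "(\<integral>\<^sup>+y. B y \<partial>lborel) \<le> ennreal ?c"
    using sup_sq_on_slices_real[OF f \<beta>(2,1), of "other 1"] by auto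
  have c: "0 \<le> ?c" using \<beta>(1) by simp
  have "(\<integral>\<^sup>+x. ennreal ((norm ((f x)\<^sup>2))\<^sup>2) \<partial>M) = (\<integral>\<^sup>+x. ennreal ((norm ((f x)\<^sup>2))\<^sup>2) * indicator \<Omega> x \<partial>lborel)"
    by (rule nn_integral_dom)
  also have "\<dots> \<le> (\<integral>\<^sup>+x. A (x $ other 1) * B (x $ 1) \<partial>lborel)"
  proof (rule nn_integral_mono)
    fix x
    show "ennreal ((norm ((f x)\<^sup>2))\<^sup>2) * indicator \<Omega> x \<le> A (x $ other 1) * B (x $ 1)"
    proof (cases "x \<in> \<Omega>")
      case True
      have "ennreal ((norm ((f x)\<^sup>2))\<^sup>2) = ennreal ((f x)\<^sup>2) * ennreal ((f x)\<^sup>2)"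
        by (simp add: power2_eq_square ennreal_mult)
      also have "\<dots> \<le> A (x $ other 1) * B (x $ 1)" by (intro mult_mono leA leB True) auto
      finally show ?thesis using True by simp
    qed simp
  qed
  also have "\<dots> = (\<integral>\<^sup>+y. \<integral>\<^sup>+t. A y * B t \<partial>lborel \<partial>lborel)"
    by (subst nn_integral_slice_pt[of _ 1]) simp_all
  also have "\<dots> = (\<integral>\<^sup>+y. A y \<partial>lborel) * (\<integral>\<^sup>+t. B t \<partial>lborel)"
    by (simp add: nn_integral_cmult nn_integral_multc)
  also have "\<dots> \<le> ennreal ?c * ennreal ?c" by (intro mult_mono A B) auto
  also have "\<dots> = ennreal (?c\<^sup>2)" using c by (simp add: power2_eq_square ennreal_mult)
  finally have le: "(\<integral>\<^sup>+x. ennreal ((norm ((f x)\<^sup>2))\<^sup>2) \<partial>M) \<le> ennreal (?c\<^sup>2)" .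
  have "(\<lambda>x. (f x)\<^sup>2) \<in> borel_measurable M"
    using sq_int_measurable[OF smooth_sq_int[OF f]] by measurable
  from sq_intI(2)[OF this le c] show ?thesis .
qed

lemma bd_approx_eventually:
  assumes "bd_approx u G f" "\<epsilon> > 0"
  shows "\<forall>\<^sub>F n in sequentially. bd_int (frontier \<Omega>) (\<lambda>x. (f n x)\<^sup>2) \<le> ennreal \<epsilon>"
proof -
  have "\<forall>\<^sub>F n in sequentially. bd_int (frontier \<Omega>) (\<lambda>x. (f n x)\<^sup>2) < ennreal \<epsilon>"
    using assms by (intro order_tendstoD(2)[of _ 0]) (auto simp: bd_approx_def)
  then show ?thesis by eventually_elim simp
qed

text \<open>The smooth inequality for \<open>g - f n\<close>, with \<open>f n\<close> approximating
  \<open>u\<close>, is passed to the limit by Fatou. The difference form serves twice: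
  \<open>g = 0\<close> gives the embedding into L4, and approximants of \<open>u\<close> in place of
  \<open>g\<close> give convergence in L4. The 4 arises because the boundary integral of a squared
  difference costs a factor 2.\<close>

lemma Ladyzhenskaya_diff:
  assumes a: "bd_approx u G f" and g: "smooth g" and \<beta>: "0 \<le> \<beta>" "bd_int (frontier \<Omega>) (\<lambda>x. (g x)\<^sup>2) \<le> ennreal \<beta>"
  shows "(\<lambda>x. (g x - u x)\<^sup>2) \<in> sq_int M"
    and "nrm M (\<lambda>x. (g x - u x)\<^sup>2) \<le> 4 * \<beta> + 2 * (nrm M (\<lambda>x. g x - u x) * nrm M (\<lambda>x. grad g x - G x))"
proof -
  let ?c = "4 * \<beta> + 2 * (nrm M (\<lambda>x. g x - u x) * nrm M (\<lambda>x. grad g x - G x))"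
  have s: "u \<in> sq_int M" "G \<in> sq_int M" and f: "\<And>n. smooth (f n)"
    and fu: "(\<lambda>n. nrm M (\<lambda>x. f n x - u x)) \<longlonglongrightarrow> 0" and fG: "(\<lambda>n. nrm M (\<lambda>x. grad (f n) x - G x)) \<longlonglongrightarrow> 0"
    using a by (auto simp: bd_approx_def)
  \<comment> \<open>Mean-square convergence yields pointwise convergence only along a subsequence,
    and Fatou needs it pointwise.\<close>
  obtain r :: "nat \<Rightarrow> nat" where r: "strict_mono r" and ae: "AE x in M. (\<lambda>n. f (r n) x) \<longlonglongrightarrow> u x"
    using sq_int_AE_subseq[OF smooth_sq_int[OF f] s(1) fu] by blast
  have h: "smooth (\<lambda>x. g x - f n x)" for n by (intro smooth_diff g f)
  \<comment> \<open>Error budget: the interior product exceeds its limit by less than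
    \<open>\<epsilon> / 4\<close>, which is doubled, and the boundary integral of the approximant is
    at most \<open>\<epsilon> / 8\<close>, which is multiplied by 4; each part contributes
    \<open>\<epsilon> / 2\<close>.\<close>
  have ev: "\<forall>\<^sub>F n in sequentially. nrm M (\<lambda>x. (g x - f n x)\<^sup>2) \<le> ?c + \<epsilon>" if \<epsilon>: "\<epsilon> > 0" for \<epsilon>
  proof -
    have lim: "(\<lambda>n. nrm M (\<lambda>x. g x - f n x) * nrm M (\<lambda>x. grad g x - grad (f n) x))
        \<longlonglongrightarrow> nrm M (\<lambda>x. g x - u x) * nrm M (\<lambda>x. grad g x - G x)"
    proof (intro tendsto_mult sq_int_tendsto_nrm)
      show "(\<lambda>n. nrm M (\<lambda>x. (g x - f n x) - (g x - u x))) \<longlonglongrightarrow> 0"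
        using fu by (simp add: nrm_minus_commute[of M u])
      show "(\<lambda>n. nrm M (\<lambda>x. (grad g x - grad (f n) x) - (grad g x - G x))) \<longlonglongrightarrow> 0"
        using fG by (simp add: nrm_minus_commute[of M G])
    qed (intro sq_int_diff smooth_sq_int grad_sq_int g f s)+
    have "\<forall>\<^sub>F n in sequentially. nrm M (\<lambda>x. g x - f n x) * nrm M (\<lambda>x. grad g x - grad (f n) x)
        < nrm M (\<lambda>x. g x - u x) * nrm M (\<lambda>x. grad g x - G x) + \<epsilon> / 4"
      using \<epsilon> by (intro order_tendstoD(2)[OF lim]) simp
    moreover have "\<forall>\<^sub>F n in sequentially. bd_int (frontier \<Omega>) (\<lambda>x. (f n x)\<^sup>2) \<le> ennreal (\<epsilon> / 8)"
      using \<epsilon> by (intro bd_approx_eventually[OF a]) simp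
    ultimately show ?thesis
    proof eventually_elim
      case (elim n)
      have "bd_int (frontier \<Omega>) (\<lambda>x. (g x - f n x)\<^sup>2) = bd_int (frontier \<Omega>) (\<lambda>x. (g x + (- 1) * f n x)\<^sup>2)" by simp
      also have "\<dots> \<le> 2 * bd_int (frontier \<Omega>) (\<lambda>x. (g x)\<^sup>2) + 2 * bd_int (frontier \<Omega>) (\<lambda>x. ((- 1) * f n x)\<^sup>2)"
        by (intro bd_int_add_sq g smooth_mult smooth_const f)
      also have "\<dots> \<le> 2 * ennreal \<beta> + 2 * ennreal (\<epsilon> / 8)"
        using \<beta> elim by (intro add_mono mult_left_mono) auto
      also have "\<dots> = ennreal (2 * \<beta>) + ennreal (2 * (\<epsilon> / 8))"
        using \<beta>(1) \<epsilon> ennreal_mult[of 2 \<beta>] ennreal_mult[of 2 "\<epsilon> / 8"] by (simp only: ennreal_numeral)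
      also have "\<dots> = ennreal (2 * \<beta> + 2 * (\<epsilon> / 8))"
        using \<beta>(1) \<epsilon> by (intro ennreal_plus[symmetric]) auto
      finally have "nrm M (\<lambda>x. (g x - f n x)\<^sup>2) \<le> 2 * (2 * \<beta> + 2 * (\<epsilon> / 8))
          + 2 * (nrm M (\<lambda>x. g x - f n x) * nrm M (grad (\<lambda>x. g x - f n x)))"
        using \<beta>(1) \<epsilon> by (intro Ladyzhenskaya_smooth[OF h]) auto
      moreover have "grad (\<lambda>x. g x - f n x) = (\<lambda>x. grad g x - grad (f n) x)"
        using grad_diff[OF smooth_Ck1[OF g] smooth_Ck1[OF f]] by (simp add: fun_eq_iff)
      ultimately show ?case using elim(1) by simp
    qed
  qed
  have c: "0 \<le> ?c" using \<beta> by simp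
  have sqh: "(\<lambda>x. (g x - f n x)\<^sup>2) \<in> sq_int M" for n
    unfolding power2_eq_square by (intro smooth_sq_int smooth_mult h)
  have meas: "(\<lambda>x. (g x - u x)\<^sup>2) \<in> borel_measurable M"
    using sq_int_measurable[OF sq_int_diff[OF smooth_sq_int[OF g] s(1)]] by measurable
  have ae': "AE x in M. (\<lambda>n. (g x - f (r n) x)\<^sup>2) \<longlonglongrightarrow> (g x - u x)\<^sup>2"
    using ae by eventually_elim (intro tendsto_intros)
  have *: "(\<lambda>x. (g x - u x)\<^sup>2) \<in> sq_int M \<and> nrm M (\<lambda>x. (g x - u x)\<^sup>2) \<le> ?c + \<epsilon>" if \<epsilon>: "\<epsilon> > 0" for \<epsilon>
  proof -
    have "\<forall>\<^sub>F n in sequentially. nrm M (\<lambda>x. (g x - f (r n) x)\<^sup>2) \<le> ?c + \<epsilon>"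
      using eventually_compose_filterlim[OF ev[OF \<epsilon>] filterlim_subseq[OF r]] .
    moreover have "0 \<le> ?c + \<epsilon>" using c \<epsilon> by linarith
    ultimately show ?thesis using nrm_le_of_AE_tendsto[OF sqh meas ae'] by blast
  qed
  show "(\<lambda>x. (g x - u x)\<^sup>2) \<in> sq_int M" using *[of 1] by simp
  show "nrm M (\<lambda>x. (g x - u x)\<^sup>2) \<le> ?c" by (rule field_le_epsilon) (rule conjunct2[OF *])
qed

lemma grad_zero: "grad (\<lambda>x. 0) = (\<lambda>x. 0)"
  by (auto simp: fun_eq_iff vec_eq_iff partial_const)

text \<open>One constant is made to serve Poincare's inequality and the embedding into L4; taking it
  at least 1 lets later estimates absorb terms that carry no factor of it.\<close>

theorem H10_embedding:
  "\<exists>C\<ge>1. \<forall>u\<in>H10 \<Omega>. nrm M u \<le> C * h10_norm \<Omega> u \<and> (\<lambda>x. (u x)\<^sup>2) \<in> sq_int M \<and>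
     nrm M (\<lambda>x. (u x)\<^sup>2) \<le> (C * h10_norm \<Omega> u)\<^sup>2"
proof -
  obtain D where D: "D > 0" and Poin: "\<And>f \<beta>. smooth f \<Longrightarrow> 0 \<le> \<beta> \<Longrightarrow> bd_int (frontier \<Omega>) (\<lambda>x. (f x)\<^sup>2) \<le> ennreal \<beta> \<Longrightarrow>
     (nrm M f)\<^sup>2 \<le> D * (2 * \<beta> + 2 * (nrm M f * nrm M (grad f)))"
    using Poincare_smooth by blast
  have main: "nrm M u \<le> 2 * D * h10_norm \<Omega> u \<and> (\<lambda>x. (u x)\<^sup>2) \<in> sq_int M \<and>
     nrm M (\<lambda>x. (u x)\<^sup>2) \<le> 4 * D * (h10_norm \<Omega> u)\<^sup>2" if u: "u \<in> H10 \<Omega>" for u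
  proof -
    let ?G = "wgrad \<Omega> u"
    obtain f where a: "bd_approx u ?G f" using H10_imp_bd_approx[OF u] by blast
    have s: "u \<in> sq_int M" "?G \<in> sq_int M" and f: "\<And>n. smooth (f n)"
      and fu: "(\<lambda>n. nrm M (\<lambda>x. f n x - u x)) \<longlonglongrightarrow> 0" and fG: "(\<lambda>n. nrm M (\<lambda>x. grad (f n) x - ?G x)) \<longlonglongrightarrow> 0"
      using a by (auto simp: bd_approx_def)
    have lim1: "(\<lambda>n. nrm M (f n)) \<longlonglongrightarrow> nrm M u" by (intro sq_int_tendsto_nrm smooth_sq_int f s fu)
    have lim2: "(\<lambda>n. nrm M (grad (f n))) \<longlonglongrightarrow> nrm M ?G" by (intro sq_int_tendsto_nrm grad_sq_int f s fG)
    \<comment> \<open>The admissible boundary error is chosen as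
      \<open>\<epsilon> / (2 * D)\<close>, so that its contribution after multiplication by
      \<open>2 * D\<close> is \<open>\<epsilon>\<close>.\<close>
    have eps: "(nrm M u)\<^sup>2 \<le> D * (2 * (nrm M u * nrm M ?G)) + \<epsilon>" if \<epsilon>: "\<epsilon> > 0" for \<epsilon>
    proof (rule tendsto_le[OF sequentially_bot])
      show "(\<lambda>n. (nrm M (f n))\<^sup>2) \<longlonglongrightarrow> (nrm M u)\<^sup>2" by (intro tendsto_intros lim1)
      show "(\<lambda>n. D * (2 * (nrm M (f n) * nrm M (grad (f n)))) + \<epsilon>) \<longlonglongrightarrow> D * (2 * (nrm M u * nrm M ?G)) + \<epsilon>"
        by (intro tendsto_intros lim1 lim2)
      have "\<forall>\<^sub>F n in sequentially. bd_int (frontier \<Omega>) (\<lambda>x. (f n x)\<^sup>2) \<le> ennreal (\<epsilon> / (2 * D))"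
        using \<epsilon> D by (intro bd_approx_eventually[OF a]) simp
      then show "\<forall>\<^sub>F n in sequentially. (nrm M (f n))\<^sup>2 \<le> D * (2 * (nrm M (f n) * nrm M (grad (f n)))) + \<epsilon>"
      proof eventually_elim
        case (elim n)
        then have "(nrm M (f n))\<^sup>2 \<le> D * (2 * (\<epsilon> / (2 * D)) + 2 * (nrm M (f n) * nrm M (grad (f n))))"
          using \<epsilon> D by (intro Poin f) auto
        also have "\<dots> = D * (2 * (nrm M (f n) * nrm M (grad (f n)))) + \<epsilon>"
          using D by (simp add: field_simps)
        finally show ?case .
      qed
    qed
    have "(nrm M u)\<^sup>2 \<le> D * (2 * (nrm M u * nrm M ?G))" using eps by (rule field_le_epsilon)
    then have "nrm M u * nrm M u \<le> (2 * D * nrm M ?G) * nrm M u" by (simp add: power2_eq_square mult_ac)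
    moreover have "0 \<le> 2 * D * nrm M ?G" using D by simp
    ultimately have P: "nrm M u \<le> 2 * D * nrm M ?G"
      using nrm_nonneg[of M u] by (metis mult_right_le_imp_le order_le_less)
    \<comment> \<open>The smooth comparison function is zero, with zero boundary error;
      \<open>Ladyzhenskaya_diff\<close> then speaks about \<open>u\<close> itself.\<close>
    have bd0: "bd_int (frontier \<Omega>) (\<lambda>x. (0::real)\<^sup>2) \<le> ennreal 0" by (simp add: bd_int_def)
    have L1: "(\<lambda>x. (u x)\<^sup>2) \<in> sq_int M"
      using Ladyzhenskaya_diff(1)[OF a smooth_const[of 0] order_refl bd0] by simp
    have z: "nrm M (\<lambda>x. - u x) = nrm M u" "nrm M (\<lambda>x. - ?G x) = nrm M ?G"
      by (simp_all add: nrm_def)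
    have "nrm M (\<lambda>x. (u x)\<^sup>2) \<le> 2 * (nrm M u * nrm M ?G)"
      using Ladyzhenskaya_diff(2)[OF a smooth_const[of 0] order_refl bd0] by (simp add: grad_zero z)
    also have "\<dots> \<le> 2 * ((2 * D * nrm M ?G) * nrm M ?G)" by (intro mult_left_mono mult_right_mono P) auto
    finally have "nrm M (\<lambda>x. (u x)\<^sup>2) \<le> 4 * D * (nrm M ?G)\<^sup>2" by (simp add: power2_eq_square mult_ac)
    with P L1 show ?thesis by (simp add: h10_norm_eq)
  qed
  show ?thesis
  \<comment> \<open>This constant is at least 1 and at least \<open>2 * D\<close>, and its square is
    at least \<open>4 * D\<close>, as the three inequalities require.\<close>
  proof (intro exI[of _ "4 * D + 1"] conjI ballI)
    show "1 \<le> 4 * D + 1" using D by simp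
    fix u assume u: "u \<in> H10 \<Omega>"
    have h: "0 \<le> h10_norm \<Omega> u" by (simp add: h10_norm_eq)
    have "2 * D * h10_norm \<Omega> u \<le> (4 * D + 1) * h10_norm \<Omega> u" using D h by (intro mult_right_mono) auto
    with main[OF u] show "nrm M u \<le> (4 * D + 1) * h10_norm \<Omega> u" by linarith
    show "(\<lambda>x. (u x)\<^sup>2) \<in> sq_int M" using main[OF u] by blast
    have "4 * D \<le> (4 * D + 1)\<^sup>2" using D by (simp add: power2_eq_square algebra_simps)
    then have "4 * D * (h10_norm \<Omega> u)\<^sup>2 \<le> (4 * D + 1)\<^sup>2 * (h10_norm \<Omega> u)\<^sup>2" by (intro mult_right_mono) auto
    with main[OF u] show "nrm M (\<lambda>x. (u x)\<^sup>2) \<le> ((4 * D + 1) * h10_norm \<Omega> u)\<^sup>2" by (simp add: power_mult_distrib)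
  qed
qed

lemma H10_diff: "u \<in> H10 \<Omega> \<Longrightarrow> w \<in> H10 \<Omega> \<Longrightarrow> (\<lambda>x. u x - w x) \<in> H10 \<Omega>"
  using H10_add[of u "\<lambda>x. - 1 * w x"] H10_scale[of w "- 1"] by simp

lemma h10_norm_diff:
  assumes "u \<in> H10 \<Omega>" "w \<in> H10 \<Omega>"
  shows "h10_norm \<Omega> (\<lambda>x. u x - w x) = nrm M (\<lambda>x. wgrad \<Omega> u x - wgrad \<Omega> w x)"
  unfolding h10_norm_eq using assms
  by (intro nrm_cong_AE sq_int_measurable sq_int_diff wgrad_sq_int H1_diff wgrad_diff H10_H1)

text \<open>Gradients converge by completeness of the square integrable functions, and Poincare
  makes the functions converge too. That the limit again has zero trace comes from a diagonal
  choice: each member is replaced by one of its smooth approximants, with function, gradient and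
  boundary errors all bounded by \<open>1 / Suc n\<close>.\<close>

theorem H10_complete:
  assumes s: "\<And>n. s n \<in> H10 \<Omega>"
    and cauchy: "\<And>e. e > 0 \<Longrightarrow> \<exists>K. \<forall>m\<ge>K. \<forall>n\<ge>K. nrm M (\<lambda>x. wgrad \<Omega> (s m) x - wgrad \<Omega> (s n) x) < e"
  shows "\<exists>u\<in>H10 \<Omega>. (\<lambda>n. nrm M (\<lambda>x. wgrad \<Omega> (s n) x - wgrad \<Omega> u x)) \<longlonglongrightarrow> 0"
proof -
  obtain C where C: "C \<ge> 1" and emb: "\<And>u. u \<in> H10 \<Omega> \<Longrightarrow> nrm M u \<le> C * h10_norm \<Omega> u" using H10_embedding by blast
  have sH: "s n \<in> H1 \<Omega>" for n using s by (rule H10_H1)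
  have ss: "s n \<in> sq_int M" and gs: "wgrad \<Omega> (s n) \<in> sq_int M" for n
    using sH by (auto intro: H1_sq_int wgrad_sq_int)
  obtain G where G: "G \<in> sq_int M" and limG: "(\<lambda>n. nrm M (\<lambda>x. wgrad \<Omega> (s n) x - G x)) \<longlonglongrightarrow> 0"
    using sq_int_complete[OF gs cauchy] by blast
  have cu: "\<exists>K. \<forall>m\<ge>K. \<forall>n\<ge>K. nrm M (\<lambda>x. s m x - s n x) < e" if e: "e > 0" for e
  proof -
    obtain K where K: "\<forall>m\<ge>K. \<forall>n\<ge>K. nrm M (\<lambda>x. wgrad \<Omega> (s m) x - wgrad \<Omega> (s n) x) < e / C"
      using cauchy[of "e / C"] e C by auto
    show ?thesis
    proof (intro exI allI impI)
      fix m n assume mn: "m \<ge> K" "n \<ge> K"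
      have "nrm M (\<lambda>x. s m x - s n x) \<le> C * nrm M (\<lambda>x. wgrad \<Omega> (s m) x - wgrad \<Omega> (s n) x)"
        using emb[OF H10_diff[OF s s], of m n] h10_norm_diff[OF s s, of m n] by simp
      also have "\<dots> < C * (e / C)" using K mn C by (intro mult_strict_left_mono) auto
      finally show "nrm M (\<lambda>x. s m x - s n x) < e" using C by simp
    qed
  qed
  obtain u where u: "u \<in> sq_int M" and limu: "(\<lambda>n. nrm M (\<lambda>x. s n x - u x)) \<longlonglongrightarrow> 0"
    using sq_int_complete[OF ss cu] by blast
  let ?Q = "\<lambda>n f. smooth f \<and> nrm M (\<lambda>x. f x - s n x) < 1 / real (Suc n) \<and>
      nrm M (\<lambda>x. grad f x - wgrad \<Omega> (s n) x) < 1 / real (Suc n) \<and>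
      bd_int (frontier \<Omega>) (\<lambda>x. (f x)\<^sup>2) \<le> ennreal (1 / real (Suc n))"
  have ex: "\<exists>f. ?Q n f" for n
  proof -
    obtain f where a: "bd_approx (s n) (wgrad \<Omega> (s n)) f" using H10_imp_bd_approx[OF s] by blast
    have "\<forall>\<^sub>F k in sequentially. nrm M (\<lambda>x. f k x - s n x) < 1 / real (Suc n)"
      "\<forall>\<^sub>F k in sequentially. nrm M (\<lambda>x. grad (f k) x - wgrad \<Omega> (s n) x) < 1 / real (Suc n)"
      using a unfolding bd_approx_def by (auto intro!: order_tendstoD(2)[of _ 0])
    moreover have "\<forall>\<^sub>F k in sequentially. bd_int (frontier \<Omega>) (\<lambda>x. (f k x)\<^sup>2) \<le> ennreal (1 / real (Suc n))"
      by (intro bd_approx_eventually[OF a]) simp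
    ultimately have "\<forall>\<^sub>F k in sequentially. nrm M (\<lambda>x. f k x - s n x) < 1 / real (Suc n) \<and>
      nrm M (\<lambda>x. grad (f k) x - wgrad \<Omega> (s n) x) < 1 / real (Suc n) \<and>
      bd_int (frontier \<Omega>) (\<lambda>x. (f k x)\<^sup>2) \<le> ennreal (1 / real (Suc n))"
      by eventually_elim blast
    then obtain k where "nrm M (\<lambda>x. f k x - s n x) < 1 / real (Suc n) \<and>
      nrm M (\<lambda>x. grad (f k) x - wgrad \<Omega> (s n) x) < 1 / real (Suc n) \<and>
      bd_int (frontier \<Omega>) (\<lambda>x. (f k x)\<^sup>2) \<le> ennreal (1 / real (Suc n))"
      by (auto simp: eventually_sequentially)
    then show ?thesis using a by (auto simp: bd_approx_def)
  qed
  define f where "f n = (SOME h. ?Q n h)" for n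
  have Q: "?Q n (f n)" for n unfolding f_def by (rule someI_ex[OF ex])
  have f: "\<And>n. smooth (f n)" and f1: "\<And>n. nrm M (\<lambda>x. f n x - s n x) \<le> 1 / real (Suc n)"
    and f2: "\<And>n. nrm M (\<lambda>x. grad (f n) x - wgrad \<Omega> (s n) x) \<le> 1 / real (Suc n)"
    and f3: "\<And>n. bd_int (frontier \<Omega>) (\<lambda>x. (f n x)\<^sup>2) \<le> ennreal (1 / real (Suc n))"
    using Q by (auto intro: less_imp_le)
  have inv: "(\<lambda>n. 1 / real (Suc n)) \<longlonglongrightarrow> 0" by (intro LIMSEQ_Suc lim_1_over_n)
  have "bd_approx u G f"
    unfolding bd_approx_def
  proof (intro conjI allI u G f)
    show "(\<lambda>n. nrm M (\<lambda>x. f n x - u x)) \<longlonglongrightarrow> 0"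
    proof (rule tendsto_sandwich[OF _ _ tendsto_const tendsto_add_zero[OF inv limu]])
      show "\<forall>\<^sub>F n in sequentially. nrm M (\<lambda>x. f n x - u x) \<le> 1 / real (Suc n) + nrm M (\<lambda>x. s n x - u x)"
        by (intro always_eventually allI, rule order_trans[OF nrm_triangle[OF smooth_sq_int[OF f] ss u] add_right_mono[OF f1]])
    qed simp
    show "(\<lambda>n. nrm M (\<lambda>x. grad (f n) x - G x)) \<longlonglongrightarrow> 0"
    proof (rule tendsto_sandwich[OF _ _ tendsto_const tendsto_add_zero[OF inv limG]])
      show "\<forall>\<^sub>F n in sequentially. nrm M (\<lambda>x. grad (f n) x - G x) \<le> 1 / real (Suc n) + nrm M (\<lambda>x. wgrad \<Omega> (s n) x - G x)"
        by (intro always_eventually allI, rule order_trans[OF nrm_triangle[OF grad_sq_int[OF f] gs G] add_right_mono[OF f2]])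
    qed simp
    show "(\<lambda>n. bd_int (frontier \<Omega>) (\<lambda>x. (f n x)\<^sup>2)) \<longlonglongrightarrow> 0"
      by (rule tendsto_zero_ennreal_le[OF f3]) (use tendsto_ennrealI[OF inv] in simp)
  qed
  note H = bd_approx_H10[OF this]
  have "nrm M (\<lambda>x. wgrad \<Omega> (s n) x - wgrad \<Omega> u x) = nrm M (\<lambda>x. wgrad \<Omega> (s n) x - G x)" for n
  proof (rule nrm_cong_AE)
    show "AE x in M. wgrad \<Omega> (s n) x - wgrad \<Omega> u x = wgrad \<Omega> (s n) x - G x"
      using H(2) by eventually_elim simp
  qed (intro sq_int_measurable sq_int_diff gs G wgrad_sq_int H10_H1 H(1))+
  then show ?thesis using limG H(1) by (intro bexI[of _ u]) simp_all
qed

text \<open>Integrate the derivative of \<open>g f^2\<close> for smooth approximants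
  \<open>f\<close> of \<open>\<theta>\<close>: the product rule yields the two terms of the
  identity, and the boundary remainder is at most a multiple of the boundary integral of
  \<open>f^2\<close>. The smooth coefficient may be nonzero on the frontier; it and its derivatives
  are bounded on the closure, so mean-square limits suffice.\<close>

lemma transport_identity_smooth:
  assumes g: "smooth g" and a: "bd_approx \<theta> G f"
  shows "2 * ip M (\<lambda>x. g x * \<theta> x) (\<lambda>x. G x $ j) + ip M (\<lambda>x. partial j g x * \<theta> x) \<theta> = 0"
proof -
  have s: "\<theta> \<in> sq_int M" "G \<in> sq_int M" and f: "\<And>n. smooth (f n)"
    and fu: "(\<lambda>n. nrm M (\<lambda>x. f n x - \<theta> x)) \<longlonglongrightarrow> 0" and fG: "(\<lambda>n. nrm M (\<lambda>x. grad (f n) x - G x)) \<longlonglongrightarrow> 0"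
    and bd: "(\<lambda>n. bd_int (frontier \<Omega>) (\<lambda>x. (f n x)\<^sup>2)) \<longlonglongrightarrow> 0"
    using a by (auto simp: bd_approx_def)
  have gc: "continuous_on UNIV g" "continuous_on UNIV (partial j g)"
    using g by (auto intro: smooth_continuous Ck1_partial_continuous smooth_Ck1)
  define E where "E n = 2 * ip M (\<lambda>x. g x * f n x) (partial j (f n)) + ip M (\<lambda>x. partial j g x * f n x) (f n)" for n
  have mult: "(\<lambda>x. h x * \<theta> x) \<in> sq_int M \<and> (\<forall>n. (\<lambda>x. h x * f n x) \<in> sq_int M) \<and>
      (\<lambda>n. nrm M (\<lambda>x. h x * f n x - h x * \<theta> x)) \<longlonglongrightarrow> 0" if h: "continuous_on UNIV h" for h :: "real^2 \<Rightarrow> real"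
  proof (intro conjI allI)
    show "(\<lambda>x. h x * \<theta> x) \<in> sq_int M" "(\<lambda>x. h x * f n x) \<in> sq_int M" for n
      by (intro continuous_mult_sq_int(1)[OF h] s smooth_sq_int f)+
    obtain c where c: "\<And>u. u \<in> sq_int M \<Longrightarrow> nrm M (\<lambda>x. h x * u x) \<le> c * nrm M u"
      using continuous_mult_sq_int(2)[OF h s(1)] by blast
    show "(\<lambda>n. nrm M (\<lambda>x. h x * f n x - h x * \<theta> x)) \<longlonglongrightarrow> 0"
    proof (rule tendsto_sandwich[OF _ _ tendsto_const tendsto_mult_right_zero[OF fu, of c]])
      show "\<forall>\<^sub>F n in sequentially. nrm M (\<lambda>x. h x * f n x - h x * \<theta> x) \<le> c * nrm M (\<lambda>x. f n x - \<theta> x)"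
        using c[OF sq_int_diff[OF smooth_sq_int[OF f] s(1)]] by (simp add: right_diff_distrib)
    qed simp
  qed
  have limj: "(\<lambda>n. nrm M (\<lambda>x. partial j (f n) x - G x $ j)) \<longlonglongrightarrow> 0"
  proof (rule tendsto_sandwich[OF _ _ tendsto_const fG])
    show "\<forall>\<^sub>F n in sequentially. nrm M (\<lambda>x. partial j (f n) x - G x $ j) \<le> nrm M (\<lambda>x. grad (f n) x - G x)"
      using nrm_component_le[OF sq_int_diff[OF grad_sq_int[OF f] s(2)], of _ j] by simp
  qed simp
  have Gj: "(\<lambda>x. G x $ j) \<in> sq_int M" using s(2) by (simp add: sq_int_vec_iff)
  have "E \<longlonglongrightarrow> 2 * ip M (\<lambda>x. g x * \<theta> x) (\<lambda>x. G x $ j) + ip M (\<lambda>x. partial j g x * \<theta> x) \<theta>"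
    unfolding E_def
  proof (intro tendsto_intros)
    note m1 = mult[OF gc(1)] and m2 = mult[OF gc(2)]
    show "(\<lambda>n. ip M (\<lambda>x. g x * f n x) (partial j (f n))) \<longlonglongrightarrow> ip M (\<lambda>x. g x * \<theta> x) (\<lambda>x. G x $ j)"
      by (rule ip_tendsto[OF _ _ _ partial_sq_int[OF f] Gj limj]) (use m1 in blast)+
    show "(\<lambda>n. ip M (\<lambda>x. partial j g x * f n x) (f n)) \<longlonglongrightarrow> ip M (\<lambda>x. partial j g x * \<theta> x) \<theta>"
      by (rule ip_tendsto[OF _ _ _ smooth_sq_int[OF f] s(1) fu]) (use m2 in blast)+
  qed
  moreover have "E \<longlonglongrightarrow> 0"
  proof -
    obtain c where c: "0 \<le> c" "\<And>x. x \<in> closure \<Omega> \<Longrightarrow> \<bar>g x\<bar> \<le> c" using continuous_bounded_dom[OF gc(1)] by blast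
    \<comment> \<open>\<open>E n\<close> is exactly the integral over \<open>\<Omega>\<close> of the
      derivative of \<open>g * f n * f n\<close>; the constant \<open>c\<close> bounds
      \<open>g\<close> on the closure, in particular on the frontier.\<close>
    have le: "ennreal \<bar>E n\<bar> \<le> 4 * (ennreal c * bd_int (frontier \<Omega>) (\<lambda>x. (f n x)\<^sup>2))" for n
    proof -
      let ?F = "\<lambda>x. g x * (f n x * f n x)"
      have F: "Ck (Suc 0) ?F" by (intro smooth_Ck1 smooth_mult g f)
      have gC: "Ck (Suc 0) g" "Ck (Suc 0) (f n)" "Ck (Suc 0) (\<lambda>x. f n x * f n x)"
        by (intro smooth_Ck1 smooth_mult g f)+
      have "partial j ?F = (\<lambda>x. g x * (f n x * partial j (f n) x + partial j (f n) x * f n x) + partial j g x * (f n x * f n x))"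
        using gC by (subst partial_mult, simp, simp, subst partial_mult) auto
      then have pF: "partial j ?F = (\<lambda>x. 2 * ((g x * f n x) * partial j (f n) x) + (partial j g x * f n x) * f n x)"
        by (simp add: fun_eq_iff algebra_simps)
      have i1: "integrable M (\<lambda>x. (g x * f n x) * partial j (f n) x)"
        by (intro sq_int_mult smooth_sq_int smooth_mult partial_sq_int g f)
      have i2: "integrable M (\<lambda>x. (partial j g x * f n x) * f n x)"
        by (intro sq_int_mult continuous_mult_sq_int(1) gc smooth_sq_int f)
      have "E n = (\<integral>x. partial j ?F x \<partial>M)"
        unfolding pF E_def ip_def using i1 i2 by simp
      also have "\<dots> = (\<integral>x. indicator \<Omega> x * partial j ?F x \<partial>lborel)"
        by (rule lebesgue_on_integral_eq(1)[OF dom_borel borel_measurable_continuous_onI[OF Ck1_partial_continuous[OF F]]])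
      finally have "ennreal \<bar>E n\<bar> \<le> 4 * bd_int (frontier \<Omega>) (\<lambda>x. \<bar>?F x\<bar>)"
        using integral_partial_bound[OF hausdorff_nonzero open_dom bounded_dom F, of j] by simp
      also have "bd_int (frontier \<Omega>) (\<lambda>x. \<bar>?F x\<bar>) \<le> ennreal c * bd_int (frontier \<Omega>) (\<lambda>x. (f n x)\<^sup>2)"
      proof -
        have [measurable]: "f n \<in> borel_measurable borel" "frontier \<Omega> \<in> sets borel"
          by (auto intro: borel_measurable_continuous_onI smooth_continuous f frontier_measurable)
        have "bd_int (frontier \<Omega>) (\<lambda>x. \<bar>?F x\<bar>) \<le> (\<integral>\<^sup>+x. ennreal c * (ennreal ((f n x)\<^sup>2) * indicator (frontier \<Omega>) x) \<partial>hausdorff1)"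
          unfolding bd_int_def
        proof (rule nn_integral_mono)
          fix x
          show "ennreal \<bar>?F x\<bar> * indicator (frontier \<Omega>) x \<le> ennreal c * (ennreal ((f n x)\<^sup>2) * indicator (frontier \<Omega>) x)"
          proof (cases "x \<in> frontier \<Omega>")
            case True
            then have "\<bar>g x\<bar> \<le> c" by (intro c(2)) (simp add: frontier_def)
            then have "\<bar>?F x\<bar> \<le> c * (f n x)\<^sup>2"
              by (simp add: abs_mult power2_eq_square mult_right_mono)
            then have "ennreal \<bar>?F x\<bar> \<le> ennreal (c * (f n x)\<^sup>2)" by (rule ennreal_leI)
            then show ?thesis using True c(1) by (simp add: ennreal_mult)
          qed simp
        qed
        also have "\<dots> = ennreal c * bd_int (frontier \<Omega>) (\<lambda>x. (f n x)\<^sup>2)"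
          unfolding bd_int_def by (rule nn_integral_cmult) measurable
        finally show ?thesis .
      qed
      finally show ?thesis by (simp add: mult_left_mono)
    qed
    have "(\<lambda>n. 4 * (ennreal c * bd_int (frontier \<Omega>) (\<lambda>x. (f n x)\<^sup>2))) \<longlonglongrightarrow> 4 * (ennreal c * 0)"
      by (intro ennreal_tendsto_cmult bd) auto
    then have lim0: "(\<lambda>n. 4 * (ennreal c * bd_int (frontier \<Omega>) (\<lambda>x. (f n x)\<^sup>2))) \<longlonglongrightarrow> 0" by simp
    have "(\<lambda>n. ennreal \<bar>E n\<bar>) \<longlonglongrightarrow> 0" by (rule tendsto_zero_ennreal_le[OF le lim0])
    then have "(\<lambda>n. \<bar>E n\<bar>) \<longlonglongrightarrow> 0"
      by (intro tendsto_ennrealD) simp_all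
    then show ?thesis by (simp add: tendsto_rabs_zero_iff)
  qed
  ultimately show ?thesis by (rule LIMSEQ_unique)
qed

text \<open>Now the coefficient \<open>u\<close> is approximated. The first term is a product of
  three functions, for which mean-square convergence of the approximants is insufficient; their
  convergence in L4 and Hoelder's inequality handle it. In the second term convergence of the
  gradients is enough, since \<open>\<theta>^2\<close> is square integrable.\<close>

theorem transport_identity:
  assumes u: "u \<in> H10 \<Omega>" and \<theta>: "\<theta> \<in> H10 \<Omega>"
  shows "2 * (\<integral>x. u x * wgrad \<Omega> \<theta> x $ j * \<theta> x \<partial>M) + (\<integral>x. wgrad \<Omega> u x $ j * (\<theta> x)\<^sup>2 \<partial>M) = 0"
proof -
  let ?U = "wgrad \<Omega> u" and ?G = "wgrad \<Omega> \<theta>"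
  obtain g where a: "bd_approx u ?U g" using H10_imp_bd_approx[OF u] by blast
  obtain f where b: "bd_approx \<theta> ?G f" using H10_imp_bd_approx[OF \<theta>] by blast
  have s: "u \<in> sq_int M" "?U \<in> sq_int M" and g: "\<And>n. smooth (g n)"
    and gu: "(\<lambda>n. nrm M (\<lambda>x. g n x - u x)) \<longlonglongrightarrow> 0" and gU: "(\<lambda>n. nrm M (\<lambda>x. grad (g n) x - ?U x)) \<longlonglongrightarrow> 0"
    using a by (auto simp: bd_approx_def)
  have t: "\<theta> \<in> sq_int M" "?G \<in> sq_int M" using b by (auto simp: bd_approx_def)
  have Gj: "(\<lambda>x. ?G x $ j) \<in> sq_int M" and Uj: "(\<lambda>x. ?U x $ j) \<in> sq_int M"
    using s(2) t(2) by (simp_all add: sq_int_vec_iff)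
  have \<theta>4: "(\<lambda>x. (\<theta> x)\<^sup>2) \<in> sq_int M" and u4: "(\<lambda>x. (u x)\<^sup>2) \<in> sq_int M" using H10_embedding u \<theta> by blast+
  have t_m: "\<theta> \<in> borel_measurable M" and u_m: "u \<in> borel_measurable M" using t s by (auto intro: sq_int_measurable)
  \<comment> \<open>Convergence in L4 by \<open>Ladyzhenskaya_diff\<close>: the boundary error
    \<open>e / 8\<close> enters with factor 4, the product of interior distances takes the other
    half of \<open>e\<close>.\<close>
  have L4: "(\<lambda>n. nrm M (\<lambda>x. (g n x - u x)\<^sup>2)) \<longlonglongrightarrow> 0"
  proof (rule LIMSEQ_I)
    fix e :: real assume e: "e > 0"
    have "(\<lambda>n. 2 * (nrm M (\<lambda>x. g n x - u x) * nrm M (\<lambda>x. grad (g n) x - ?U x))) \<longlonglongrightarrow> 2 * (0 * 0)"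
      by (intro tendsto_intros gu gU)
    then have "\<forall>\<^sub>F n in sequentially. 2 * (nrm M (\<lambda>x. g n x - u x) * nrm M (\<lambda>x. grad (g n) x - ?U x)) < e / 2"
      using e by (elim order_tendstoD(2)) simp
    moreover have "\<forall>\<^sub>F n in sequentially. bd_int (frontier \<Omega>) (\<lambda>x. (g n x)\<^sup>2) \<le> ennreal (e / 8)"
      using e by (intro bd_approx_eventually[OF a]) simp
    ultimately have "\<forall>\<^sub>F n in sequentially. norm (nrm M (\<lambda>x. (g n x - u x)\<^sup>2) - 0) < e"
    proof eventually_elim
      case (elim n)
      then show ?case using Ladyzhenskaya_diff(2)[OF a g, of "e / 8" n] e by simp
    qed
    then show "\<exists>no. \<forall>n\<ge>no. norm (nrm M (\<lambda>x. (g n x - u x)\<^sup>2) - 0) < e" by (simp add: eventually_sequentially)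
  qed
  have sg4: "(\<lambda>x. (g n x)\<^sup>2) \<in> sq_int M" for n unfolding power2_eq_square by (intro smooth_sq_int smooth_mult g)
  have g_m: "g n \<in> borel_measurable M" for n using g by (intro sq_int_measurable smooth_sq_int)
  have d4: "(\<lambda>x. (g n x - u x)\<^sup>2) \<in> sq_int M" for n
  proof (rule sq_int_bounded[of "\<lambda>x. (g n x)\<^sup>2 + (u x)\<^sup>2" _ _ 2])
    show "(\<lambda>x. (g n x)\<^sup>2 + (u x)\<^sup>2) \<in> sq_int M" by (intro sq_int_add sg4 u4)
    show "(\<lambda>x. (g n x - u x)\<^sup>2) \<in> borel_measurable M" using g_m u_m by measurable
    have "(a - b)\<^sup>2 \<le> 2 * (a\<^sup>2 + b\<^sup>2)" for a b :: real
      using sum_squares_bound[of a "- b"] by (simp add: power2_diff)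
    then show "AE x in M. norm ((g n x - u x)\<^sup>2) \<le> 2 * norm ((g n x)\<^sup>2 + (u x)\<^sup>2)" by simp
  qed
  have lim1: "(\<lambda>n. ip M (\<lambda>x. g n x * \<theta> x) (\<lambda>x. ?G x $ j)) \<longlonglongrightarrow> (\<integral>x. u x * ?G x $ j * \<theta> x \<partial>M)"
  proof -
    have "norm (ip M (\<lambda>x. g n x * \<theta> x) (\<lambda>x. ?G x $ j) - (\<integral>x. u x * ?G x $ j * \<theta> x \<partial>M)) \<le>
        sqrt (nrm M (\<lambda>x. (g n x - u x)\<^sup>2)) * nrm M (\<lambda>x. ?G x $ j) * sqrt (nrm M (\<lambda>x. (\<theta> x)\<^sup>2))" for n
    proof -
      have "ip M (\<lambda>x. g n x * \<theta> x) (\<lambda>x. ?G x $ j) = (\<integral>x. g n x * ?G x $ j * \<theta> x \<partial>M)"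
        unfolding ip_def by (simp add: mult_ac)
      then have "ip M (\<lambda>x. g n x * \<theta> x) (\<lambda>x. ?G x $ j) - (\<integral>x. u x * ?G x $ j * \<theta> x \<partial>M)
          = (\<integral>x. g n x * ?G x $ j * \<theta> x - u x * ?G x $ j * \<theta> x \<partial>M)"
        using triple_product(1)[OF g_m sg4 t_m \<theta>4 Gj, of n] triple_product(1)[OF u_m u4 t_m \<theta>4 Gj] by simp
      also have "\<dots> = (\<integral>x. (g n x - u x) * ?G x $ j * \<theta> x \<partial>M)" by (simp add: algebra_simps)
      finally show ?thesis
        using triple_product(2)[OF borel_measurable_diff[OF g_m u_m] d4 t_m \<theta>4 Gj, of n] by simp
    qed
    moreover have "(\<lambda>n. sqrt (nrm M (\<lambda>x. (g n x - u x)\<^sup>2)) * nrm M (\<lambda>x. ?G x $ j) * sqrt (nrm M (\<lambda>x. (\<theta> x)\<^sup>2)))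
        \<longlonglongrightarrow> sqrt 0 * nrm M (\<lambda>x. ?G x $ j) * sqrt (nrm M (\<lambda>x. (\<theta> x)\<^sup>2))"
      by (intro tendsto_intros L4)
    ultimately have "(\<lambda>n. ip M (\<lambda>x. g n x * \<theta> x) (\<lambda>x. ?G x $ j) - (\<integral>x. u x * ?G x $ j * \<theta> x \<partial>M)) \<longlonglongrightarrow> 0"
      by (rule_tac Lim_null_comparison[rotated]) auto
    then show ?thesis by (simp add: LIM_zero_cancel)
  qed
  have limj: "(\<lambda>n. nrm M (\<lambda>x. partial j (g n) x - ?U x $ j)) \<longlonglongrightarrow> 0"
  proof (rule tendsto_sandwich[OF _ _ tendsto_const gU])
    show "\<forall>\<^sub>F n in sequentially. nrm M (\<lambda>x. partial j (g n) x - ?U x $ j) \<le> nrm M (\<lambda>x. grad (g n) x - ?U x)"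
      using nrm_component_le[OF sq_int_diff[OF grad_sq_int[OF g] s(2)], of _ j] by simp
  qed simp
  have "(\<lambda>n. ip M (partial j (g n)) (\<lambda>x. (\<theta> x)\<^sup>2)) \<longlonglongrightarrow> ip M (\<lambda>x. ?U x $ j) (\<lambda>x. (\<theta> x)\<^sup>2)"
    by (rule ip_tendsto[OF partial_sq_int[OF g] Uj limj \<theta>4 \<theta>4]) (simp add: nrm_def)
  then have lim2: "(\<lambda>n. ip M (\<lambda>x. partial j (g n) x * \<theta> x) \<theta>) \<longlonglongrightarrow> (\<integral>x. ?U x $ j * (\<theta> x)\<^sup>2 \<partial>M)"
    by (simp add: ip_def power2_eq_square mult.assoc)
  have "(\<lambda>n. 2 * ip M (\<lambda>x. g n x * \<theta> x) (\<lambda>x. ?G x $ j) + ip M (\<lambda>x. partial j (g n) x * \<theta> x) \<theta>) \<longlonglongrightarrow>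
      2 * (\<integral>x. u x * ?G x $ j * \<theta> x \<partial>M) + (\<integral>x. ?U x $ j * (\<theta> x)\<^sup>2 \<partial>M)"
    by (intro tendsto_intros lim1 lim2)
  then have "(\<lambda>n::nat. 0) \<longlonglongrightarrow> 2 * (\<integral>x. u x * ?G x $ j * \<theta> x \<partial>M) + (\<integral>x. ?U x $ j * (\<theta> x)\<^sup>2 \<partial>M)"
    unfolding transport_identity_smooth[OF g b] .
  then show ?thesis by (rule LIMSEQ_unique[OF _ tendsto_const])
qed

end

section \<open>The energy space and the transport forms\<close>

lemma ip_cong_AE:
  assumes "f \<in> borel_measurable M" "f' \<in> borel_measurable M" "g \<in> borel_measurable M"
    and "AE x in M. f x = f' x"
  shows "ip M f g = ip M f' g"
  unfolding ip_def
proof (rule integral_cong_AE)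
  show "AE x in M. f x \<bullet> g x = f' x \<bullet> g x" using assms(4) by eventually_elim simp
qed (intro borel_measurable_inner assms)+

text \<open>The dual norm is a supremum of reals and says something only for a set bounded above;
  membership in the dual space supplies this. Functions of norm zero cannot be normalised and are
  covered by the same boundedness.\<close>

lemma dual_norm_bound:
  fixes Y :: "('a \<Rightarrow> 'b::real_vector) set"
  assumes g: "g \<in> dual_space Y n" and \<phi>: "\<phi> \<in> Y"
    and scale: "\<And>c \<phi>. \<phi> \<in> Y \<Longrightarrow> (\<lambda>x. c *\<^sub>R \<phi> x) \<in> Y" "\<And>c \<phi>. \<phi> \<in> Y \<Longrightarrow> n (\<lambda>x. c *\<^sub>R \<phi> x) = \<bar>c\<bar> * n \<phi>"
    and nonneg: "\<And>\<phi>. \<phi> \<in> Y \<Longrightarrow> 0 \<le> n \<phi>"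
  shows "\<bar>g \<phi>\<bar> \<le> dual_norm Y n g * n \<phi>"
proof -
  have "\<exists>C. \<forall>\<phi>\<in>Y. \<bar>g \<phi>\<bar> \<le> C * n \<phi>" using g unfolding dual_space_def by blast
  then obtain C where C: "\<And>\<phi>. \<phi> \<in> Y \<Longrightarrow> \<bar>g \<phi>\<bar> \<le> C * n \<phi>" by blast
  have bdd: "bdd_above ((\<lambda>\<phi>. \<bar>g \<phi>\<bar>) ` {\<phi> \<in> Y. n \<phi> \<le> 1})"
  proof (rule bdd_aboveI2)
    fix \<phi> assume "\<phi> \<in> {\<phi> \<in> Y. n \<phi> \<le> 1}"
    then have *: "\<phi> \<in> Y" "n \<phi> \<le> 1" by auto
    have "\<bar>g \<phi>\<bar> \<le> C * n \<phi>" by (rule C[OF *(1)])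
    also have "\<dots> \<le> \<bar>C\<bar> * n \<phi>" using nonneg[OF *(1)] by (intro mult_right_mono) auto
    also have "\<dots> \<le> \<bar>C\<bar> * 1" using *(2) by (intro mult_left_mono) auto
    finally show "\<bar>g \<phi>\<bar> \<le> \<bar>C\<bar>" by simp
  qed
  show ?thesis
  proof (cases "n \<phi> = 0")
    case True
    then show ?thesis using C[OF \<phi>] by simp
  next
    case False
    then have pos: "0 < n \<phi>" using nonneg[OF \<phi>] by simp
    let ?p = "\<lambda>x. (1 / n \<phi>) *\<^sub>R \<phi> x"
    have "?p \<in> {\<phi> \<in> Y. n \<phi> \<le> 1}" using scale[OF \<phi>, of "1 / n \<phi>"] pos by simp
    then have "\<bar>g ?p\<bar> \<le> dual_norm Y n g" unfolding dual_norm_def by (rule cSUP_upper[OF _ bdd])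
    moreover have "g ?p = (1 / n \<phi>) * g \<phi>" using g \<phi> unfolding dual_space_def by blast
    ultimately show ?thesis using pos by (simp add: field_simps)
  qed
qed

context bounded_domain
begin

text \<open>Fixing one embedding constant per domain lets the smallness hypotheses of the later
  locale refer to it.\<close>

definition emb :: real where
  "emb = (SOME C. C \<ge> 1 \<and> (\<forall>u\<in>H10 \<Omega>. nrm M u \<le> C * h10_norm \<Omega> u \<and> (\<lambda>x. (u x)\<^sup>2) \<in> sq_int M \<and>
     nrm M (\<lambda>x. (u x)\<^sup>2) \<le> (C * h10_norm \<Omega> u)\<^sup>2))"

lemma emb: "emb \<ge> 1 \<and> (\<forall>u\<in>H10 \<Omega>. nrm M u \<le> emb * h10_norm \<Omega> u \<and> (\<lambda>x. (u x)\<^sup>2) \<in> sq_int M \<and>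
     nrm M (\<lambda>x. (u x)\<^sup>2) \<le> (emb * h10_norm \<Omega> u)\<^sup>2)"
  unfolding emb_def by (rule someI_ex[OF H10_embedding])

lemma h10_nonneg [simp]: "0 \<le> h10_norm \<Omega> u"
  by (simp add: h10_norm_eq)

lemma H10_sq_int: "u \<in> H10 \<Omega> \<Longrightarrow> u \<in> sq_int M"
  by (intro H1_sq_int H10_H1)

lemma H10_measurable: "u \<in> H10 \<Omega> \<Longrightarrow> u \<in> borel_measurable M"
  by (intro sq_int_measurable H10_sq_int)

definition energy :: "(real^2 \<Rightarrow> real) \<Rightarrow> (real^2 \<Rightarrow> real) \<Rightarrow> real" where
  "energy u w = ip M (wgrad \<Omega> u) (wgrad \<Omega> w)"

lemma energy_commute: "energy u w = energy w u"
  by (simp add: energy_def ip_commute)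

lemma energy_self: "energy u u = (h10_norm \<Omega> u)\<^sup>2"
  by (simp add: energy_def h10_norm_eq nrm_sq ip_def power2_norm_eq_inner)

lemma energy_add:
  assumes "u \<in> H1 \<Omega>" "w \<in> H1 \<Omega>" "z \<in> H1 \<Omega>"
  shows "energy (\<lambda>x. u x + w x) z = energy u z + energy w z"
proof -
  have "energy (\<lambda>x. u x + w x) z = ip M (\<lambda>x. wgrad \<Omega> u x + wgrad \<Omega> w x) (wgrad \<Omega> z)"
    unfolding energy_def using assms
    by (intro ip_cong_AE sq_int_measurable sq_int_add wgrad_sq_int H1_add wgrad_add)
  also have "\<dots> = energy u z + energy w z"
    unfolding energy_def using assms by (intro ip_add_left wgrad_sq_int)
  finally show ?thesis .
qed

lemma energy_scale:
  assumes "u \<in> H1 \<Omega>" "z \<in> H1 \<Omega>"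
  shows "energy (\<lambda>x. c * u x) z = c * energy u z"
proof -
  have "energy (\<lambda>x. c * u x) z = ip M (\<lambda>x. c *\<^sub>R wgrad \<Omega> u x) (wgrad \<Omega> z)"
    unfolding energy_def using assms
    by (intro ip_cong_AE sq_int_measurable sq_int_scaleR wgrad_sq_int H1_scale wgrad_scale)
  then show ?thesis by (simp add: ip_scaleR_left energy_def)
qed

lemma energy_bound: "u \<in> H1 \<Omega> \<Longrightarrow> w \<in> H1 \<Omega> \<Longrightarrow> \<bar>energy u w\<bar> \<le> nrm M (wgrad \<Omega> u) * nrm M (wgrad \<Omega> w)"
  unfolding energy_def by (intro ip_Cauchy_Schwarz wgrad_sq_int)

text \<open>The scalar building block of both transport terms. The outer arguments are taken from
  \<open>H10\<close>, for the sake of L4, but the middle one only from \<open>H1\<close>, so that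
  the boundary datum can be inserted there.\<close>

definition tri :: "2 \<Rightarrow> (real^2 \<Rightarrow> real) \<Rightarrow> (real^2 \<Rightarrow> real) \<Rightarrow> (real^2 \<Rightarrow> real) \<Rightarrow> real" where
  "tri i u \<tau> \<psi> = (\<integral>x. u x * wgrad \<Omega> \<tau> x $ i * \<psi> x \<partial>M)"

lemma wgrad_component: "\<tau> \<in> H1 \<Omega> \<Longrightarrow> (\<lambda>x. wgrad \<Omega> \<tau> x $ i) \<in> sq_int M"
  using wgrad_sq_int by (simp add: sq_int_vec_iff)

lemma tri_integrable:
  assumes "u \<in> H10 \<Omega>" "\<tau> \<in> H1 \<Omega>" "\<psi> \<in> H10 \<Omega>"
  shows "integrable M (\<lambda>x. u x * wgrad \<Omega> \<tau> x $ i * \<psi> x)"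
  using assms emb by (intro triple_product(1) H10_measurable wgrad_component) auto

lemma tri_bound:
  assumes "u \<in> H10 \<Omega>" "\<tau> \<in> H1 \<Omega>" "\<psi> \<in> H10 \<Omega>"
  shows "\<bar>tri i u \<tau> \<psi>\<bar> \<le> emb\<^sup>2 * (h10_norm \<Omega> u * nrm M (wgrad \<Omega> \<tau>) * h10_norm \<Omega> \<psi>)"
proof -
  have e: "0 \<le> emb" using emb by linarith
  have s: "sqrt (nrm M (\<lambda>x. (u x)\<^sup>2)) \<le> emb * h10_norm \<Omega> u" if "u \<in> H10 \<Omega>" for u
    using emb that e by (intro real_le_lsqrt) auto
  have "\<bar>tri i u \<tau> \<psi>\<bar> \<le> sqrt (nrm M (\<lambda>x. (u x)\<^sup>2)) * nrm M (\<lambda>x. wgrad \<Omega> \<tau> x $ i) * sqrt (nrm M (\<lambda>x. (\<psi> x)\<^sup>2))"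
    unfolding tri_def using assms emb by (intro triple_product(2) H10_measurable wgrad_component) auto
  also have "\<dots> \<le> (emb * h10_norm \<Omega> u) * nrm M (wgrad \<Omega> \<tau>) * (emb * h10_norm \<Omega> \<psi>)"
    using e nrm_component_le[OF wgrad_sq_int[OF assms(2)]]
    by (intro mult_mono s assms mult_nonneg_nonneg) auto
  finally show ?thesis by (simp add: power2_eq_square mult_ac)
qed

lemma tri_diff1:
  assumes "u \<in> H10 \<Omega>" "u' \<in> H10 \<Omega>" "\<tau> \<in> H1 \<Omega>" "\<psi> \<in> H10 \<Omega>"
  shows "tri i (\<lambda>x. u x - u' x) \<tau> \<psi> = tri i u \<tau> \<psi> - tri i u' \<tau> \<psi>"
  unfolding tri_def using tri_integrable[of u \<tau> \<psi> i] tri_integrable[of u' \<tau> \<psi> i] assms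
  by (simp add: left_diff_distrib)

lemma tri_diff2:
  assumes "u \<in> H10 \<Omega>" "\<tau> \<in> H1 \<Omega>" "\<tau>' \<in> H1 \<Omega>" "\<psi> \<in> H10 \<Omega>"
  shows "tri i u (\<lambda>x. \<tau> x - \<tau>' x) \<psi> = tri i u \<tau> \<psi> - tri i u \<tau>' \<psi>"
proof -
  have "tri i u (\<lambda>x. \<tau> x - \<tau>' x) \<psi> = (\<integral>x. u x * wgrad \<Omega> \<tau> x $ i * \<psi> x - u x * wgrad \<Omega> \<tau>' x $ i * \<psi> x \<partial>M)"
    unfolding tri_def
  proof (rule integral_cong_AE)
    show "AE x in M. u x * wgrad \<Omega> (\<lambda>x. \<tau> x - \<tau>' x) x $ i * \<psi> x = u x * wgrad \<Omega> \<tau> x $ i * \<psi> x - u x * wgrad \<Omega> \<tau>' x $ i * \<psi> x"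
      using wgrad_diff[OF assms(2,3)] by eventually_elim (simp add: left_diff_distrib right_diff_distrib)
  qed (use assms in \<open>auto intro!: borel_measurable_diff borel_measurable_integrable tri_integrable H1_diff\<close>)
  then show ?thesis
    unfolding tri_def using tri_integrable[of u \<tau> \<psi> i] tri_integrable[of u \<tau>' \<psi> i] assms by simp
qed

lemma tri_add3:
  assumes "u \<in> H10 \<Omega>" "\<tau> \<in> H1 \<Omega>" "\<psi> \<in> H10 \<Omega>" "\<psi>' \<in> H10 \<Omega>"
  shows "tri i u \<tau> (\<lambda>x. \<psi> x + \<psi>' x) = tri i u \<tau> \<psi> + tri i u \<tau> \<psi>'"
  unfolding tri_def using tri_integrable[of u \<tau> \<psi> i] tri_integrable[of u \<tau> \<psi>' i] assms
  by (simp add: distrib_left)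

lemma tri_scale3: "tri i u \<tau> (\<lambda>x. c * \<psi> x) = c * tri i u \<tau> \<psi>"
  unfolding tri_def by (subst integral_mult_right_zero[symmetric]) (simp add: mult_ac)

lemma V_iff: "v \<in> V \<Omega> \<longleftrightarrow> (\<forall>j. (\<lambda>x. v x $ j) \<in> H10 \<Omega>) \<and>
    (AE x in M. (\<Sum>i\<in>UNIV. wgrad \<Omega> (\<lambda>y. v y $ i) x $ i) = 0)"
  by (auto simp: V_def H10_def wjac_def)

lemma V_comp: "v \<in> V \<Omega> \<Longrightarrow> (\<lambda>x. v x $ j) \<in> H10 \<Omega>"
  by (simp add: V_iff)

lemma V_comp_H1: "v \<in> V \<Omega> \<Longrightarrow> (\<lambda>x. v x $ j) \<in> H1 \<Omega>"
  by (intro H10_H1 V_comp)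

lemma V_add:
  assumes v: "v \<in> V \<Omega>" and w: "w \<in> V \<Omega>"
  shows "(\<lambda>x. v x + w x) \<in> V \<Omega>"
  unfolding V_iff
proof (intro conjI allI)
  show "(\<lambda>x. (v x + w x) $ j) \<in> H10 \<Omega>" for j using H10_add[OF V_comp[OF v] V_comp[OF w]] by simp
  have "AE x in M. \<forall>i. wgrad \<Omega> (\<lambda>y. v y $ i + w y $ i) x = wgrad \<Omega> (\<lambda>y. v y $ i) x + wgrad \<Omega> (\<lambda>y. w y $ i) x"
    using wgrad_add[OF V_comp_H1[OF v] V_comp_H1[OF w]] by (simp add: AE_all_countable)
  moreover have "AE x in M. (\<Sum>i\<in>UNIV. wgrad \<Omega> (\<lambda>y. v y $ i) x $ i) = 0"
    "AE x in M. (\<Sum>i\<in>UNIV. wgrad \<Omega> (\<lambda>y. w y $ i) x $ i) = 0" using v w by (auto simp: V_iff)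
  ultimately show "AE x in M. (\<Sum>i\<in>UNIV. wgrad \<Omega> (\<lambda>y. (v y + w y) $ i) x $ i) = 0"
    by eventually_elim (simp add: sum.distrib)
qed

lemma V_scale:
  assumes v: "v \<in> V \<Omega>"
  shows "(\<lambda>x. c *\<^sub>R v x) \<in> V \<Omega>"
  unfolding V_iff
proof (intro conjI allI)
  show "(\<lambda>x. (c *\<^sub>R v x) $ j) \<in> H10 \<Omega>" for j using H10_scale[OF V_comp[OF v]] by simp
  have "AE x in M. \<forall>i. wgrad \<Omega> (\<lambda>y. c * v y $ i) x = c *\<^sub>R wgrad \<Omega> (\<lambda>y. v y $ i) x"
    using wgrad_scale[OF V_comp_H1[OF v]] by (simp add: AE_all_countable)
  moreover have "AE x in M. (\<Sum>i\<in>UNIV. wgrad \<Omega> (\<lambda>y. v y $ i) x $ i) = 0" using v by (simp add: V_iff)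
  ultimately show "AE x in M. (\<Sum>i\<in>UNIV. wgrad \<Omega> (\<lambda>y. (c *\<^sub>R v y) $ i) x $ i) = 0"
    by eventually_elim (simp add: sum_distrib_left[symmetric])
qed

lemma V_zero: "(\<lambda>x. 0) \<in> V \<Omega>"
proof -
  have "AE x in M. wgrad \<Omega> (\<lambda>y. 0) x = 0" using wgrad_scale[OF H10_H1[OF H10_zero], of 0] by simp
  then have "AE x in M. (\<Sum>i\<in>UNIV. wgrad \<Omega> (\<lambda>y. (0 :: real^2) $ i) x $ i) = 0" by eventually_elim simp
  then show ?thesis by (simp add: V_iff H10_zero)
qed

section \<open>The product space of velocities and temperatures\<close>

definition addP :: "(real^2 \<Rightarrow> real^2) \<times> (real^2 \<Rightarrow> real) \<Rightarrow> (real^2 \<Rightarrow> real^2) \<times> (real^2 \<Rightarrow> real)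
    \<Rightarrow> (real^2 \<Rightarrow> real^2) \<times> (real^2 \<Rightarrow> real)" where
  "addP U W = (\<lambda>x. fst U x + fst W x, \<lambda>x. snd U x + snd W x)"

definition smulP :: "real \<Rightarrow> (real^2 \<Rightarrow> real^2) \<times> (real^2 \<Rightarrow> real) \<Rightarrow> (real^2 \<Rightarrow> real^2) \<times> (real^2 \<Rightarrow> real)" where
  "smulP c U = (\<lambda>x. c *\<^sub>R fst U x, \<lambda>x. c * snd U x)"

definition formP :: "(real^2 \<Rightarrow> real^2) \<times> (real^2 \<Rightarrow> real) \<Rightarrow> (real^2 \<Rightarrow> real^2) \<times> (real^2 \<Rightarrow> real) \<Rightarrow> real" where
  "formP U W = (\<Sum>j\<in>UNIV. energy (\<lambda>x. fst U x $ j) (\<lambda>x. fst W x $ j)) + energy (snd U) (snd W)"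

sublocale E: form_space "V \<Omega> \<times> H10 \<Omega>" addP smulP formP
proof
  show "V \<Omega> \<times> H10 \<Omega> \<noteq> {}" using V_zero H10_zero by auto
  fix U W Z :: "(real^2 \<Rightarrow> real^2) \<times> (real^2 \<Rightarrow> real)" and c :: real
  assume U: "U \<in> V \<Omega> \<times> H10 \<Omega>"
  then have U': "fst U \<in> V \<Omega>" "snd U \<in> H10 \<Omega>" by auto
  show "smulP c U \<in> V \<Omega> \<times> H10 \<Omega>" using U' by (simp add: smulP_def V_scale H10_scale)
  show "0 \<le> formP U U" by (simp add: formP_def energy_self sum_nonneg)
  assume W: "W \<in> V \<Omega> \<times> H10 \<Omega>"
  then have W': "fst W \<in> V \<Omega>" "snd W \<in> H10 \<Omega>" by auto
  show "addP U W \<in> V \<Omega> \<times> H10 \<Omega>" using U' W' by (simp add: addP_def V_add H10_add)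
  show "formP U W = formP W U" by (simp add: formP_def energy_commute[of "snd U"] energy_commute[of "\<lambda>x. fst U x $ _"])
  show "formP (smulP c U) W = c * formP U W"
    using U' W' by (simp add: formP_def smulP_def energy_scale V_comp_H1 H10_H1 sum_distrib_left distrib_left)
  assume Z: "Z \<in> V \<Omega> \<times> H10 \<Omega>"
  then have Z': "fst Z \<in> V \<Omega>" "snd Z \<in> H10 \<Omega>" by auto
  show "formP (addP U W) Z = formP U Z + formP W Z"
    using U' W' Z' by (simp add: formP_def addP_def energy_add V_comp_H1 H10_H1 sum.distrib)
qed

lemma sub_comp:
  "(\<lambda>x. fst (E.sub U W) x $ j) = (\<lambda>x. fst U x $ j - fst W x $ j)"
  "snd (E.sub U W) = (\<lambda>x. snd U x - snd W x)"
  by (auto simp: E.sub_def addP_def smulP_def)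

lemma N_sq_eq: "(E.N U)\<^sup>2 = (\<Sum>j\<in>UNIV. (h10_norm \<Omega> (\<lambda>x. fst U x $ j))\<^sup>2) + (h10_norm \<Omega> (snd U))\<^sup>2"
  by (simp add: E.N_def formP_def energy_self sum_nonneg)

lemma N_nonneg' [simp]: "0 \<le> E.N U"
  by (simp add: E.N_def formP_def energy_self sum_nonneg)

lemma comp_le_N: "h10_norm \<Omega> (\<lambda>x. fst U x $ j) \<le> E.N U" "h10_norm \<Omega> (snd U) \<le> E.N U"
proof -
  have "(h10_norm \<Omega> (\<lambda>x. fst U x $ j))\<^sup>2 \<le> (\<Sum>j\<in>UNIV. (h10_norm \<Omega> (\<lambda>x. fst U x $ j))\<^sup>2)"
    by (rule member_le_sum) auto
  then have "(h10_norm \<Omega> (\<lambda>x. fst U x $ j))\<^sup>2 \<le> (E.N U)\<^sup>2" "(h10_norm \<Omega> (snd U))\<^sup>2 \<le> (E.N U)\<^sup>2"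
    unfolding N_sq_eq by (auto intro: add_increasing2 add_increasing sum_nonneg)
  then show "h10_norm \<Omega> (\<lambda>x. fst U x $ j) \<le> E.N U" "h10_norm \<Omega> (snd U) \<le> E.N U"
    by (auto elim!: power2_le_imp_le)
qed

text \<open>Each component converges by \<open>H10_complete\<close>. The constraint survives because
  the divergence depends continuously on the gradients.\<close>

lemma complete_energy: "E.complete_form"
  unfolding E.complete_form_def
proof (intro allI impI)
  fix s :: "nat \<Rightarrow> (real^2 \<Rightarrow> real^2) \<times> (real^2 \<Rightarrow> real)"
  assume rs: "range s \<subseteq> V \<Omega> \<times> H10 \<Omega>"
    and cauchy: "\<forall>e>0. \<exists>K. \<forall>m\<ge>K. \<forall>n\<ge>K. E.N (E.sub (s m) (s n)) < e"
  have sV: "fst (s n) \<in> V \<Omega>" and sH: "snd (s n) \<in> H10 \<Omega>" for n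
    using rs by (metis mem_Times_iff rangeI subsetD)+
  have 1: "\<exists>u\<in>H10 \<Omega>. (\<lambda>n. nrm M (\<lambda>x. wgrad \<Omega> (\<lambda>x. fst (s n) x $ j) x - wgrad \<Omega> u x)) \<longlonglongrightarrow> 0" for j
  proof (rule H10_complete[OF V_comp[OF sV]])
    fix e :: real assume "e > 0"
    then obtain K where K: "\<And>m n. m \<ge> K \<Longrightarrow> n \<ge> K \<Longrightarrow> E.N (E.sub (s m) (s n)) < e" using cauchy by blast
    have "nrm M (\<lambda>x. wgrad \<Omega> (\<lambda>x. fst (s m) x $ j) x - wgrad \<Omega> (\<lambda>x. fst (s n) x $ j) x) < e" if "m \<ge> K" "n \<ge> K" for m n
      using K[OF that] comp_le_N(1)[of "E.sub (s m) (s n)" j] h10_norm_diff[OF V_comp[OF sV] V_comp[OF sV], of m j n j]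
      by (simp add: sub_comp)
    then show "\<exists>K. \<forall>m\<ge>K. \<forall>n\<ge>K. nrm M (\<lambda>x. wgrad \<Omega> (\<lambda>x. fst (s m) x $ j) x - wgrad \<Omega> (\<lambda>x. fst (s n) x $ j) x) < e"
      by blast
  qed
  have "\<exists>u\<in>H10 \<Omega>. (\<lambda>n. nrm M (\<lambda>x. wgrad \<Omega> (snd (s n)) x - wgrad \<Omega> u x)) \<longlonglongrightarrow> 0"
  proof (rule H10_complete[OF sH])
    fix e :: real assume "e > 0"
    then obtain K where K: "\<And>m n. m \<ge> K \<Longrightarrow> n \<ge> K \<Longrightarrow> E.N (E.sub (s m) (s n)) < e" using cauchy by blast
    have "nrm M (\<lambda>x. wgrad \<Omega> (snd (s m)) x - wgrad \<Omega> (snd (s n)) x) < e" if "m \<ge> K" "n \<ge> K" for m n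
      using K[OF that] comp_le_N(2)[of "E.sub (s m) (s n)"] h10_norm_diff[OF sH sH, of m n]
      by (simp add: sub_comp)
    then show "\<exists>K. \<forall>m\<ge>K. \<forall>n\<ge>K. nrm M (\<lambda>x. wgrad \<Omega> (snd (s m)) x - wgrad \<Omega> (snd (s n)) x) < e"
      by blast
  qed
  then obtain \<theta> where \<theta>: "\<theta> \<in> H10 \<Omega>" and lim\<theta>: "(\<lambda>n. nrm M (\<lambda>x. wgrad \<Omega> (snd (s n)) x - wgrad \<Omega> \<theta> x)) \<longlonglongrightarrow> 0"
    by blast
  define P where "P j w \<longleftrightarrow> w \<in> H10 \<Omega> \<and>
    (\<lambda>n. nrm M (\<lambda>x. wgrad \<Omega> (\<lambda>x. fst (s n) x $ j) x - wgrad \<Omega> w x)) \<longlonglongrightarrow> 0" for j w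
  have "\<exists>w. P j w" for j using 1[of j] unfolding P_def Bex_def .
  then obtain u where u: "\<And>j. P j (u j)" by metis
  define v where "v x = (\<chi> j. u j x)" for x
  have vj: "(\<lambda>x. v x $ j) = u j" for j by (auto simp: v_def)
  have uH: "u j \<in> H10 \<Omega>" and limu: "(\<lambda>n. nrm M (\<lambda>x. wgrad \<Omega> (\<lambda>x. fst (s n) x $ j) x - wgrad \<Omega> (u j) x)) \<longlonglongrightarrow> 0" for j
    using u[of j] by (simp_all add: P_def)
  define d where "d x = (\<Sum>i\<in>UNIV. wgrad \<Omega> (u i) x $ i)" for x
  have d: "d \<in> sq_int M"
    unfolding d_def UNIV_2 using wgrad_component[OF H10_H1[OF uH]] by (simp add: sq_int_add)
  \<comment> \<open>The members of the sequence have zero divergence, so the divergence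
    \<open>d\<close> of the limit is, up to sign, that of the difference and is bounded by the
    distances of the gradients.\<close>
  have dle: "nrm M d \<le> (\<Sum>i\<in>UNIV. nrm M (\<lambda>x. wgrad \<Omega> (\<lambda>x. fst (s n) x $ i) x - wgrad \<Omega> (u i) x))" for n
  proof -
    let ?D = "\<lambda>i x. wgrad \<Omega> (\<lambda>x. fst (s n) x $ i) x - wgrad \<Omega> (u i) x"
    have D: "?D i \<in> sq_int M" for i by (intro sq_int_diff wgrad_sq_int H10_H1 V_comp sV uH)
    then have Di: "(\<lambda>x. ?D i x $ j) \<in> sq_int M" for i j unfolding sq_int_vec_iff by blast
    have "AE x in M. (\<Sum>i\<in>UNIV. wgrad \<Omega> (\<lambda>y. fst (s n) y $ i) x $ i) = 0" using sV[of n] by (simp add: V_iff)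
    then have "AE x in M. norm (d x) \<le> 1 * norm (?D 1 x $ 1 + ?D 2 x $ 2)"
      by eventually_elim (simp add: d_def UNIV_2)
    then have "nrm M d \<le> 1 * nrm M (\<lambda>x. ?D 1 x $ 1 + ?D 2 x $ 2)"
      by (intro nrm_mono sq_int_add Di sq_int_measurable d) auto
    also have "\<dots> \<le> nrm M (\<lambda>x. ?D 1 x $ 1) + nrm M (\<lambda>x. ?D 2 x $ 2)" using nrm_add[OF Di Di] by simp
    also have "\<dots> \<le> nrm M (?D 1) + nrm M (?D 2)" by (intro add_mono nrm_component_le D)
    finally show ?thesis by (simp add: UNIV_2)
  qed
  have "(\<lambda>n. \<Sum>i\<in>UNIV. nrm M (\<lambda>x. wgrad \<Omega> (\<lambda>x. fst (s n) x $ i) x - wgrad \<Omega> (u i) x)) \<longlonglongrightarrow> (\<Sum>i\<in>(UNIV::2 set). 0)"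
    by (intro tendsto_sum limu)
  then have "nrm M d \<le> 0" using dle by (intro LIMSEQ_le_const[of _ 0]) auto
  then have "nrm M d = 0" using nrm_nonneg[of M d] by linarith
  then have "AE x in M. d x = 0" by (rule nrm_eq_0_AE[OF d])
  then have vV: "v \<in> V \<Omega>" unfolding V_iff vj using uH by (simp add: d_def)
  have "(\<lambda>n. E.N (E.sub (s n) (v, \<theta>))) \<longlonglongrightarrow> sqrt ((\<Sum>j\<in>(UNIV::2 set). 0\<^sup>2) + 0\<^sup>2)"
  proof -
    have "E.N (E.sub (s n) (v, \<theta>)) = sqrt ((\<Sum>j\<in>UNIV. (nrm M (\<lambda>x. wgrad \<Omega> (\<lambda>x. fst (s n) x $ j) x - wgrad \<Omega> (u j) x))\<^sup>2)
        + (nrm M (\<lambda>x. wgrad \<Omega> (snd (s n)) x - wgrad \<Omega> \<theta> x))\<^sup>2)" for n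
    proof -
      have h: "h10_norm \<Omega> (\<lambda>x. fst (s n) x $ j - v x $ j) = nrm M (\<lambda>x. wgrad \<Omega> (\<lambda>x. fst (s n) x $ j) x - wgrad \<Omega> (u j) x)" for j
        using h10_norm_diff[OF V_comp[OF sV] V_comp[OF vV], of n j j] by (simp only: vj)
      have "E.N (E.sub (s n) (v, \<theta>)) = sqrt ((E.N (E.sub (s n) (v, \<theta>)))\<^sup>2)" by simp
      then show ?thesis unfolding N_sq_eq sub_comp by (simp only: fst_conv snd_conv h h10_norm_diff[OF sH \<theta>])
    qed
    then show ?thesis by (simp only:) (intro tendsto_intros limu lim\<theta>)
  qed
  then have "(\<lambda>n. E.N (E.sub (s n) (v, \<theta>))) \<longlonglongrightarrow> 0" by simp
  then show "\<exists>l\<in>V \<Omega> \<times> H10 \<Omega>. (\<lambda>n. E.N (E.sub (s n) l)) \<longlonglongrightarrow> 0"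
    using vV \<theta> by (intro bexI[of _ "(v, \<theta>)"]) auto
qed

section \<open>Transport forms, norms and dual bounds\<close>

definition conv_v :: "(real^2 \<Rightarrow> real^2) \<Rightarrow> (real^2 \<Rightarrow> real^2) \<Rightarrow> (real^2 \<Rightarrow> real^2) \<Rightarrow> real" where
  "conv_v v w \<phi> = (\<Sum>k\<in>UNIV. \<Sum>i\<in>UNIV. tri i (\<lambda>x. v x $ i) (\<lambda>x. w x $ k) (\<lambda>x. \<phi> x $ k))"

definition conv_t :: "(real^2 \<Rightarrow> real^2) \<Rightarrow> (real^2 \<Rightarrow> real) \<Rightarrow> (real^2 \<Rightarrow> real) \<Rightarrow> real" where
  "conv_t v \<tau> \<psi> = (\<Sum>i\<in>UNIV. tri i (\<lambda>x. v x $ i) \<tau> \<psi>)"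

lemma conv_v_integral:
  assumes "v \<in> V \<Omega>" "w \<in> V \<Omega>" "\<phi> \<in> V \<Omega>"
  shows "(\<integral>x. (wjac \<Omega> w x *v v x) \<bullet> \<phi> x \<partial>M) = conv_v v w \<phi>"
proof -
  have "(wjac \<Omega> w x *v v x) \<bullet> \<phi> x =
      (\<Sum>k\<in>UNIV. \<Sum>i\<in>UNIV. v x $ i * wgrad \<Omega> (\<lambda>x. w x $ k) x $ i * \<phi> x $ k)" for x
    by (simp add: inner_vec_def matrix_vector_mult_def wjac_def sum_distrib_left mult_ac)
  then show ?thesis unfolding conv_v_def tri_def
    using assms by (simp add: Bochner_Integration.integral_sum Bochner_Integration.integrable_sum tri_integrable V_comp V_comp_H1)
qed

lemma conv_t_integral:
  assumes "v \<in> V \<Omega>" "\<tau> \<in> H1 \<Omega>" "\<psi> \<in> H10 \<Omega>"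
  shows "(\<integral>x. (v x \<bullet> wgrad \<Omega> \<tau> x) * \<psi> x \<partial>M) = conv_t v \<tau> \<psi>"
proof -
  have "(v x \<bullet> wgrad \<Omega> \<tau> x) * \<psi> x = (\<Sum>i\<in>UNIV. v x $ i * wgrad \<Omega> \<tau> x $ i * \<psi> x)" for x
    by (simp add: inner_vec_def sum_distrib_right)
  then show ?thesis unfolding conv_t_def tri_def
    using assms by (simp add: Bochner_Integration.integral_sum tri_integrable V_comp)
qed

lemma energy_v_integral:
  assumes "v \<in> V \<Omega>" "\<phi> \<in> V \<Omega>"
  shows "(\<integral>x. wjac \<Omega> v x \<bullet> wjac \<Omega> \<phi> x \<partial>M) = (\<Sum>j\<in>UNIV. energy (\<lambda>x. v x $ j) (\<lambda>x. \<phi> x $ j))"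
proof -
  have "wjac \<Omega> v x \<bullet> wjac \<Omega> \<phi> x = (\<Sum>j\<in>UNIV. wgrad \<Omega> (\<lambda>x. v x $ j) x \<bullet> wgrad \<Omega> (\<lambda>x. \<phi> x $ j) x)" for x
    by (subst inner_vec_def) (simp add: wjac_def)
  then show ?thesis unfolding energy_def ip_def
    using assms by (simp add: Bochner_Integration.integral_sum sq_int_inner wgrad_sq_int V_comp_H1)
qed

lemma V_norm_sq: "v \<in> V \<Omega> \<Longrightarrow> (V_norm \<Omega> v)\<^sup>2 = (\<Sum>j\<in>UNIV. (h10_norm \<Omega> (\<lambda>x. v x $ j))\<^sup>2)"
  using energy_v_integral[of v v] by (simp add: V_norm_def power2_norm_eq_inner energy_self sum_nonneg)

lemma V_norm_eq: "v \<in> V \<Omega> \<Longrightarrow> V_norm \<Omega> v = sqrt (\<Sum>j\<in>UNIV. (h10_norm \<Omega> (\<lambda>x. v x $ j))\<^sup>2)"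
  using energy_v_integral[of v v] by (simp add: V_norm_def power2_norm_eq_inner energy_self)

lemma h10_norm_scale:
  assumes "u \<in> H10 \<Omega>"
  shows "h10_norm \<Omega> (\<lambda>x. c * u x) = \<bar>c\<bar> * h10_norm \<Omega> u"
proof -
  have u: "u \<in> H1 \<Omega>" using assms by (rule H10_H1)
  have "energy (\<lambda>x. c * u x) (\<lambda>x. c * u x) = c * energy u (\<lambda>x. c * u x)"
    by (rule energy_scale[OF u H1_scale[OF u]])
  also have "energy u (\<lambda>x. c * u x) = c * energy u u"
    unfolding energy_commute[of u "\<lambda>x. c * u x"] by (rule energy_scale[OF u u])
  finally have "(h10_norm \<Omega> (\<lambda>x. c * u x))\<^sup>2 = (\<bar>c\<bar> * h10_norm \<Omega> u)\<^sup>2"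
    unfolding energy_self by (simp add: power_mult_distrib power2_eq_square)
  then show ?thesis by (simp add: power2_eq_iff_nonneg)
qed

lemma V_dual_bound:
  assumes "g \<in> dual_space (V \<Omega>) (V_norm \<Omega>)" "\<phi> \<in> V \<Omega>"
  shows "\<bar>g \<phi>\<bar> \<le> dual_norm (V \<Omega>) (V_norm \<Omega>) g * V_norm \<Omega> \<phi>"
  using assms
proof (rule dual_norm_bound)
  fix \<phi> :: "real^2 \<Rightarrow> real^2" and c :: real assume \<phi>: "\<phi> \<in> V \<Omega>"
  show "(\<lambda>x. c *\<^sub>R \<phi> x) \<in> V \<Omega>" by (rule V_scale[OF \<phi>])
  have "(\<Sum>j\<in>UNIV. (h10_norm \<Omega> (\<lambda>x. c * \<phi> x $ j))\<^sup>2) = c\<^sup>2 * (\<Sum>j\<in>UNIV. (h10_norm \<Omega> (\<lambda>x. \<phi> x $ j))\<^sup>2)"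
    by (simp add: h10_norm_scale[OF V_comp[OF \<phi>]] power_mult_distrib sum_distrib_left)
  then show "V_norm \<Omega> (\<lambda>x. c *\<^sub>R \<phi> x) = \<bar>c\<bar> * V_norm \<Omega> \<phi>"
    using \<phi> by (simp add: V_norm_eq V_scale real_sqrt_mult)
  show "0 \<le> V_norm \<Omega> \<phi>" using \<phi> by (simp add: V_norm_eq sum_nonneg)
qed

lemma H10_dual_bound:
  assumes "g \<in> dual_space (H10 \<Omega>) (h10_norm \<Omega>)" "\<psi> \<in> H10 \<Omega>"
  shows "\<bar>g \<psi>\<bar> \<le> dual_norm (H10 \<Omega>) (h10_norm \<Omega>) g * h10_norm \<Omega> \<psi>"
  using assms by (rule dual_norm_bound) (simp_all add: H10_scale h10_norm_scale)

text \<open>Summing \<open>transport_identity\<close> over both directions leaves twice the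
  transport form plus the integral of the divergence of \<open>v\<close> times
  \<open>\<theta>^2\<close>, and the divergence is zero.\<close>

lemma conv_t_zero:
  assumes v: "v \<in> V \<Omega>" and \<theta>: "\<theta> \<in> H10 \<Omega>"
  shows "conv_t v \<theta> \<theta> = 0"
proof -
  have \<theta>4: "(\<lambda>x. (\<theta> x)\<^sup>2) \<in> sq_int M" using emb \<theta> by blast
  have int: "integrable M (\<lambda>x. wgrad \<Omega> (\<lambda>y. v y $ i) x $ i * (\<theta> x)\<^sup>2)" for i
    by (intro sq_int_mult wgrad_component V_comp_H1 v \<theta>4)
  have "(\<Sum>i\<in>UNIV. \<integral>x. wgrad \<Omega> (\<lambda>y. v y $ i) x $ i * (\<theta> x)\<^sup>2 \<partial>M)
      = (\<integral>x. (\<Sum>i\<in>UNIV. wgrad \<Omega> (\<lambda>y. v y $ i) x $ i * (\<theta> x)\<^sup>2) \<partial>M)"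
    using int by (simp add: Bochner_Integration.integral_sum)
  also have "\<dots> = (\<integral>x. 0 \<partial>M)"
  proof (rule integral_cong_AE)
    have "AE x in M. (\<Sum>i\<in>UNIV. wgrad \<Omega> (\<lambda>y. v y $ i) x $ i) = 0" using v by (simp add: V_iff)
    then show "AE x in M. (\<Sum>i\<in>UNIV. wgrad \<Omega> (\<lambda>y. v y $ i) x $ i * (\<theta> x)\<^sup>2) = 0"
      by eventually_elim (simp add: sum_distrib_right[symmetric])
  qed (use int in \<open>auto intro!: borel_measurable_sum borel_measurable_integrable\<close>)
  finally have "(\<Sum>i\<in>UNIV. \<integral>x. wgrad \<Omega> (\<lambda>y. v y $ i) x $ i * (\<theta> x)\<^sup>2 \<partial>M) = 0" by simp
  moreover have "(\<Sum>i\<in>UNIV. 2 * tri i (\<lambda>x. v x $ i) \<theta> \<theta> + (\<integral>x. wgrad \<Omega> (\<lambda>y. v y $ i) x $ i * (\<theta> x)\<^sup>2 \<partial>M)) = 0"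
    unfolding tri_def using transport_identity[OF V_comp[OF v] \<theta>] by (intro sum.neutral) simp
  ultimately have "2 * conv_t v \<theta> \<theta> = 0"
    by (simp add: conv_t_def sum.distrib sum_distrib_left)
  then show ?thesis by simp
qed

lemma conv_v_conv_t: "conv_v v w \<phi> = (\<Sum>k\<in>UNIV. conv_t v (\<lambda>x. w x $ k) (\<lambda>x. \<phi> x $ k))"
  by (simp add: conv_v_def conv_t_def)

lemma conv_v_zero: "v \<in> V \<Omega> \<Longrightarrow> conv_v v v v = 0"
  by (simp add: conv_v_conv_t conv_t_zero V_comp)

text \<open>The 2 counts the directions; the velocity form, with two components, has twice this
  constant. The bounds \<open>a\<close>, \<open>b\<close>, \<open>c\<close> are parameters so that
  \<open>b\<close> may bound either the gradient of a zero-trace function or that of the boundary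
  datum.\<close>

lemma conv_t_bound:
  assumes v: "v \<in> V \<Omega>" and \<tau>: "\<tau> \<in> H1 \<Omega>" and \<psi>: "\<psi> \<in> H10 \<Omega>"
    and a: "\<And>i. h10_norm \<Omega> (\<lambda>x. v x $ i) \<le> a" and b: "nrm M (wgrad \<Omega> \<tau>) \<le> b" and c: "h10_norm \<Omega> \<psi> \<le> c"
  shows "\<bar>conv_t v \<tau> \<psi>\<bar> \<le> 2 * emb\<^sup>2 * (a * b * c)"
proof -
  have a0: "0 \<le> a" using a[of 1] h10_nonneg order_trans by blast
  have b0: "0 \<le> b" using b nrm_nonneg order_trans by blast
  have "\<bar>tri i (\<lambda>x. v x $ i) \<tau> \<psi>\<bar> \<le> emb\<^sup>2 * (a * b * c)" for i
    using tri_bound[OF V_comp[OF v] \<tau> \<psi>, of i i]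
    by (rule order_trans) (intro mult_left_mono mult_mono a b c mult_nonneg_nonneg a0 b0, auto)
  then have "(\<Sum>i\<in>UNIV. \<bar>tri i (\<lambda>x. v x $ i) \<tau> \<psi>\<bar>) \<le> (\<Sum>i\<in>(UNIV::2 set). emb\<^sup>2 * (a * b * c))" by (intro sum_mono)
  then show ?thesis unfolding conv_t_def by (intro order_trans[OF sum_abs]) (simp add: mult.assoc)
qed

lemma conv_v_bound:
  assumes v: "v \<in> V \<Omega>" and w: "w \<in> V \<Omega>" and \<phi>: "\<phi> \<in> V \<Omega>"
    and a: "\<And>i. h10_norm \<Omega> (\<lambda>x. v x $ i) \<le> a" and b: "\<And>i. h10_norm \<Omega> (\<lambda>x. w x $ i) \<le> b"
    and c: "\<And>i. h10_norm \<Omega> (\<lambda>x. \<phi> x $ i) \<le> c"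
  shows "\<bar>conv_v v w \<phi>\<bar> \<le> 4 * emb\<^sup>2 * (a * b * c)"
proof -
  have "\<bar>conv_t v (\<lambda>x. w x $ k) (\<lambda>x. \<phi> x $ k)\<bar> \<le> 2 * emb\<^sup>2 * (a * b * c)" for k
    using b[of k] by (intro conv_t_bound v V_comp V_comp_H1 w \<phi> a c) (simp add: h10_norm_eq)
  then have "(\<Sum>k\<in>UNIV. \<bar>conv_t v (\<lambda>x. w x $ k) (\<lambda>x. \<phi> x $ k)\<bar>) \<le> (\<Sum>i\<in>(UNIV::2 set). 2 * emb\<^sup>2 * (a * b * c))" by (intro sum_mono)
  then show ?thesis unfolding conv_v_conv_t by (intro order_trans[OF sum_abs]) (simp add: mult.assoc)
qed

end

section \<open>The Boussinesq system\<close>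

context bounded_domain
begin

lemma fst_sub: "fst (E.sub U W) = (\<lambda>x. fst U x - fst W x)"
  by (auto simp: E.sub_def addP_def smulP_def)

lemma conv_t_diff1:
  assumes "v \<in> V \<Omega>" "w \<in> V \<Omega>" "\<tau> \<in> H1 \<Omega>" "\<psi> \<in> H10 \<Omega>"
  shows "conv_t (\<lambda>x. v x - w x) \<tau> \<psi> = conv_t v \<tau> \<psi> - conv_t w \<tau> \<psi>"
  using assms by (simp add: conv_t_def tri_diff1 V_comp sum_subtractf)

lemma conv_t_diff2:
  assumes "v \<in> V \<Omega>" "\<tau> \<in> H1 \<Omega>" "\<tau>' \<in> H1 \<Omega>" "\<psi> \<in> H10 \<Omega>"
  shows "conv_t v (\<lambda>x. \<tau> x - \<tau>' x) \<psi> = conv_t v \<tau> \<psi> - conv_t v \<tau>' \<psi>"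
  using assms by (simp add: conv_t_def tri_diff2 V_comp sum_subtractf)

lemma conv_t_add3:
  assumes "v \<in> V \<Omega>" "\<tau> \<in> H1 \<Omega>" "\<psi> \<in> H10 \<Omega>" "\<psi>' \<in> H10 \<Omega>"
  shows "conv_t v \<tau> (\<lambda>x. \<psi> x + \<psi>' x) = conv_t v \<tau> \<psi> + conv_t v \<tau> \<psi>'"
  using assms by (simp add: conv_t_def tri_add3 V_comp sum.distrib)

lemma conv_t_scale3: "conv_t v \<tau> (\<lambda>x. c * \<psi> x) = c * conv_t v \<tau> \<psi>"
  by (simp add: conv_t_def tri_scale3 sum_distrib_left)

lemma conv_v_diff1:
  assumes "v \<in> V \<Omega>" "w \<in> V \<Omega>" "z \<in> V \<Omega>" "\<phi> \<in> V \<Omega>"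
  shows "conv_v (\<lambda>x. v x - w x) z \<phi> = conv_v v z \<phi> - conv_v w z \<phi>"
  using assms by (simp add: conv_v_conv_t conv_t_diff1 V_comp V_comp_H1 sum_subtractf)

lemma conv_v_diff2:
  assumes "v \<in> V \<Omega>" "w \<in> V \<Omega>" "z \<in> V \<Omega>" "\<phi> \<in> V \<Omega>"
  shows "conv_v v (\<lambda>x. w x - z x) \<phi> = conv_v v w \<phi> - conv_v v z \<phi>"
  using assms by (simp add: conv_v_conv_t conv_t_diff2 V_comp V_comp_H1 sum_subtractf)

lemma conv_v_add3:
  assumes "v \<in> V \<Omega>" "w \<in> V \<Omega>" "\<phi> \<in> V \<Omega>" "\<phi>' \<in> V \<Omega>"
  shows "conv_v v w (\<lambda>x. \<phi> x + \<phi>' x) = conv_v v w \<phi> + conv_v v w \<phi>'"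
  using assms by (simp add: conv_v_conv_t conv_t_add3 V_comp V_comp_H1 sum.distrib)

lemma conv_v_scale3: "conv_v v w (\<lambda>x. c *\<^sub>R \<phi> x) = c * conv_v v w \<phi>"
  by (simp add: conv_v_conv_t conv_t_scale3 sum_distrib_left)

end

text \<open>The two equations are multiplied by \<open>Rey\<close> and \<open>Rey * Pra\<close>, so that the principal part becomes
  the energy form and every lower order term carries one of the small factors \<open>Rey\<close>,
  \<open>Rey * Pra\<close>, \<open>Gra / Rey\<close>, or comes from the boundary datum.\<close>

locale small_boussinesq = bounded_domain +
  fixes Rey Pra Gra :: real and g1 :: "(real^2 \<Rightarrow> real^2) \<Rightarrow> real" and g2 :: "(real^2 \<Rightarrow> real) \<Rightarrow> real"
    and Td :: "real^2 \<Rightarrow> real"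
  assumes Rey_pos: "0 < Rey" and Pra_pos: "0 < Pra" and Gra_pos: "0 < Gra"
    and Rey_small: "Rey < 1 / (64 * emb\<^sup>2)" and Pra_small: "Rey * Pra < 1 / (64 * emb\<^sup>2)"
    and Gra_small: "Gra / Rey < 1 / (64 * emb\<^sup>2)"
    and g1: "g1 \<in> dual_space (V \<Omega>) (V_norm \<Omega>)" and g2: "g2 \<in> dual_space (H10 \<Omega>) (h10_norm \<Omega>)"
    and Td: "Td \<in> H1 \<Omega>"
    and g1_small: "dual_norm (V \<Omega>) (V_norm \<Omega>) g1 < 1 / 16"
    and g2_small: "dual_norm (H10 \<Omega>) (h10_norm \<Omega>) g2 < 1 / 16"
    and Td_small: "h1_norm \<Omega> Td < 1 / 16"
begin

text \<open>What the scaled momentum equation leaves after the energy form of the velocity is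
  isolated; \<open>\<theta>\<close> stands for \<open>T - Td\<close>, and buoyancy sees only the
  second component of the test function because \<open>e_vec\<close> is the second unit
  vector.\<close>

definition rhs_v :: "(real^2 \<Rightarrow> real^2) \<Rightarrow> (real^2 \<Rightarrow> real) \<Rightarrow> (real^2 \<Rightarrow> real^2) \<Rightarrow> real" where
  "rhs_v v \<theta> \<phi> = Rey * g1 \<phi> - Rey * conv_v v v \<phi> + Gra / Rey * ip M (\<lambda>x. \<theta> x + Td x) (\<lambda>x. \<phi> x $ 2)"

definition rhs_t :: "(real^2 \<Rightarrow> real^2) \<Rightarrow> (real^2 \<Rightarrow> real) \<Rightarrow> (real^2 \<Rightarrow> real) \<Rightarrow> real" where
  "rhs_t v \<theta> \<psi> = Rey * Pra * g2 \<psi> - Rey * Pra * conv_t v \<theta> \<psi> - Rey * Pra * conv_t v Td \<psi> - energy Td \<psi>"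

text \<open>Adding the two equations loses nothing, since their test functions vary
  independently.\<close>

definition rhs :: "(real^2 \<Rightarrow> real^2) \<times> (real^2 \<Rightarrow> real) \<Rightarrow> (real^2 \<Rightarrow> real^2) \<times> (real^2 \<Rightarrow> real) \<Rightarrow> real" where
  "rhs U \<Phi> = rhs_v (fst U) (snd U) (fst \<Phi>) + rhs_t (fst U) (snd U) (snd \<Phi>)"

lemma emb_pos: "1 \<le> emb\<^sup>2"
  using emb power_mono[of 1 emb 2] by simp

text \<open>All smallness conditions enter through this cancellation of \<open>emb^2\<close>: 4 is
  the largest constant in front of a transport form, and \<open>4 / 64 = 1 / 16\<close>.\<close>

lemma small_mult: "0 \<le> x \<Longrightarrow> x < 1 / (64 * emb\<^sup>2) \<Longrightarrow> \<bar>y\<bar> \<le> 4 * emb\<^sup>2 * z \<Longrightarrow> \<bar>x * y\<bar> \<le> z / 16"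
proof -
  assume *: "0 \<le> x" "x < 1 / (64 * emb\<^sup>2)" "\<bar>y\<bar> \<le> 4 * emb\<^sup>2 * z"
  have "\<bar>x * y\<bar> = x * \<bar>y\<bar>" using *(1) by (simp add: abs_mult)
  also have "\<dots> \<le> 1 / (64 * emb\<^sup>2) * (4 * emb\<^sup>2 * z)" using * by (intro mult_mono) auto
  also have "\<dots> = z / 16" using emb by (auto simp: field_simps)
  finally show ?thesis .
qed

lemma small_mult': "0 \<le> x \<Longrightarrow> x < 1 / (64 * emb\<^sup>2) \<Longrightarrow> \<bar>y\<bar> \<le> z \<Longrightarrow> \<bar>x * y\<bar> \<le> z / 16"
proof (rule small_mult)
  assume "\<bar>y\<bar> \<le> z"
  moreover from this have "0 \<le> z" by linarith
  moreover have "1 \<le> 4 * emb\<^sup>2" using emb_pos by linarith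
  ultimately have "1 * z \<le> 4 * emb\<^sup>2 * z" by (intro mult_right_mono)
  with \<open>\<bar>y\<bar> \<le> z\<close> show "\<bar>y\<bar> \<le> 4 * emb\<^sup>2 * z" by linarith
qed

lemma nonneg: "0 \<le> Rey" "0 \<le> Rey * Pra" "0 \<le> Gra / Rey"
  using Rey_pos Pra_pos Gra_pos by auto

lemma nrm_le_emb: "u \<in> H10 \<Omega> \<Longrightarrow> h10_norm \<Omega> u \<le> a \<Longrightarrow> nrm M u \<le> emb * a"
  using emb mult_left_mono[of "h10_norm \<Omega> u" a emb] by (meson order_trans zero_le_one)

lemma Td_bounds: "nrm M Td \<le> 1 / 16" "nrm M (wgrad \<Omega> Td) \<le> 1 / 16"
  using h1_norm_ge[of Td] Td_small by auto

lemma force_bounds: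
  assumes \<Phi>: "\<Phi> \<in> V \<Omega> \<times> H10 \<Omega>"
  shows "\<bar>Rey * g1 (fst \<Phi>)\<bar> \<le> E.N \<Phi> / 256" and "\<bar>Rey * Pra * g2 (snd \<Phi>)\<bar> \<le> E.N \<Phi> / 256"
    and "\<bar>energy Td (snd \<Phi>)\<bar> \<le> E.N \<Phi> / 16"
proof -
  have f: "fst \<Phi> \<in> V \<Omega>" and s: "snd \<Phi> \<in> H10 \<Omega>" using \<Phi> by auto
  have V: "0 \<le> V_norm \<Omega> (fst \<Phi>)" "V_norm \<Omega> (fst \<Phi>) \<le> E.N \<Phi>"
  proof -
    show "0 \<le> V_norm \<Omega> (fst \<Phi>)" using f by (simp add: V_norm_eq sum_nonneg)
    have "(V_norm \<Omega> (fst \<Phi>))\<^sup>2 \<le> (E.N \<Phi>)\<^sup>2" unfolding N_sq_eq V_norm_sq[OF f] by simp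
    then show "V_norm \<Omega> (fst \<Phi>) \<le> E.N \<Phi>" by (rule power2_le_imp_le) simp
  qed
  have "\<bar>g1 (fst \<Phi>)\<bar> \<le> dual_norm (V \<Omega>) (V_norm \<Omega>) g1 * V_norm \<Omega> (fst \<Phi>)" by (rule V_dual_bound[OF g1 f])
  also have "\<dots> \<le> 1 / 16 * V_norm \<Omega> (fst \<Phi>)" using g1_small V(1) by (intro mult_right_mono) auto
  also have "\<dots> \<le> E.N \<Phi> / 16" using V(2) by simp
  finally show "\<bar>Rey * g1 (fst \<Phi>)\<bar> \<le> E.N \<Phi> / 256"
    using small_mult'[OF nonneg(1) Rey_small] by fastforce
  have "\<bar>g2 (snd \<Phi>)\<bar> \<le> dual_norm (H10 \<Omega>) (h10_norm \<Omega>) g2 * h10_norm \<Omega> (snd \<Phi>)" by (rule H10_dual_bound[OF g2 s])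
  also have "\<dots> \<le> 1 / 16 * h10_norm \<Omega> (snd \<Phi>)" using g2_small by (intro mult_right_mono) auto
  also have "\<dots> \<le> E.N \<Phi> / 16" using comp_le_N(2)[of \<Phi>] by simp
  finally show "\<bar>Rey * Pra * g2 (snd \<Phi>)\<bar> \<le> E.N \<Phi> / 256"
    using small_mult'[OF nonneg(2) Pra_small] by fastforce
  have "\<bar>energy Td (snd \<Phi>)\<bar> \<le> nrm M (wgrad \<Omega> Td) * nrm M (wgrad \<Omega> (snd \<Phi>))"
    by (rule energy_bound[OF Td H10_H1[OF s]])
  also have "\<dots> \<le> 1 / 16 * E.N \<Phi>"
    using Td_bounds(2) comp_le_N(2)[of \<Phi>] by (intro mult_mono) (auto simp: h10_norm_eq)
  finally show "\<bar>energy Td (snd \<Phi>)\<bar> \<le> E.N \<Phi> / 16" by simp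
qed

text \<open>Poincare's inequality on both factors costs \<open>emb^2\<close>, which the bound on
  \<open>Gra / Rey\<close> absorbs. The first factor enters through its norm alone, as it will be
  both the full temperature, which has nonzero boundary values, and a difference of zero-trace
  functions.\<close>

lemma coupling_bound:
  assumes \<Phi>: "\<Phi> \<in> V \<Omega> \<times> H10 \<Omega>" and \<theta>: "\<theta> \<in> sq_int M" and le: "nrm M \<theta> \<le> emb * a"
  shows "\<bar>Gra / Rey * ip M \<theta> (\<lambda>x. fst \<Phi> x $ 2)\<bar> \<le> a * E.N \<Phi> / 16"
proof -
  have c: "(\<lambda>x. fst \<Phi> x $ 2) \<in> H10 \<Omega>" using \<Phi> by (intro V_comp) auto
  have e: "0 < emb" using emb by linarith
  have a0: "0 \<le> a" using le nrm_nonneg[of M \<theta>] e by (smt (verit) mult_pos_neg)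
  have "\<bar>ip M \<theta> (\<lambda>x. fst \<Phi> x $ 2)\<bar> \<le> nrm M \<theta> * nrm M (\<lambda>x. fst \<Phi> x $ 2)"
    by (rule ip_Cauchy_Schwarz[OF \<theta> H10_sq_int[OF c]])
  also have "\<dots> \<le> (emb * a) * (emb * E.N \<Phi>)"
    using e a0 by (intro mult_mono le nrm_le_emb[OF c comp_le_N(1)]) auto
  also have "\<dots> = 1 * (emb\<^sup>2 * (a * E.N \<Phi>))" by (simp add: power2_eq_square)
  also have "\<dots> \<le> 4 * (emb\<^sup>2 * (a * E.N \<Phi>))" using a0 by (intro mult_right_mono) auto
  finally show ?thesis
    by (intro small_mult[OF nonneg(3) Gra_small]) simp
qed

lemma transport_bounds:
  assumes U: "U \<in> V \<Omega> \<times> H10 \<Omega>" and W: "W \<in> V \<Omega> \<times> H10 \<Omega>" and \<Phi>: "\<Phi> \<in> V \<Omega> \<times> H10 \<Omega>"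
  shows "\<bar>Rey * conv_v (fst U) (fst W) (fst \<Phi>)\<bar> \<le> E.N U * E.N W * E.N \<Phi> / 16"
    and "\<bar>Rey * Pra * conv_t (fst U) (snd W) (snd \<Phi>)\<bar> \<le> E.N U * E.N W * E.N \<Phi> / 16"
    and "\<bar>Rey * Pra * conv_t (fst U) Td (snd \<Phi>)\<bar> \<le> E.N U * E.N \<Phi> / 256"
proof -
  have v: "fst U \<in> V \<Omega>" "fst W \<in> V \<Omega>" "fst \<Phi> \<in> V \<Omega>" and s: "snd W \<in> H10 \<Omega>" "snd \<Phi> \<in> H10 \<Omega>"
    using U W \<Phi> by auto
  have "\<bar>conv_v (fst U) (fst W) (fst \<Phi>)\<bar> \<le> 4 * emb\<^sup>2 * (E.N U * E.N W * E.N \<Phi>)"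
    by (intro conv_v_bound v comp_le_N)
  then show "\<bar>Rey * conv_v (fst U) (fst W) (fst \<Phi>)\<bar> \<le> E.N U * E.N W * E.N \<Phi> / 16"
    by (rule small_mult[OF nonneg(1) Rey_small])
  have "\<bar>conv_t (fst U) (snd W) (snd \<Phi>)\<bar> \<le> 2 * emb\<^sup>2 * (E.N U * E.N W * E.N \<Phi>)"
    using comp_le_N(2)[of W] by (intro conv_t_bound v s comp_le_N H10_H1) (simp add: h10_norm_eq)
  also have "\<dots> \<le> 4 * emb\<^sup>2 * (E.N U * E.N W * E.N \<Phi>)" by (intro mult_right_mono) auto
  finally show "\<bar>Rey * Pra * conv_t (fst U) (snd W) (snd \<Phi>)\<bar> \<le> E.N U * E.N W * E.N \<Phi> / 16"
    by (rule small_mult[OF nonneg(2) Pra_small])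
  have "\<bar>conv_t (fst U) Td (snd \<Phi>)\<bar> \<le> 2 * emb\<^sup>2 * (E.N U * (1 / 16) * E.N \<Phi>)"
    by (intro conv_t_bound v s comp_le_N Td Td_bounds)
  also have "\<dots> \<le> 4 * emb\<^sup>2 * (E.N U * (1 / 16) * E.N \<Phi>)" by (intro mult_right_mono) auto
  finally have "\<bar>Rey * Pra * conv_t (fst U) Td (snd \<Phi>)\<bar> \<le> E.N U * (1 / 16) * E.N \<Phi> / 16"
    by (rule small_mult[OF nonneg(2) Pra_small])
  then show "\<bar>Rey * Pra * conv_t (fst U) Td (snd \<Phi>)\<bar> \<le> E.N U * E.N \<Phi> / 256" by simp
qed

lemma temperature_bound:
  assumes U: "U \<in> V \<Omega> \<times> H10 \<Omega>"
  shows "(\<lambda>x. snd U x + Td x) \<in> sq_int M" and "nrm M (\<lambda>x. snd U x + Td x) \<le> emb * (E.N U + 1 / 16)"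
proof -
  have s: "snd U \<in> H10 \<Omega>" using U by auto
  show "(\<lambda>x. snd U x + Td x) \<in> sq_int M" by (intro sq_int_add H10_sq_int s H1_sq_int Td)
  have "nrm M (\<lambda>x. snd U x + Td x) \<le> nrm M (snd U) + nrm M Td"
    by (intro nrm_add H10_sq_int s H1_sq_int Td)
  also have "\<dots> \<le> emb * E.N U + 1 / 16" by (intro add_mono nrm_le_emb s comp_le_N Td_bounds)
  \<comment> \<open>By \<open>emb \<ge> 1\<close>; it gives the bound the form
    \<open>emb * a\<close> expected by \<open>coupling_bound\<close>.\<close>
  also have "\<dots> \<le> emb * E.N U + emb * (1 / 16)" using emb by simp
  finally show "nrm M (\<lambda>x. snd U x + Td x) \<le> emb * (E.N U + 1 / 16)" by (simp add: distrib_left)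
qed

lemma rhs_bound:
  assumes U: "U \<in> V \<Omega> \<times> H10 \<Omega>" and \<Phi>: "\<Phi> \<in> V \<Omega> \<times> H10 \<Omega>" and N: "E.N U \<le> 1"
  shows "\<bar>rhs U \<Phi>\<bar> \<le> E.N \<Phi>"
proof -
  have "E.N U * E.N \<Phi> \<le> 1 * E.N \<Phi>" using N by (intro mult_right_mono) auto
  moreover have "E.N U * E.N U * E.N \<Phi> \<le> 1 * E.N \<Phi>" using N by (intro mult_right_mono mult_le_one) auto
  moreover have "(E.N U + 1 / 16) * E.N \<Phi> \<le> 17 / 16 * E.N \<Phi>" using N by (intro mult_right_mono) auto
  \<comment> \<open>In units of \<open>1 / 256\<close>: 1 for each external force, 16 for the energy
    of \<open>Td\<close>, 17 for the coupling, 16 for each nonlinear transport term and 1 for the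
    transport of \<open>Td\<close>; the total of 68 is well below 256.\<close>
  ultimately show ?thesis
    using force_bounds[OF \<Phi>] coupling_bound[OF \<Phi> temperature_bound[OF U]] transport_bounds[OF U U \<Phi>] N_nonneg'[of \<Phi>]
    unfolding rhs_def rhs_v_def rhs_t_def abs_le_iff by (intro conjI; linarith)
qed

lemma rhs_lipschitz:
  assumes U: "U \<in> V \<Omega> \<times> H10 \<Omega>" and W: "W \<in> V \<Omega> \<times> H10 \<Omega>" and \<Phi>: "\<Phi> \<in> V \<Omega> \<times> H10 \<Omega>"
    and NU: "E.N U \<le> 1" and NW: "E.N W \<le> 1"
  shows "\<bar>rhs U \<Phi> - rhs W \<Phi>\<bar> \<le> 1 / 2 * E.N (E.sub U W) * E.N \<Phi>"
proof -
  let ?D = "E.sub U W"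
  let ?d = "E.N ?D * E.N \<Phi>"
  have D: "?D \<in> V \<Omega> \<times> H10 \<Omega>" by (rule E.sub_closed[OF U W])
  have v: "fst U \<in> V \<Omega>" "fst W \<in> V \<Omega>" "fst \<Phi> \<in> V \<Omega>" and s: "snd U \<in> H10 \<Omega>" "snd W \<in> H10 \<Omega>" "snd \<Phi> \<in> H10 \<Omega>"
    using U W \<Phi> by auto
  \<comment> \<open>The difference of a quadratic expression is split by bilinearity: the difference
    of the arguments is inserted once in the transporting place and once in the transported
    place.\<close>
  have c1: "conv_v (fst U) (fst U) (fst \<Phi>) - conv_v (fst W) (fst W) (fst \<Phi>)
      = conv_v (fst ?D) (fst U) (fst \<Phi>) + conv_v (fst W) (fst ?D) (fst \<Phi>)"
    unfolding fst_sub using v by (simp add: conv_v_diff1 conv_v_diff2)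
  have c2: "conv_t (fst U) (snd U) (snd \<Phi>) - conv_t (fst W) (snd W) (snd \<Phi>)
      = conv_t (fst ?D) (snd U) (snd \<Phi>) + conv_t (fst W) (snd ?D) (snd \<Phi>)"
    unfolding fst_sub sub_comp(2) using v s by (simp add: conv_t_diff1 conv_t_diff2 H10_H1)
  have c3: "conv_t (fst U) Td (snd \<Phi>) - conv_t (fst W) Td (snd \<Phi>) = conv_t (fst ?D) Td (snd \<Phi>)"
    unfolding fst_sub using v s Td by (simp add: conv_t_diff1)
  have c4: "ip M (\<lambda>x. snd U x + Td x) (\<lambda>x. fst \<Phi> x $ 2) - ip M (\<lambda>x. snd W x + Td x) (\<lambda>x. fst \<Phi> x $ 2)
      = ip M (snd ?D) (\<lambda>x. fst \<Phi> x $ 2)"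
  proof -
    have p: "(\<lambda>x. fst \<Phi> x $ 2) \<in> sq_int M" by (intro H10_sq_int V_comp v)
    have "ip M (\<lambda>x. snd U x + Td x) (\<lambda>x. fst \<Phi> x $ 2)
        = ip M (\<lambda>x. (snd U x - snd W x) + (snd W x + Td x)) (\<lambda>x. fst \<Phi> x $ 2)" by simp
    also have "\<dots> = ip M (\<lambda>x. snd U x - snd W x) (\<lambda>x. fst \<Phi> x $ 2) + ip M (\<lambda>x. snd W x + Td x) (\<lambda>x. fst \<Phi> x $ 2)"
      by (intro ip_add_left p temperature_bound W sq_int_diff H10_sq_int s)
    finally show ?thesis by (simp add: sub_comp(2))
  qed
  have "rhs U \<Phi> - rhs W \<Phi> =
      - (Rey * (conv_v (fst U) (fst U) (fst \<Phi>) - conv_v (fst W) (fst W) (fst \<Phi>)))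
      + Gra / Rey * (ip M (\<lambda>x. snd U x + Td x) (\<lambda>x. fst \<Phi> x $ 2) - ip M (\<lambda>x. snd W x + Td x) (\<lambda>x. fst \<Phi> x $ 2))
      - Rey * Pra * (conv_t (fst U) (snd U) (snd \<Phi>) - conv_t (fst W) (snd W) (snd \<Phi>))
      - Rey * Pra * (conv_t (fst U) Td (snd \<Phi>) - conv_t (fst W) Td (snd \<Phi>))"
    unfolding rhs_def rhs_v_def rhs_t_def right_diff_distrib by linarith
  then have eq: "rhs U \<Phi> - rhs W \<Phi> =
      - (Rey * conv_v (fst ?D) (fst U) (fst \<Phi>)) - Rey * conv_v (fst W) (fst ?D) (fst \<Phi>)
      + Gra / Rey * ip M (snd ?D) (\<lambda>x. fst \<Phi> x $ 2)
      - Rey * Pra * conv_t (fst ?D) (snd U) (snd \<Phi>) - Rey * Pra * conv_t (fst W) (snd ?D) (snd \<Phi>)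
      - Rey * Pra * conv_t (fst ?D) Td (snd \<Phi>)"
    unfolding c1 c2 c3 c4 distrib_left by linarith
  have "E.N ?D * E.N U * E.N \<Phi> \<le> ?d" "E.N W * E.N ?D * E.N \<Phi> \<le> ?d"
    using NU NW by (intro mult_right_mono mult_left_le mult_left_le_one_le; simp)+
  moreover have "\<bar>Gra / Rey * ip M (snd ?D) (\<lambda>x. fst \<Phi> x $ 2)\<bar> \<le> ?d / 16"
    using D by (intro coupling_bound[OF \<Phi>] H10_sq_int nrm_le_emb comp_le_N) auto
  moreover have "0 \<le> ?d" by simp
  \<comment> \<open>Four nonlinear transport terms and the coupling contribute \<open>1 / 16\<close>
    each and the transport of \<open>Td\<close> contributes \<open>1 / 256\<close>, which is less
    than \<open>1 / 2\<close> altogether.\<close>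
  ultimately have "\<bar>rhs U \<Phi> - rhs W \<Phi>\<bar> \<le> 1 / 2 * ?d"
    unfolding eq using transport_bounds[OF D U \<Phi>] transport_bounds[OF W D \<Phi>] by linarith
  then show ?thesis by (simp only: mult.assoc)
qed

lemma ip_H10_add:
  assumes "\<theta> \<in> sq_int M" "\<phi> \<in> H10 \<Omega>" "\<psi> \<in> H10 \<Omega>"
  shows "ip M \<theta> (\<lambda>x. \<phi> x + \<psi> x) = ip M \<theta> \<phi> + ip M \<theta> \<psi>"
  using ip_add_left[of \<phi> M \<psi> \<theta>] assms by (simp add: ip_commute[of M \<theta>] H10_sq_int)

lemma rhs_linear:
  assumes U: "U \<in> V \<Omega> \<times> H10 \<Omega>"
  shows "E.linear_fun (rhs U)"
proof -
  have v: "fst U \<in> V \<Omega>" and s: "snd U \<in> H10 \<Omega>" using U by auto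
  have ga: "g1 (\<lambda>x. \<phi> x + \<psi> x) = g1 \<phi> + g1 \<psi>" if "\<phi> \<in> V \<Omega>" "\<psi> \<in> V \<Omega>" for \<phi> \<psi>
    using g1 that by (simp add: dual_space_def)
  have gb: "g1 (\<lambda>x. c *\<^sub>R \<phi> x) = c * g1 \<phi>" if "\<phi> \<in> V \<Omega>" for c \<phi>
    using g1 that by (simp add: dual_space_def)
  have ha: "g2 (\<lambda>x. \<phi> x + \<psi> x) = g2 \<phi> + g2 \<psi>" if "\<phi> \<in> H10 \<Omega>" "\<psi> \<in> H10 \<Omega>" for \<phi> \<psi>
    using g2 that by (simp add: dual_space_def)
  have hb: "g2 (\<lambda>x. c * \<phi> x) = c * g2 \<phi>" if "\<phi> \<in> H10 \<Omega>" for c \<phi>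
    using g2 that by (simp add: dual_space_def)
  have ea: "energy Td (\<lambda>x. \<phi> x + \<psi> x) = energy Td \<phi> + energy Td \<psi>" if "\<phi> \<in> H10 \<Omega>" "\<psi> \<in> H10 \<Omega>" for \<phi> \<psi>
    unfolding energy_commute[of Td] by (intro energy_add H10_H1 that Td)
  have eb: "energy Td (\<lambda>x. c * \<phi> x) = c * energy Td \<phi>" if "\<phi> \<in> H10 \<Omega>" for c \<phi>
    unfolding energy_commute[of Td] by (intro energy_scale H10_H1 that Td)
  have ib: "ip M \<theta> (\<lambda>x. c * \<phi> x) = c * ip M \<theta> \<phi>" for \<theta> \<phi> :: "real^2 \<Rightarrow> real" and c
    unfolding ip_def by (subst integral_mult_right_zero[symmetric]) (simp add: mult_ac)
  show ?thesis unfolding E.linear_fun_def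
  proof (intro conjI ballI allI)
    fix \<Phi> \<Psi> assume \<Phi>: "\<Phi> \<in> V \<Omega> \<times> H10 \<Omega>" and \<Psi>: "\<Psi> \<in> V \<Omega> \<times> H10 \<Omega>"
    then have p: "fst \<Phi> \<in> V \<Omega>" "snd \<Phi> \<in> H10 \<Omega>" "fst \<Psi> \<in> V \<Omega>" "snd \<Psi> \<in> H10 \<Omega>" by auto
    have "ip M (\<lambda>x. snd U x + Td x) (\<lambda>x. fst \<Phi> x $ 2 + fst \<Psi> x $ 2)
       = ip M (\<lambda>x. snd U x + Td x) (\<lambda>x. fst \<Phi> x $ 2) + ip M (\<lambda>x. snd U x + Td x) (\<lambda>x. fst \<Psi> x $ 2)"
      by (intro ip_H10_add temperature_bound U V_comp p)
    then show "rhs U (addP \<Phi> \<Psi>) = rhs U \<Phi> + rhs U \<Psi>"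
      using p v s Td by (simp add: rhs_def rhs_v_def rhs_t_def addP_def ga ha ea conv_v_add3 conv_t_add3 H10_H1 distrib_left)
  next
    fix c \<Phi> assume \<Phi>: "\<Phi> \<in> V \<Omega> \<times> H10 \<Omega>"
    then have p: "fst \<Phi> \<in> V \<Omega>" "snd \<Phi> \<in> H10 \<Omega>" by auto
    show "rhs U (smulP c \<Phi>) = c * rhs U \<Phi>"
      using p by (simp add: rhs_def rhs_v_def rhs_t_def smulP_def gb hb eb ib conv_v_scale3 conv_t_scale3 distrib_left right_diff_distrib mult_ac)
  qed
qed

text \<open>Tested with the solution itself, the cubic terms vanish by antisymmetry. What remains is
  linear or quadratic in the norm, with a quadratic coefficient below 1, so a solution of any size
  is forced into the ball where the contraction argument applies.\<close>

lemma a_priori_bound: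
  assumes U: "U \<in> V \<Omega> \<times> H10 \<Omega>" and eq: "formP U U = rhs U U"
  shows "E.N U \<le> 1"
proof (rule ccontr)
  let ?n = "E.N U"
  assume "\<not> ?n \<le> 1"
  then have n: "1 < ?n" by simp
  have v: "fst U \<in> V \<Omega>" and s: "snd U \<in> H10 \<Omega>" using U by auto
  have "?n * ?n = rhs U U" using eq E.N_sq[OF U] by (simp add: power2_eq_square)
  also have "\<dots> \<le> ?n / 256 + (?n + 1 / 16) * ?n / 16 + ?n / 256 + ?n * ?n / 256 + ?n / 16"
    using force_bounds[OF U] coupling_bound[OF U temperature_bound[OF U]] transport_bounds(3)[OF U U U]
    unfolding rhs_def rhs_v_def rhs_t_def conv_v_zero[OF v] conv_t_zero[OF v s] mult_zero_right abs_le_iff by linarith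
  also have "(?n + 1 / 16) * ?n / 16 = ?n * ?n / 16 + ?n / 256" by (simp add: field_simps)
  finally have "?n * ?n \<le> ?n / 256 + (?n * ?n / 16 + ?n / 256) + ?n / 256 + ?n * ?n / 256 + ?n / 16" .
  moreover have "1 * ?n < ?n * ?n" using n by (intro mult_strict_right_mono) auto
  \<comment> \<open>The inequality amounts to \<open>256 * n^2 \<le> 17 * n^2 + 19 * n\<close>,
    impossible for \<open>n > 1\<close>.\<close>
  ultimately show False using n by linarith
qed

text \<open>The factors \<open>Rey\<close> and \<open>Rey * Pra\<close> are positive, so the scaling
  is reversible. The single equation on the product space splits back into the two original ones by
  testing with pairs one of whose components is zero, on which all forms and functionals
  vanish.\<close>

lemma weak_solution_iff:
  "weak_solution \<Omega> Rey Pra Gra g1 g2 Td v T \<longleftrightarrow>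
    (v, \<lambda>x. T x - Td x) \<in> V \<Omega> \<times> H10 \<Omega> \<and>
    (\<forall>\<Phi> \<in> V \<Omega> \<times> H10 \<Omega>. formP (v, \<lambda>x. T x - Td x) \<Phi> = rhs (v, \<lambda>x. T x - Td x) \<Phi>)"
proof (cases "v \<in> V \<Omega> \<and> (\<lambda>x. T x - Td x) \<in> H10 \<Omega>")
  case False
  then show ?thesis by (auto simp: weak_solution_def)
next
  case True
  define \<theta> where "\<theta> = (\<lambda>x. T x - Td x)"
  have v: "v \<in> V \<Omega>" and \<theta>: "\<theta> \<in> H10 \<Omega>" using True by (auto simp: \<theta>_def)
  have T\<theta>: "T = (\<lambda>x. \<theta> x + Td x)" by (auto simp: \<theta>_def)
  have TH: "T \<in> H1 \<Omega>" unfolding T\<theta> by (intro H1_add H10_H1 \<theta> Td)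
  let ?Ev = "\<lambda>\<phi>. \<Sum>j\<in>UNIV. energy (\<lambda>x. v x $ j) (\<lambda>x. \<phi> x $ j)"
  have mom: "((\<integral>x. (wjac \<Omega> v x *v v x) \<bullet> \<phi> x \<partial>M)
        + 1 / Rey * (\<integral>x. wjac \<Omega> v x \<bullet> wjac \<Omega> \<phi> x \<partial>M)
        - Gra / Rey\<^sup>2 * (\<integral>x. (T x *\<^sub>R e_vec) \<bullet> \<phi> x \<partial>M) = g1 \<phi>) \<longleftrightarrow> ?Ev \<phi> = rhs_v v \<theta> \<phi>" if \<phi>: "\<phi> \<in> V \<Omega>" for \<phi>
  proof -
    have e: "(\<integral>x. (T x *\<^sub>R e_vec) \<bullet> \<phi> x \<partial>M) = ip M T (\<lambda>x. \<phi> x $ 2)"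
      by (simp add: ip_def e_vec_def inner_axis')
    show ?thesis
      unfolding conv_v_integral[OF v v \<phi>] energy_v_integral[OF v \<phi>] rhs_v_def T\<theta>[symmetric]
    proof -
      have "r > 0 \<Longrightarrow> (a + 1 / r * b - q / r\<^sup>2 * c = d) \<longleftrightarrow> (b = r * d - r * a + q / r * c)" for a b c d q r :: real
        by (auto simp: divide_simps power2_eq_square) (auto simp: algebra_simps)
      from this[OF Rey_pos] show "(conv_v v v \<phi> + 1 / Rey * ?Ev \<phi> - Gra / Rey\<^sup>2 * (\<integral>x. (T x *\<^sub>R e_vec) \<bullet> \<phi> x \<partial>M) = g1 \<phi>)
        \<longleftrightarrow> ?Ev \<phi> = Rey * g1 \<phi> - Rey * conv_v v v \<phi> + Gra / Rey * ip M T (\<lambda>x. \<phi> x $ 2)"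
        unfolding e .
    qed
  qed
  have heat: "((\<integral>x. (v x \<bullet> wgrad \<Omega> T x) * \<psi> x \<partial>M)
        + 1 / (Rey * Pra) * (\<integral>x. wgrad \<Omega> T x \<bullet> wgrad \<Omega> \<psi> x \<partial>M) = g2 \<psi>) \<longleftrightarrow> energy \<theta> \<psi> = rhs_t v \<theta> \<psi>" if \<psi>: "\<psi> \<in> H10 \<Omega>" for \<psi>
  proof -
    have 1: "(\<integral>x. wgrad \<Omega> T x \<bullet> wgrad \<Omega> \<psi> x \<partial>M) = energy \<theta> \<psi> + energy Td \<psi>"
      using energy_add[OF H10_H1[OF \<theta>] Td H10_H1[OF \<psi>]] by (simp add: energy_def ip_def T\<theta>)
    have 2: "conv_t v T \<psi> = conv_t v \<theta> \<psi> + conv_t v Td \<psi>"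
      unfolding \<theta>_def using conv_t_diff2[OF v TH Td \<psi>] by simp
    have "s \<noteq> 0 \<Longrightarrow> ((a + a') + 1 / s * (b + c) = d) \<longleftrightarrow> (b = s * d - s * a - s * a' - c)" for a a' b c d s :: real
      by (auto simp: field_simps)
    moreover have "Rey * Pra \<noteq> 0" using Rey_pos Pra_pos by simp
    ultimately show ?thesis unfolding conv_t_integral[OF v TH \<psi>] 1 2 rhs_t_def .
  qed
  have split: "formP (v, \<theta>) (\<phi>, \<psi>) = rhs (v, \<theta>) (\<phi>, \<psi>) \<longleftrightarrow> ?Ev \<phi> + energy \<theta> \<psi> = rhs_v v \<theta> \<phi> + rhs_t v \<theta> \<psi>" for \<phi> \<psi>
    by (simp add: formP_def rhs_def)
  \<comment> \<open>The weak gradient of the zero function is determined only up to null sets, so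
    this follows from homogeneity instead of unfolding.\<close>
  have z1: "energy u (\<lambda>x. 0) = 0" if "u \<in> H1 \<Omega>" for u
    using energy_scale[OF H10_H1[OF H10_zero] that, of 0] energy_commute[of u "\<lambda>x. 0"] by simp
  have zv: "?Ev (\<lambda>x. 0) = 0" by (simp add: z1 V_comp_H1 v)
  have zt: "energy \<theta> (\<lambda>x. 0) = 0" by (intro z1 H10_H1 \<theta>)
  have zc: "conv_v w z (\<lambda>x. 0) = 0" "conv_t w \<tau> (\<lambda>x. 0) = 0" for w z \<tau>
    by (simp_all add: conv_v_def conv_t_def tri_def)
  have "\<forall>c. \<forall>\<phi>\<in>V \<Omega>. g1 (\<lambda>x. c *\<^sub>R \<phi> x) = c * g1 \<phi>" using g1 by (simp add: dual_space_def)
  from this[rule_format, OF V_zero, of 0] have "g1 (\<lambda>x. 0) = 0" by simp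
  moreover have "\<forall>c. \<forall>\<psi>\<in>H10 \<Omega>. g2 (\<lambda>x. c * \<psi> x) = c * g2 \<psi>" using g2 by (simp add: dual_space_def)
  from this[rule_format, OF H10_zero, of 0] have "g2 (\<lambda>x. 0) = 0" by simp
  ultimately have rv: "rhs_v v \<theta> (\<lambda>x. 0) = 0" and rt: "rhs_t v \<theta> (\<lambda>x. 0) = 0"
    by (simp_all add: rhs_v_def rhs_t_def zc z1 Td ip_def)
  have "(\<forall>\<Phi> \<in> V \<Omega> \<times> H10 \<Omega>. formP (v, \<theta>) \<Phi> = rhs (v, \<theta>) \<Phi>) \<longleftrightarrow>
      (\<forall>\<phi>\<in>V \<Omega>. ?Ev \<phi> = rhs_v v \<theta> \<phi>) \<and> (\<forall>\<psi>\<in>H10 \<Omega>. energy \<theta> \<psi> = rhs_t v \<theta> \<psi>)" (is "?L \<longleftrightarrow> ?R")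
  proof
    assume L: ?L
    show ?R
    proof (intro conjI ballI)
      show "?Ev \<phi> = rhs_v v \<theta> \<phi>" if "\<phi> \<in> V \<Omega>" for \<phi>
        using bspec[OF L, of "(\<phi>, \<lambda>x. 0)"] that H10_zero unfolding split by (simp add: zt rt)
      show "energy \<theta> \<psi> = rhs_t v \<theta> \<psi>" if "\<psi> \<in> H10 \<Omega>" for \<psi>
        using bspec[OF L, of "(\<lambda>x. 0, \<psi>)"] that V_zero unfolding split zv rv by simp
    qed
  next
    assume R: ?R
    show ?L
    proof
      fix \<Phi> assume "\<Phi> \<in> V \<Omega> \<times> H10 \<Omega>"
      then obtain \<phi> \<psi> where "\<Phi> = (\<phi>, \<psi>)" "\<phi> \<in> V \<Omega>" "\<psi> \<in> H10 \<Omega>" by auto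
      with R show "formP (v, \<theta>) \<Phi> = rhs (v, \<theta>) \<Phi>" by (simp add: split)
    qed
  qed
  then show ?thesis
    using v \<theta> TH mom heat unfolding weak_solution_def \<theta>_def[symmetric] by auto
qed

text \<open>Existence comes from the contraction on the unit ball. A competing solution lies in that
  ball by \<open>a_priori_bound\<close>, so the contractive uniqueness lemma applies to it.\<close>

theorem unique_weak_solution:
  "\<exists>v T. weak_solution \<Omega> Rey Pra Gra g1 g2 Td v T \<and>
    (\<forall>v' T'. weak_solution \<Omega> Rey Pra Gra g1 g2 Td v' T' \<longrightarrow> (AE x in M. v' x = v x \<and> T' x = T x))"
proof -
  obtain U where U: "U \<in> V \<Omega> \<times> H10 \<Omega>" "E.N U \<le> 1" and eqU: "\<And>\<Phi>. \<Phi> \<in> V \<Omega> \<times> H10 \<Omega> \<Longrightarrow> formP U \<Phi> = rhs U \<Phi>"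
    using E.contractive_Lax_Milgram[OF complete_energy rhs_linear rhs_bound rhs_lipschitz] by auto
  define v where "v = fst U"
  define T where "T = (\<lambda>x. snd U x + Td x)"
  have UT: "(v, \<lambda>x. T x - Td x) = U" by (simp add: v_def T_def)
  have sol: "weak_solution \<Omega> Rey Pra Gra g1 g2 Td v T"
    unfolding weak_solution_iff UT using U(1) eqU by blast
  have "AE x in M. v' x = v x \<and> T' x = T x" if sol': "weak_solution \<Omega> Rey Pra Gra g1 g2 Td v' T'" for v' T'
  proof -
    define W where "W = (v', \<lambda>x. T' x - Td x)"
    have W: "W \<in> V \<Omega> \<times> H10 \<Omega>" and eqW: "\<And>\<Phi>. \<Phi> \<in> V \<Omega> \<times> H10 \<Omega> \<Longrightarrow> formP W \<Phi> = rhs W \<Phi>"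
      using sol' unfolding weak_solution_iff W_def by blast+
    have NW: "E.N W \<le> 1" by (rule a_priori_bound[OF W eqW[OF W]])
    have N0: "E.N (E.sub W U) = 0"
      by (rule E.contractive_solution_unique[OF W NW eqW U eqU rhs_lipschitz[OF W U(1) _ NW U(2)]]) auto
    \<comment> \<open>Energy distance zero becomes equality almost everywhere through Poincare's
      inequality.\<close>
    have zero: "AE x in M. u x = 0" if "u \<in> H10 \<Omega>" "h10_norm \<Omega> u \<le> 0" for u
    proof -
      have "nrm M u \<le> 0" using nrm_le_emb[OF that] by simp
      then have "nrm M u = 0" using nrm_nonneg[of M u] by linarith
      then show ?thesis by (rule nrm_eq_0_AE[OF H10_sq_int[OF that(1)]])
    qed
    have D: "E.sub W U \<in> V \<Omega> \<times> H10 \<Omega>" by (rule E.sub_closed[OF W U(1)])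
    have DV: "fst (E.sub W U) \<in> V \<Omega>" using D by (simp add: mem_Times_iff)
    have "AE x in M. fst W x $ j - fst U x $ j = 0" for j
    proof -
      have "h10_norm \<Omega> (\<lambda>x. fst (E.sub W U) x $ j) \<le> 0" using comp_le_N(1)[of "E.sub W U" j] by (simp only: N0)
      from zero[OF V_comp[OF DV] this] show ?thesis by (simp add: fst_sub)
    qed
    then have "AE x in M. \<forall>j. fst W x $ j - fst U x $ j = 0" by (simp add: AE_all_countable)
    moreover have "AE x in M. snd W x - snd U x = 0"
    proof -
      have "h10_norm \<Omega> (snd (E.sub W U)) \<le> 0" using comp_le_N(2)[of "E.sub W U"] by (simp only: N0)
      moreover have "snd (E.sub W U) \<in> H10 \<Omega>" using D by (simp add: mem_Times_iff)
      ultimately have "AE x in M. snd (E.sub W U) x = 0" using zero by blast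
      then show ?thesis by (simp add: sub_comp(2))
    qed
    ultimately show ?thesis
      by eventually_elim (simp add: W_def v_def T_def vec_eq_iff)
  qed
  with sol show ?thesis by blast
qed

end

theorem theorem2p1:
  fixes \<Omega> \<Gamma> :: "(real^2) set"
  assumes "open \<Omega>" and "bounded \<Omega>" and "lipschitz_boundary \<Omega>"
    and "\<Gamma> \<subseteq> frontier \<Omega>" and "openin (top_of_set (frontier \<Omega>)) \<Gamma>" and "connected \<Gamma>"
    and "emeasure hausdorff1 \<Gamma> \<noteq> 0"
  shows "\<exists>\<epsilon>1>0. \<exists>\<epsilon>2>0. \<exists>\<epsilon>3>0. \<exists>\<delta>>0.
    \<forall>g1 \<in> dual_space (V \<Omega>) (V_norm \<Omega>). \<forall>g2 \<in> dual_space (H10 \<Omega>) (h10_norm \<Omega>). \<forall>Td \<in> H1 \<Omega>.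
    \<forall>Rey Pra Gra.
      zero_trace_on \<Omega> (frontier \<Omega> - \<Gamma>) Td \<longrightarrow>
      Rey \<in> {0<..<\<epsilon>1} \<longrightarrow> Pra \<in> {0<..<\<epsilon>2 / Rey} \<longrightarrow> Gra \<in> {0<..<\<epsilon>3 * Rey} \<longrightarrow>
      dual_norm (V \<Omega>) (V_norm \<Omega>) g1 < \<delta> \<longrightarrow> dual_norm (H10 \<Omega>) (h10_norm \<Omega>) g2 < \<delta> \<longrightarrow>
      h1_norm \<Omega> Td < \<delta> \<longrightarrow>
      (\<exists>v T. weak_solution \<Omega> Rey Pra Gra g1 g2 Td v T \<and>
        (\<forall>v' T'. weak_solution \<Omega> Rey Pra Gra g1 g2 Td v' T' \<longrightarrow>
          (AE x in lebesgue_on \<Omega>. v' x = v x \<and> T' x = T x)))"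
proof -
  interpret bounded_domain \<Omega> \<Gamma> by unfold_locales (use assms in auto)
  \<comment> \<open>One threshold for all three parameters. It depends on the domain only, through
    the embedding constant, and so can be fixed before data and parameters; the bound for the data
    is the absolute constant \<open>1 / 16\<close>.\<close>
  define \<kappa> where "\<kappa> = 1 / (64 * emb\<^sup>2)"
  have \<kappa>: "\<kappa> > 0" using emb by (auto simp: \<kappa>_def)
  show ?thesis
  proof (rule exI[of _ \<kappa>], intro conjI \<kappa>, rule exI[of _ \<kappa>], intro conjI \<kappa>, rule exI[of _ \<kappa>], intro conjI \<kappa>,
      rule exI[of _ "1 / 16"], intro conjI ballI allI impI)
    fix g1 g2 Td and Rey Pra Gra :: real
    assume "g1 \<in> dual_space (V \<Omega>) (V_norm \<Omega>)" "g2 \<in> dual_space (H10 \<Omega>) (h10_norm \<Omega>)" "Td \<in> H1 \<Omega>"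
      "dual_norm (V \<Omega>) (V_norm \<Omega>) g1 < 1 / 16" "dual_norm (H10 \<Omega>) (h10_norm \<Omega>) g2 < 1 / 16" "h1_norm \<Omega> Td < 1 / 16"
      and R: "Rey \<in> {0<..<\<kappa>}" "Pra \<in> {0<..<\<kappa> / Rey}" "Gra \<in> {0<..<\<kappa> * Rey}"
    moreover have "0 < Rey" "0 < Pra" "0 < Gra" "Rey < \<kappa>" "Rey * Pra < \<kappa>" "Gra / Rey < \<kappa>"
      using R by (auto simp: field_simps)
    ultimately interpret small_boussinesq \<Omega> \<Gamma> Rey Pra Gra g1 g2 Td
      by unfold_locales (simp_all add: \<kappa>_def)
    show "\<exists>v T. weak_solution \<Omega> Rey Pra Gra g1 g2 Td v T \<and>
        (\<forall>v' T'. weak_solution \<Omega> Rey Pra Gra g1 g2 Td v' T' \<longrightarrow>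
          (AE x in lebesgue_on \<Omega>. v' x = v x \<and> T' x = T x))"
      by (rule unique_weak_solution)
  qed simp
qed

end
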